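(* Let $r\ge 2$ and $\ell\ge r+1$ be integers, and let $F=K_{a_1,\ldots,a_r}$ be an almost balanced complete $r$-partite graph on $\ell=a_1+\cdots+a_r$ vertices. Let $m=m_{r,\ell}$. Then \[ i(F)=\kappa_F\cdot\frac{(m-1)_{r-1}}{m^{\ell-1}}. \] Moreover, there exists a constant $N_F$ such that for all $n\ge N_F$, the $m$-partite Turán graph $T_m(n)$ is the unique extremal graph for $I(F,n)$; that is, $I(F,T_m(n))=I(F,n)$ and every $n$-vertex graph $G$ with $I(F,G)=I(F,n)$ is isomorphic to $T_m(n)$.
   Context: For graphs $F,G$, $I(F,G)$ denotes the number of induced copies of $F$ in $G$, i.e. the number of subsets $S\subseteq V(G)$ with $|S|=v(F)$ such that $G[S]\cong F$. $I(F,n)=\max\{I(F,G): v(G)=n\}$ and the inducibility is $i(F)=\lim_{n\to\infty}I(F,n)/\binom{n}{v(F)}$. $K_{a_1,\ldots,a_r}$ denotes the complete $r$-partite graph with part sizes $a_1,\ldots,a_r$; we order $a_1\ge\cdots\ge a_r\ge 1$. Such an $F$ is called almost balanced if it is not a complete graph and $\binom{a_1-a_r}{2}<a_r$. The Turán graph $T_k(n)$ is the complete $k$-partite graph on $n$ vertices whose part sizes differ by at most one. For an integer $z$ and positive integer $k$, $(z)_k=z(z-1)\cdots(z-k+1)$ if $z>k-1$ and $(z)_k=0$ otherwise. Define $\kappa_F=\frac{\ell!}{a_1!\cdots a_r!\cdot \mathrm{sym}(a_1,\ldots,a_r)}$, where if $b_1,\ldots,b_t$ are the distinct values among $a_1,\ldots,a_r$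 with multiplicities $r_1,\ldots,r_t$, then $\mathrm{sym}(a_1,\ldots,a_r)=r_1!\cdots r_t!$. The integer $m_{r,\ell}$ is the unique integer $k\ge r$ maximizing $f(k)=\frac{(k-1)(k-2)\cdots(k-r+1)}{k^{\ell-1}}$ over all integers $k\ge r$ (this maximizer is unique). *)

theory Defs
  imports Complex_Main
begin

definition simple_graph :: "nat \<Rightarrow> (nat \<Rightarrow> nat \<Rightarrow> bool) \<Rightarrow> bool" where
  "simple_graph n E \<longleftrightarrow>
     (\<forall>i j. E i j \<longrightarrow> i < n \<and> j < n \<and> i \<noteq> j) \<and> (\<forall>i j. E i j \<longrightarrow> E j i)"

definition graph_iso :: "nat \<Rightarrow> (nat \<Rightarrow> nat \<Rightarrow> bool) \<Rightarrow> (nat \<Rightarrow> nat \<Rightarrow> bool) \<Rightarrow> bool" where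
  "graph_iso n E1 E2 \<longleftrightarrow>
     (\<exists>f. bij_betw f {0..<n} {0..<n} \<and> (\<forall>i<n. \<forall>j<n. E1 i j \<longleftrightarrow> E2 (f i) (f j)))"

definition induced_count ::
  "nat \<Rightarrow> (nat \<Rightarrow> nat \<Rightarrow> bool) \<Rightarrow> nat \<Rightarrow> (nat \<Rightarrow> nat \<Rightarrow> bool) \<Rightarrow> nat" where
  "induced_count k EF n EG = card {S. S \<subseteq> {0..<n} \<and> card S = k \<and>
     (\<exists>f. bij_betw f {0..<k} S \<and> (\<forall>i<k. \<forall>j<k. EF i j \<longleftrightarrow> EG (f i) (f j)))}"

definition max_induced :: "nat \<Rightarrow> (nat \<Rightarrow> nat \<Rightarrow> bool) \<Rightarrow> nat \<Rightarrow> nat" where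
  "max_induced k EF n = Max {induced_count k EF n E | E. simple_graph n E}"

text \<open>Complete multipartite graph K_{a_1,...,a_r}: vertex set {0..<sum a}, the
  p-th part (0-based) consists of the vertices in [a_1+..+a_p, a_1+..+a_{p+1}).\<close>
definition part_index :: "nat list \<Rightarrow> nat \<Rightarrow> nat" where
  "part_index a i = (LEAST p. i < sum_list (take (Suc p) a))"

definition complete_multipartite :: "nat list \<Rightarrow> nat \<Rightarrow> nat \<Rightarrow> bool" where
  "complete_multipartite a i j \<longleftrightarrow>
     i < sum_list a \<and> j < sum_list a \<and> part_index a i \<noteq> part_index a j"

text \<open>Turan graph T_k(n): vertex i lies in part (i mod k); parts differ in size by at most one.\<close>
definition turan :: "nat \<Rightarrow> nat \<Rightarrow> nat \<Rightarrow> nat \<Rightarrow> bool" where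
  "turan k n i j \<longleftrightarrow> i < n \<and> j < n \<and> i mod k \<noteq> j mod k"

definition falling :: "int \<Rightarrow> nat \<Rightarrow> int" where
  "falling z k = (if z > int k - 1 then (\<Prod>i<k. z - int i) else 0)"

definition sym_factor :: "nat list \<Rightarrow> nat" where
  "sym_factor a = (\<Prod>b\<in>set a. fact (count_list a b))"

definition kappa :: "nat list \<Rightarrow> real" where
  "kappa a = fact (sum_list a) / (real (\<Prod>x\<leftarrow>a. fact x) * real (sym_factor a))"

definition f_rl :: "nat \<Rightarrow> nat \<Rightarrow> nat \<Rightarrow> real" where
  "f_rl r l k = (\<Prod>i\<in>{1..<r}. real k - real i) / real k ^ (l - 1)"

definition m_rl :: "nat \<Rightarrow> nat \<Rightarrow> nat" where
  "m_rl r l = (THE k. r \<le> k \<and> (\<forall>j\<ge>r. f_rl r l j \<le> f_rl r l k))"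

text \<open>Almost balanced: not complete and binom(a_1-a_r,2) < a_r (a sorted non-increasingly).\<close>
definition almost_balanced :: "nat list \<Rightarrow> bool" where
  "almost_balanced a \<longleftrightarrow> \<not> (\<forall>x\<in>set a. x = 1) \<and> ((hd a - last a) choose 2) < last a"

end

(* Writing the number of copies of F in a complete multipartite graph with part sizes x_1, ..., x_k as a
   sum of products of binomial coefficients, and replacing binomials by monomials, gives a polynomial p
   on probability vectors. For two parts x, y with sum s put lambda = 4xy/s^2. Almost balancedness is
   exactly what is needed for
     p(x, y, R) <= lambda * p(s/2, s/2, R) + (1 - lambda) * p(s, 0, R).
   Hence from a near-optimal vector one can merge a smaller part q into a larger part x, multiplying the
   deficit by at most ((x + q) / (x - q))^2; as long as x - q stays bounded below, these factors multiply up
   to a constant, however many parts are merged. Since a single part has p = 0, a near-optimal vector must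
   consist of equal parts up to a small error, and then the number of parts is m. For large n, the first-order
   versions of the same inequality show that leftover small parts can be merged, and that vertices can be
   moved from a larger to a smaller part, with a strict gain in the exact count.

   Extremal graphs are closed under replacing a vertex by a clone of a non-neighbour. Collapsing twin
   classes leads to a complete multipartite extremal graph; at the last step before that, different
   choices of clones would give complete multipartite extremal graphs with different numbers of parts,
   unless the graph already was complete multipartite. *)
theory Submission
  imports Defs "HOL-Library.Multiset" "HOL-Library.FuncSet"
begin

text \<open>The number of parts is not bounded in advance, so there is no compact space of part
  sizes, and it is not known at the start that the supremum is attained. Merging replaces
  compactness: a merge of mass q multiplies the deficit by at most
  \<open>exp (4 * q / \<delta>)\<close>, and these factors multiply to at most
  \<open>exp (4 / \<delta>)\<close> because the merged mass is at most 1. Put h = (x+y)/2 and t =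
  (x-y)/(x+y); then lambda = 1 - t^2. Terms using one of the two parts are convex in t^2 and lie
  below their chord. A pair of sizes a >= b with d = a - b contributes (1 - t^2)^b times the even
  part of (1+t)^d. It takes d choose 2 factors 1 - t^2 to compensate that even part, and one more
  must be left over as lambda: this is the condition (d choose 2) < b. The strict gains for large n
  come from two vectors that are strictly worse than the equal one: one part halved, or two parts
  merged. Up to a positive factor, the first-order rates of the local moves are bounded below by
  these two finite differences.\<close>

section \<open>The copy count as a function of the part sizes\<close>

text \<open>The sum, over all ways to place parts of sizes \<open>M\<close> into distinct entries of \<open>xs\<close> (parts of equal size
  being indistinguishable), of the product of the weights \<open>w\<close>.\<close>

primrec psum :: "('x \<Rightarrow> nat \<Rightarrow> real) \<Rightarrow> nat multiset \<Rightarrow> 'x list \<Rightarrow> real" where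
  "psum w M [] = (if M = {#} then 1 else 0)"
| "psum w M (x # xs) = psum w M xs + (\<Sum>\<alpha>\<in>set_mset M. w x \<alpha> * psum w (M - {#\<alpha>#}) xs)"

definition cw :: "nat \<Rightarrow> nat \<Rightarrow> real" where "cw x \<alpha> = real (x choose \<alpha>)"

text \<open>The leading term of \<open>cw\<close> for large \<open>x\<close>. It is homogeneous in
  \<open>x\<close>, so part sizes can be rescaled to a probability vector.\<close>

definition pw :: "real \<Rightarrow> nat \<Rightarrow> real" where "pw x \<alpha> = x ^ \<alpha> / fact \<alpha>"

text \<open>Ordered pairs of values that can be removed from \<open>M\<close> together. Each pair of
  values occurs once, whatever the multiplicities, and \<open>(\<alpha>, \<alpha>)\<close> occurs
  only if \<open>\<alpha>\<close> has multiplicity at least 2.\<close>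

definition part_pairs :: "nat multiset \<Rightarrow> (nat \<times> nat) set" where
  "part_pairs M = Sigma (set_mset M) (\<lambda>\<alpha>. set_mset (M - {#\<alpha>#}))"

lemma finite_part_pairs [simp]: "finite (part_pairs M)"
  by (simp add: part_pairs_def)

lemma part_pairs_iff: "(\<alpha>, \<beta>) \<in> part_pairs M \<longleftrightarrow> {#\<alpha>, \<beta>#} \<subseteq># M"
  by (auto simp: part_pairs_def insert_subset_eq_iff)

lemma part_pairs_sym: "(\<alpha>, \<beta>) \<in> part_pairs M \<longleftrightarrow> (\<beta>, \<alpha>) \<in> part_pairs M"
  by (simp add: part_pairs_iff add_mset_commute)

lemma part_pairsD: "(\<alpha>, \<beta>) \<in> part_pairs M \<Longrightarrow> \<alpha> \<in># M \<and> \<beta> \<in># M"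
  by (auto simp: part_pairs_def dest: in_diffD)

lemma sum_part_pairs_swap:
  "(\<Sum>(\<alpha>, \<beta>)\<in>part_pairs M. f \<alpha> \<beta>) = (\<Sum>(\<alpha>, \<beta>)\<in>part_pairs M. f \<beta> \<alpha>)"
  by (rule sum.reindex_bij_witness[where i = "\<lambda>(a, b). (b, a)" and j = "\<lambda>(a, b). (b, a)"])
     (auto intro: part_pairs_sym[THEN iffD1])

lemma sum_part_pairs_symmetrize:
  fixes f :: "nat \<Rightarrow> nat \<Rightarrow> real"
  assumes "\<And>\<alpha> \<beta>. c \<alpha> \<beta> = c \<beta> \<alpha>"
  shows "2 * (\<Sum>(\<alpha>, \<beta>)\<in>part_pairs M. f \<alpha> \<beta> * c \<alpha> \<beta>)
       = (\<Sum>(\<alpha>, \<beta>)\<in>part_pairs M. (f \<alpha> \<beta> + f \<beta> \<alpha>) * c \<alpha> \<beta>)"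
proof -
  have "(\<Sum>(\<alpha>, \<beta>)\<in>part_pairs M. f \<alpha> \<beta> * c \<alpha> \<beta>) = (\<Sum>(\<alpha>, \<beta>)\<in>part_pairs M. f \<beta> \<alpha> * c \<alpha> \<beta>)"
    by (subst sum_part_pairs_swap) (simp add: assms)
  then show ?thesis
    by (simp add: case_prod_unfold distrib_right sum.distrib)
qed

text \<open>Sorts the placements by whether none, one or both of the first two entries are
  used.\<close>

lemma psum_two:
  "psum w M (x # y # R) = psum w M R
     + (\<Sum>\<alpha>\<in>set_mset M. (w x \<alpha> + w y \<alpha>) * psum w (M - {#\<alpha>#}) R)
     + (\<Sum>(\<alpha>, \<beta>)\<in>part_pairs M. w x \<alpha> * w y \<beta> * psum w (M - {#\<alpha>#} - {#\<beta>#}) R)"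
proof -
  have "(\<Sum>(\<alpha>, \<beta>)\<in>part_pairs M. w x \<alpha> * w y \<beta> * psum w (M - {#\<alpha>#} - {#\<beta>#}) R)
      = (\<Sum>\<alpha>\<in>set_mset M. w x \<alpha> * (\<Sum>\<beta>\<in>set_mset (M - {#\<alpha>#}). w y \<beta> * psum w (M - {#\<alpha>#} - {#\<beta>#}) R))"
    unfolding part_pairs_def by (subst sum.Sigma[symmetric]) (auto simp: sum_distrib_left mult.assoc)
  then show ?thesis
    by (simp add: distrib_left distrib_right sum.distrib algebra_simps)
qed

lemma psum_swap: "psum w M (x # y # R) = psum w M (y # x # R)"
  unfolding psum_two
  by (subst (2) sum_part_pairs_swap) (simp add: add.commute mult.commute diff_right_commute)

lemma psum_Cons_cong: "(\<And>M. psum w M xs = psum w M ys) \<Longrightarrow> psum w M (x # xs) = psum w M (x # ys)"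
  by simp

lemma psum_insert: "psum w M (xs @ x # ys) = psum w M (x # xs @ ys)"
proof (induction xs arbitrary: M)
  case (Cons y xs)
  have "psum w M (y # (xs @ x # ys)) = psum w M (y # x # xs @ ys)"
    by (rule psum_Cons_cong) (rule Cons.IH)
  also have "\<dots> = psum w M (x # y # xs @ ys)"
    by (rule psum_swap)
  finally show ?case by simp
qed simp

lemma psum_mset_cong:
  assumes "mset xs = mset ys"
  shows "psum w M xs = psum w M ys"
  using assms
proof (induction xs arbitrary: ys M)
  case (Cons x xs)
  then have "x \<in> set ys"
    by (metis list.set_intros(1) mset_eq_setD)
  then obtain us vs where ys: "ys = us @ x # vs"
    by (auto dest: split_list)
  then have "mset xs = mset (us @ vs)"
    using Cons.prems by simp
  then have "psum w M (x # xs) = psum w M (x # us @ vs)"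
    by (intro psum_Cons_cong) (rule Cons.IH)
  then show ?case
    by (simp only: ys psum_insert)
qed simp

lemma psum_mono:
  assumes "list_all2 (\<lambda>x y. \<forall>\<alpha>\<in>#M. 0 \<le> w x \<alpha> \<and> w x \<alpha> \<le> v y \<alpha>) xs ys"
  shows "0 \<le> psum w M xs \<and> psum w M xs \<le> psum v M ys"
proof -
  \<comment> \<open>The fixed set \<open>A\<close> keeps the hypothesis on the weights unchanged
    while the induction removes elements from \<open>M\<close>.\<close>
  define A where "A = set_mset M"
  have "list_all2 (\<lambda>x y. \<forall>\<alpha>\<in>A. 0 \<le> w x \<alpha> \<and> w x \<alpha> \<le> v y \<alpha>) xs ys"
    using assms by (simp add: A_def)
  moreover have "set_mset M \<subseteq> A" by (simp add: A_def)
  ultimately show ?thesis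
  proof (induction xs ys arbitrary: M rule: list_all2_induct)
    case (Cons x xs y ys)
    have IH: "0 \<le> psum w (M - {#\<alpha>#}) xs \<and> psum w (M - {#\<alpha>#}) xs \<le> psum v (M - {#\<alpha>#}) ys" for \<alpha>
      using Cons.prems by (intro Cons.IH) (auto dest: in_diffD)
    have "0 \<le> psum w M xs \<and> psum w M xs \<le> psum v M ys"
      using Cons.prems by (intro Cons.IH)
    moreover have "0 \<le> (\<Sum>\<alpha>\<in>set_mset M. w x \<alpha> * psum w (M - {#\<alpha>#}) xs)"
      using Cons.hyps Cons.prems IH by (intro sum_nonneg) auto
    moreover have "(\<Sum>\<alpha>\<in>set_mset M. w x \<alpha> * psum w (M - {#\<alpha>#}) xs)
        \<le> (\<Sum>\<alpha>\<in>set_mset M. v y \<alpha> * psum v (M - {#\<alpha>#}) ys)"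
    proof (rule sum_mono)
      fix \<alpha> assume "\<alpha> \<in># M"
      then have "0 \<le> w x \<alpha>" "w x \<alpha> \<le> v y \<alpha>" using Cons.hyps Cons.prems by auto
      then show "w x \<alpha> * psum w (M - {#\<alpha>#}) xs \<le> v y \<alpha> * psum v (M - {#\<alpha>#}) ys"
        using IH[of \<alpha>] by (intro mult_mono) auto
    qed
    ultimately show ?case by simp
  qed simp
qed

lemma psum_nonneg:
  assumes "\<And>x \<alpha>. x \<in> set xs \<Longrightarrow> \<alpha> \<in># M \<Longrightarrow> 0 \<le> w x \<alpha>"
  shows "0 \<le> psum w M xs"
  using psum_mono[of M w w xs xs] assms by (auto simp: list_all2_same)

lemma psum_Cons_ge:
  assumes "\<And>y \<alpha>. y \<in> set (x # xs) \<Longrightarrow> \<alpha> \<in># M \<Longrightarrow> 0 \<le> w y \<alpha>"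
  shows "psum w M xs \<le> psum w M (x # xs)"
proof -
  have "0 \<le> (\<Sum>\<alpha>\<in>set_mset M. w x \<alpha> * psum w (M - {#\<alpha>#}) xs)"
    using assms by (intro sum_nonneg mult_nonneg_nonneg psum_nonneg) (auto dest: in_diffD)
  then show ?thesis by simp
qed

lemma psum_append_ge:
  assumes "\<And>y \<alpha>. y \<in> set (xs @ ys) \<Longrightarrow> \<alpha> \<in># M \<Longrightarrow> 0 \<le> w y \<alpha>"
  shows "psum w M ys \<le> psum w M (xs @ ys)"
  using assms
proof (induction xs)
  case (Cons x xs)
  then have "psum w M ys \<le> psum w M (xs @ ys)" by auto
  also have "\<dots> \<le> psum w M (x # xs @ ys)"
    using Cons.prems by (intro psum_Cons_ge) auto
  finally show ?case by simp
qed simp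

text \<open>Every placement puts \<open>\<gamma>\<close> into some entry. Choosing that entry first
  and letting the other sizes go anywhere, that entry included, only adds nonnegative terms.\<close>

lemma psum_le_remove_part:
  assumes "\<And>x \<alpha>. x \<in> set xs \<Longrightarrow> 0 \<le> w x \<alpha>" and "\<gamma> \<in># M"
  shows "psum w M xs \<le> (\<Sum>x\<leftarrow>xs. w x \<gamma>) * psum w (M - {#\<gamma>#}) xs"
  using assms
proof (induction xs arbitrary: M)
  case (Cons x xs)
  define T where "T = (\<Sum>x\<leftarrow>xs. w x \<gamma>)"
  have nn: "0 \<le> w x \<alpha>" "0 \<le> psum w N xs" for \<alpha> N
    using Cons.prems by (auto intro!: psum_nonneg)
  have T0: "0 \<le> T" unfolding T_def using Cons.prems by (intro sum_list_nonneg) auto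
  have IH: "psum w N xs \<le> T * psum w (N - {#\<gamma>#}) xs" if "\<gamma> \<in># N" for N
    unfolding T_def using Cons.prems that by (intro Cons.IH) auto
  have "(\<Sum>\<alpha>\<in>set_mset M. w x \<alpha> * psum w (M - {#\<alpha>#}) xs)
      = w x \<gamma> * psum w (M - {#\<gamma>#}) xs + (\<Sum>\<alpha>\<in>set_mset M - {\<gamma>}. w x \<alpha> * psum w (M - {#\<alpha>#}) xs)"
    using Cons.prems by (subst sum.remove[of _ \<gamma>]) auto
  also have "(\<Sum>\<alpha>\<in>set_mset M - {\<gamma>}. w x \<alpha> * psum w (M - {#\<alpha>#}) xs)
      \<le> (\<Sum>\<alpha>\<in>set_mset M - {\<gamma>}. w x \<alpha> * (T * psum w (M - {#\<gamma>#} - {#\<alpha>#}) xs))"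
  proof (intro sum_mono mult_left_mono nn)
    fix \<alpha> assume "\<alpha> \<in> set_mset M - {\<gamma>}"
    then have "\<gamma> \<in># M - {#\<alpha>#}"
      using Cons.prems by (simp add: in_diff_count)
    from IH[OF this] show "psum w (M - {#\<alpha>#}) xs \<le> T * psum w (M - {#\<gamma>#} - {#\<alpha>#}) xs"
      by (simp add: add_mset_commute)
  qed
  also have "\<dots> \<le> (\<Sum>\<alpha>\<in>set_mset (M - {#\<gamma>#}). w x \<alpha> * (T * psum w (M - {#\<gamma>#} - {#\<alpha>#}) xs))"
  proof (rule sum_mono2)
    show "set_mset M - {\<gamma>} \<subseteq> set_mset (M - {#\<gamma>#})" 
    proof
      fix \<alpha> assume "\<alpha> \<in> set_mset M - {\<gamma>}"
      then have "\<alpha> \<noteq> \<gamma>" "0 < count M \<alpha>" by auto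
      then show "\<alpha> \<in># M - {#\<gamma>#}" by (simp add: in_diff_count)
    qed
  qed (auto intro!: mult_nonneg_nonneg nn T0)
  also have "\<dots> = T * (\<Sum>\<alpha>\<in>set_mset (M - {#\<gamma>#}). w x \<alpha> * psum w (M - {#\<gamma>#} - {#\<alpha>#}) xs)"
    by (simp add: sum_distrib_left mult_ac)
  also have "\<dots> \<le> (T + w x \<gamma>) * (\<Sum>\<alpha>\<in>set_mset (M - {#\<gamma>#}). w x \<alpha> * psum w (M - {#\<gamma>#} - {#\<alpha>#}) xs)"
    by (intro mult_right_mono sum_nonneg mult_nonneg_nonneg nn) (auto intro: nn)
  finally have "psum w M (x # xs) \<le> T * psum w (M - {#\<gamma>#}) xs + w x \<gamma> * psum w (M - {#\<gamma>#}) xs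
      + (T + w x \<gamma>) * (\<Sum>\<alpha>\<in>set_mset (M - {#\<gamma>#}). w x \<alpha> * psum w (M - {#\<gamma>#} - {#\<alpha>#}) xs)"
    using IH[OF Cons.prems(2)] by simp
  also have "\<dots> = (\<Sum>x\<leftarrow>x # xs. w x \<gamma>) * psum w (M - {#\<gamma>#}) (x # xs)"
    by (simp add: T_def algebra_simps)
  finally show ?case .
qed auto

lemma psum_zero_part:
  assumes "\<And>\<alpha>. \<alpha> \<in># M \<Longrightarrow> w x \<alpha> = 0"
  shows "psum w M (x # xs) = psum w M xs"
  using assms by simp

lemma psum_size_gt_length: "length xs < size M \<Longrightarrow> psum w M xs = 0"
proof (induction xs arbitrary: M)
  case (Cons x xs)
  have "psum w (M - {#\<alpha>#}) xs = 0" if "\<alpha> \<in># M" for \<alpha>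
    using Cons that by (intro Cons.IH) (auto simp: size_Diff_singleton)
  then show ?case using Cons by auto
qed auto

lemma psum_scale:
  assumes "\<And>x \<alpha>. x \<in> set xs \<Longrightarrow> w (g x) \<alpha> = c ^ \<alpha> * v x \<alpha>"
  shows "psum w M (map g xs) = c ^ sum_mset M * psum v M xs"
  using assms
proof (induction xs arbitrary: M)
  case (Cons x xs)
  have *: "c ^ \<alpha> * c ^ sum_mset (M - {#\<alpha>#}) = c ^ sum_mset M" if "\<alpha> \<in># M" for \<alpha>
    using that by (simp add: power_add[symmetric] sum_mset.remove[symmetric])
  have "(\<Sum>\<alpha>\<in>set_mset M. w (g x) \<alpha> * psum w (M - {#\<alpha>#}) (map g xs))
      = (\<Sum>\<alpha>\<in>set_mset M. c ^ sum_mset M * (v x \<alpha> * psum v (M - {#\<alpha>#}) xs))"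
  proof (rule sum.cong[OF refl])
    fix \<alpha> assume "\<alpha> \<in># M"
    from *[OF this] have "c ^ sum_mset M = c ^ \<alpha> * c ^ sum_mset (M - {#\<alpha>#})" by simp
    then show "w (g x) \<alpha> * psum w (M - {#\<alpha>#}) (map g xs) = c ^ sum_mset M * (v x \<alpha> * psum v (M - {#\<alpha>#}) xs)"
      by (simp add: Cons.prems Cons.IH)
  qed
  moreover have "psum w M (map g xs) = c ^ sum_mset M * psum v M xs"
    using Cons.prems by (intro Cons.IH) auto
  ultimately show ?case by (simp add: distrib_left sum_distrib_left)
qed auto

text \<open>With equal entries only the number of placements matters. Ordered placements are counted
  by a falling factorial, and permuting equal sizes identifies them in groups of size the product of
  the \<open>fact (count M \<alpha>)\<close>.\<close>

lemma psum_replicate: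
  "psum w M (replicate k z) * (\<Prod>\<alpha>\<in>set_mset M. fact (count M \<alpha>))
     = (\<Prod>\<alpha>\<in>#M. w z \<alpha>) * (\<Prod>i<size M. real k - real i)"
proof (induction k arbitrary: M)
  case 0
  show ?case
  proof (cases "M = {#}")
    case False
    then have "0 < size M" by (simp add: nonempty_has_size)
    then show ?thesis using False by (auto intro!: prod_zero)
  qed simp
next
  case (Suc k)
  define s where "s N = (\<Prod>\<alpha>\<in>set_mset N. fact (count N \<alpha>) :: real)" for N :: "nat multiset"
  define W where "W N = (\<Prod>\<alpha>\<in>#N. w z \<alpha>)" for N
  define ff where "ff k r = (\<Prod>i<r. real k - real i)" for k r
  have s_rem: "s M = count M \<alpha> * s (M - {#\<alpha>#})" if "\<alpha> \<in># M" for \<alpha>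
  proof -
    have "s (M - {#\<alpha>#}) = (\<Prod>\<beta>\<in>set_mset M. fact (count (M - {#\<alpha>#}) \<beta>))"
      unfolding s_def by (rule prod.mono_neutral_left) (auto dest: in_diffD simp: not_in_iff)
    also have "\<dots> = fact (count M \<alpha> - 1) * (\<Prod>\<beta>\<in>set_mset M - {\<alpha>}. fact (count M \<beta>))"
      using that by (subst prod.remove[of _ \<alpha>]) auto
    finally have "real (count M \<alpha>) * s (M - {#\<alpha>#})
        = (real (count M \<alpha>) * fact (count M \<alpha> - 1)) * (\<Prod>\<beta>\<in>set_mset M - {\<alpha>}. fact (count M \<beta>))"
      by simp
    also have "real (count M \<alpha>) * fact (count M \<alpha> - 1) = fact (count M \<alpha>)"
      using that by (simp add: fact_reduce)
    also have "\<dots> * (\<Prod>\<beta>\<in>set_mset M - {\<alpha>}. fact (count M \<beta>)) = s M"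
      unfolding s_def using that by (subst (2) prod.remove[of _ \<alpha>]) auto
    finally show ?thesis by simp
  qed
  \<comment> \<open>Pascal's rule for falling factorials. Its factor \<open>r\<close> is matched
    below by the sum of the multiplicities, which is \<open>size M\<close>.\<close>
  have ff_Suc: "ff (Suc k) r = ff k r + r * ff k (r - 1)" for r
  proof (induction r)
    case (Suc r)
    show ?case
    proof (cases r)
      case r: (Suc r')
      have "ff (Suc k) (Suc r) = ff (Suc k) r * (real k + 1 - real r)" by (simp add: ff_def)
      also have "\<dots> = (ff k r + r * ff k r') * (real k + 1 - real r)" using Suc r by simp
      also have "\<dots> = ff k r * (real k + 1 - real r) + r * ff k r"
        by (simp add: ff_def r algebra_simps)
      also have "\<dots> = ff k (Suc r) + Suc r * ff k (Suc r - 1)" by (simp add: ff_def algebra_simps)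
      finally show ?thesis .
    qed (simp add: ff_def)
  qed (simp add: ff_def)
  have "psum w M (replicate (Suc k) z) * s M
      = psum w M (replicate k z) * s M + (\<Sum>\<alpha>\<in>set_mset M. w z \<alpha> * psum w (M - {#\<alpha>#}) (replicate k z) * s M)"
    by (simp add: distrib_right sum_distrib_right)
  also have "(\<Sum>\<alpha>\<in>set_mset M. w z \<alpha> * psum w (M - {#\<alpha>#}) (replicate k z) * s M)
      = (\<Sum>\<alpha>\<in>set_mset M. count M \<alpha> * (W M * ff k (size M - 1)))"
  proof (rule sum.cong[OF refl])
    fix \<alpha> assume a: "\<alpha> \<in># M"
    have "w z \<alpha> * psum w (M - {#\<alpha>#}) (replicate k z) * s M
        = count M \<alpha> * (w z \<alpha> * (psum w (M - {#\<alpha>#}) (replicate k z) * s (M - {#\<alpha>#})))"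
      by (simp add: s_rem[OF a])
    also have "psum w (M - {#\<alpha>#}) (replicate k z) * s (M - {#\<alpha>#}) = W (M - {#\<alpha>#}) * ff k (size M - 1)"
      using Suc.IH[of "M - {#\<alpha>#}"] a by (simp add: s_def W_def ff_def size_Diff_singleton)
    also have "w z \<alpha> * (W (M - {#\<alpha>#}) * ff k (size M - 1)) = W M * ff k (size M - 1)"
      using a by (simp add: W_def image_mset_Diff prod_mset.remove[of "w z \<alpha>" "image_mset (w z) M"])
    finally show "w z \<alpha> * psum w (M - {#\<alpha>#}) (replicate k z) * s M = count M \<alpha> * (W M * ff k (size M - 1))" .
  qed
  also have "\<dots> = size M * (W M * ff k (size M - 1))"
    by (simp add: sum_distrib_right[symmetric] size_multiset_overloaded_eq)
  also have "psum w M (replicate k z) * s M = W M * ff k (size M)"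
    using Suc.IH[of M] by (simp add: s_def W_def ff_def)
  finally show ?case
    using ff_Suc[of "size M"] unfolding s_def[symmetric] W_def[symmetric] ff_def[symmetric]
    by (simp add: algebra_simps)
qed

section \<open>Binomial and monomial weights and their elementary bounds\<close>

lemma pw_nonneg: "0 \<le> x \<Longrightarrow> 0 \<le> pw x \<alpha>"
  by (simp add: pw_def)

lemma cw_nonneg: "0 \<le> cw x \<alpha>"
  by (simp add: cw_def)

lemma fact_mult_cw: "fact \<alpha> * cw x \<alpha> = (\<Prod>i<\<alpha>. real x - real i)"
  using gbinomial_mult_fact[of \<alpha> "real x"]
  by (simp add: cw_def binomial_gbinomial lessThan_atLeast0)

lemma cw_le_pw: "cw x \<alpha> \<le> pw (real x) \<alpha>"
proof (cases "\<alpha> \<le> x")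
  case True
  have "fact \<alpha> * cw x \<alpha> \<le> (\<Prod>i<\<alpha>. real x)"
    unfolding fact_mult_cw using True by (intro prod_mono) auto
  then show ?thesis by (simp add: pw_def pos_le_divide_eq mult.commute)
qed (simp add: cw_def pw_def binomial_eq_0)

lemma pw_mono: "0 \<le> x \<Longrightarrow> x \<le> y \<Longrightarrow> pw x \<alpha> \<le> pw y \<alpha>"
  by (simp add: pw_def divide_right_mono power_mono)

lemma pw_le_cw:
  assumes "y \<le> real x - real \<alpha>" "0 \<le> y"
  shows "pw y \<alpha> \<le> cw x \<alpha>"
proof -
  have "(\<Prod>i<\<alpha>. y) \<le> fact \<alpha> * cw x \<alpha>"
    unfolding fact_mult_cw using assms by (intro prod_mono) auto
  then show ?thesis by (simp add: pw_def pos_divide_le_eq mult.commute)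
qed

lemma sum_pw_binomial_le:
  assumes "0 \<le> x" "0 \<le> S" and "\<forall>\<alpha>\<in>#M. 1 \<le> \<alpha>"
  shows "S ^ sum_mset M + (\<Sum>\<alpha>\<in>set_mset M. pw x \<alpha> * S ^ sum_mset (M - {#\<alpha>#})) \<le> (S + x) ^ sum_mset M"
proof -
  define L where "L = sum_mset M"
  have L: "sum_mset (M - {#\<alpha>#}) = L - \<alpha>" "\<alpha> \<le> L" "1 \<le> \<alpha>" if "\<alpha> \<in># M" for \<alpha>
    using that assms(3) by (auto simp: L_def sum_mset.remove)
  have "(\<Sum>\<alpha>\<in>set_mset M. pw x \<alpha> * S ^ sum_mset (M - {#\<alpha>#}))
      \<le> (\<Sum>\<alpha>\<in>set_mset M. (L choose \<alpha>) * x ^ \<alpha> * S ^ (L - \<alpha>))"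
  proof (rule sum_mono)
    fix \<alpha> assume a: "\<alpha> \<in># M"
    have "pw x \<alpha> \<le> 1 * x ^ \<alpha>"
      using assms by (simp add: pw_def divide_le_eq mult_le_cancel_left1)
    also have "\<dots> \<le> (L choose \<alpha>) * x ^ \<alpha>"
      using L[OF a] assms by (intro mult_right_mono) (auto simp: Suc_le_eq)
    finally show "pw x \<alpha> * S ^ sum_mset (M - {#\<alpha>#}) \<le> (L choose \<alpha>) * x ^ \<alpha> * S ^ (L - \<alpha>)"
      using L[OF a] assms by (simp add: mult_right_mono)
  qed
  also have "\<dots> \<le> (\<Sum>\<alpha>\<in>{1..L}. (L choose \<alpha>) * x ^ \<alpha> * S ^ (L - \<alpha>))"
    using L assms by (intro sum_mono2) auto
  also have "S ^ L + \<dots> = (\<Sum>\<alpha>\<le>L. (L choose \<alpha>) * x ^ \<alpha> * S ^ (L - \<alpha>))"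
    by (simp add: atMost_atLeast0 sum.atLeast_Suc_atMost[of 0])
  also have "\<dots> = (S + x) ^ L"
    by (subst add.commute) (rule binomial_ring[symmetric])
  finally show ?thesis by (simp add: L_def)
qed

lemma psum_pw_le_power:
  assumes "\<forall>x\<in>set xs. 0 \<le> x" and "\<forall>\<alpha>\<in>#M. 1 \<le> \<alpha>"
  shows "psum pw M xs \<le> sum_list xs ^ sum_mset M"
  using assms
proof (induction xs arbitrary: M)
  case (Cons x xs)
  define S where "S = sum_list xs"
  have S: "0 \<le> S" unfolding S_def using Cons.prems by (intro sum_list_nonneg) auto
  have "psum pw M (x # xs) \<le> S ^ sum_mset M + (\<Sum>\<alpha>\<in>set_mset M. pw x \<alpha> * S ^ sum_mset (M - {#\<alpha>#}))"
    unfolding psum.simps S_def using Cons.prems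
    by (intro add_mono sum_mono mult_left_mono Cons.IH pw_nonneg) (auto dest: in_diffD)
  also have "\<dots> \<le> (S + x) ^ sum_mset M"
    using Cons.prems S by (intro sum_pw_binomial_le) auto
  finally show ?case by (simp add: S_def add.commute)
qed (auto simp: power_0_left)

lemma psum_pw_le_1:
  assumes "\<forall>x\<in>set xs. 0 \<le> x" "\<forall>\<alpha>\<in>#M. 1 \<le> \<alpha>" "sum_list xs \<le> 1"
  shows "psum pw M xs \<le> 1"
proof -
  have "0 \<le> sum_list xs" using assms by (intro sum_list_nonneg) auto
  then have "sum_list xs ^ sum_mset M \<le> 1" using assms by (intro power_le_one) auto
  then show ?thesis using psum_pw_le_power[of xs M] assms by linarith
qed

text \<open>A placement that uses an entry \<open>d\<close> pays a factor at most
  \<open>d ^ \<alpha> \<le> d\<close>. There are at most \<open>size M\<close> values for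
  \<open>\<alpha>\<close>, and the rest of the placement weighs at most 1.\<close>

lemma psum_pw_append_le:
  fixes ds xs :: "real list"
  assumes "\<forall>x\<in>set (ds @ xs). 0 \<le> x" "\<forall>\<alpha>\<in>#M. 1 \<le> \<alpha>" "sum_list (ds @ xs) \<le> 1"
  shows "psum pw M (ds @ xs) \<le> psum pw M xs + size M * sum_list ds"
  using assms
proof (induction ds)
  case (Cons d ds)
  have nn: "0 \<le> d" "0 \<le> sum_list (ds @ xs)" "d \<le> 1"
    using Cons.prems sum_list_nonneg[of "ds @ xs"] by auto
  have "(\<Sum>\<alpha>\<in>set_mset M. pw d \<alpha> * psum pw (M - {#\<alpha>#}) (ds @ xs)) \<le> (\<Sum>\<alpha>\<in>set_mset M. d * 1)"
  proof (intro sum_mono mult_mono)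
    fix \<alpha> assume a: "\<alpha> \<in># M"
    have "d ^ \<alpha> \<le> d ^ 1" using a nn Cons.prems by (intro power_decreasing) auto
    moreover have "pw d \<alpha> \<le> d ^ \<alpha>" using nn by (simp add: pw_def divide_le_eq mult_le_cancel_left1)
    ultimately show "pw d \<alpha> \<le> d" by simp
    show "psum pw (M - {#\<alpha>#}) (ds @ xs) \<le> 1"
      using Cons.prems nn by (intro psum_pw_le_1) (auto dest: in_diffD)
    show "0 \<le> psum pw (M - {#\<alpha>#}) (ds @ xs)"
      using Cons.prems by (intro psum_nonneg pw_nonneg) auto
  qed (use nn in auto)
  also have "\<dots> \<le> size M * d"
  proof -
    have "card (set_mset M) \<le> size M"
      using sum_mono[of "set_mset M" "\<lambda>_. 1" "count M"] by (simp add: size_multiset_overloaded_eq)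
    then show ?thesis using nn by (simp add: mult_right_mono)
  qed
  finally show ?case
    using Cons nn by (auto simp: algebra_simps)
qed simp

lemma tendsto_psum:
  assumes "list_all2 (\<lambda>g x. \<forall>\<alpha>\<in>#M. ((\<lambda>t. w (g t) \<alpha>) \<longlongrightarrow> v x \<alpha>) F) gs xs"
  shows "((\<lambda>t. psum w M (map (\<lambda>g. g t) gs)) \<longlongrightarrow> psum v M xs) F"
proof -
  define A where "A = set_mset M"
  have "list_all2 (\<lambda>g x. \<forall>\<alpha>\<in>A. ((\<lambda>t. w (g t) \<alpha>) \<longlongrightarrow> v x \<alpha>) F) gs xs" 
    using assms by (simp add: A_def)
  moreover have "set_mset M \<subseteq> A" by (simp add: A_def)
  ultimately show ?thesis
  proof (induction gs xs arbitrary: M rule: list_all2_induct)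
    case (Cons g gs x xs)
    have "((\<lambda>t. psum w (M - {#\<alpha>#}) (map (\<lambda>g. g t) gs)) \<longlongrightarrow> psum v (M - {#\<alpha>#}) xs) F" for \<alpha>
      using Cons.prems by (intro Cons.IH) (auto dest: in_diffD)
    moreover have "((\<lambda>t. psum w M (map (\<lambda>g. g t) gs)) \<longlongrightarrow> psum v M xs) F"
      using Cons.prems by (intro Cons.IH)
    ultimately show ?case
      using Cons.hyps Cons.prems by (auto intro!: tendsto_add tendsto_sum tendsto_mult)
  qed simp
qed

lemma tendsto_psum_pw_replicate:
  assumes "(g \<longlongrightarrow> z) F"
  shows "((\<lambda>t. psum pw M (replicate k (g t))) \<longlongrightarrow> psum pw M (replicate k z)) F"
proof -
  have "list_all2 (\<lambda>g x. \<forall>\<alpha>\<in>#M. ((\<lambda>t. pw (g t) \<alpha>) \<longlongrightarrow> pw x \<alpha>) F) (replicate k g) (replicate k z)"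
    unfolding list_all2_conv_all_nth pw_def by (auto intro!: tendsto_divide tendsto_power assms)
  from tendsto_psum[OF this] show ?thesis by simp
qed

section \<open>Comparing two parts with their merger and their balancing\<close>

text \<open>The estimate for pairs of sizes concerns the sum of the two ways to assign the sizes to
  the two parts. Doubling produces that sum without a separate treatment of equal sizes.\<close>

lemma psum_two_symmetric:
  "2 * psum w M (x # y # R) = 2 * psum w M R
     + (\<Sum>\<alpha>\<in>set_mset M. 2 * ((w x \<alpha> + w y \<alpha>) * psum w (M - {#\<alpha>#}) R))
     + (\<Sum>(\<alpha>, \<beta>)\<in>part_pairs M. (w x \<alpha> * w y \<beta> + w x \<beta> * w y \<alpha>) * psum w (M - {#\<alpha>, \<beta>#}) R)"
proof -
  have "2 * (\<Sum>(\<alpha>, \<beta>)\<in>part_pairs M. w x \<alpha> * w y \<beta> * psum w (M - {#\<alpha>, \<beta>#}) R)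
      = (\<Sum>(\<alpha>, \<beta>)\<in>part_pairs M. (w x \<alpha> * w y \<beta> + w x \<beta> * w y \<alpha>) * psum w (M - {#\<alpha>, \<beta>#}) R)"
    by (rule sum_part_pairs_symmetrize) (simp add: add_mset_commute)
  then show ?thesis
    unfolding psum_two by (simp add: distrib_left sum_distrib_left mult.assoc add_mset_commute del: distrib_right_numeral)
qed

section \<open>Polynomial inequalities for two parts\<close>

text \<open>Even and odd parts of \<open>(1 + t) ^ d\<close> as a polynomial in \<open>t\<close>.
  For x = h(1+t) and y = h(1-t), the sum of the d-th powers of x and y is 2 h^d
  \<open>even_part d t\<close>.\<close>

definition even_part :: "nat \<Rightarrow> real \<Rightarrow> real" where
  "even_part d t = ((1 + t) ^ d + (1 - t) ^ d) / 2"

definition odd_part :: "nat \<Rightarrow> real \<Rightarrow> real" where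
  "odd_part d t = ((1 + t) ^ d - (1 - t) ^ d) / 2"

lemma even_part_0 [simp]: "even_part 0 t = 1" by (simp add: even_part_def)
lemma odd_part_0 [simp]: "odd_part 0 t = 0" by (simp add: odd_part_def)
lemma even_part_Suc: "even_part (Suc d) t = even_part d t + t * odd_part d t"
  by (simp add: even_part_def odd_part_def field_simps)
lemma odd_part_Suc: "odd_part (Suc d) t = odd_part d t + t * even_part d t"
  by (simp add: even_part_def odd_part_def field_simps)

lemma even_odd_part_basic:
  assumes "0 \<le> t"
  shows "1 \<le> even_part d t \<and> 0 \<le> odd_part d t \<and> odd_part d t \<le> real d * t * even_part d t"
proof (induction d)
  case (Suc d)
  have "odd_part (Suc d) t \<le> (real d + 1) * t * even_part d t"
    using Suc by (simp add: odd_part_Suc algebra_simps)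
  also have "\<dots> \<le> (real d + 1) * t * even_part (Suc d) t"
    using Suc assms by (intro mult_left_mono) (auto simp: even_part_Suc)
  finally have "odd_part (Suc d) t \<le> real (Suc d) * t * even_part (Suc d) t" by (simp add: add.commute)
  moreover have "1 \<le> even_part (Suc d) t" using Suc assms by (simp add: even_part_Suc add_increasing2)
  moreover have "0 \<le> odd_part (Suc d) t" using Suc assms by (simp add: odd_part_Suc)
  ultimately show ?case by blast
qed simp

text \<open>As a polynomial in \<open>t\<^sup>2\<close> with nonnegative coefficients,
  \<open>even_part (Suc d) t\<close> is convex in \<open>t\<^sup>2\<close>, so it lies below the
  chord between its values 1 at 0 and \<open>2 ^ d\<close> at 1. The bound on the odd part carries
  the induction.\<close>

lemma even_odd_part_le:
  assumes "0 \<le> t" "t \<le> 1"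
  shows "even_part (Suc d) t \<le> 1 + t\<^sup>2 * (2 ^ d - 1) \<and> odd_part (Suc d) t \<le> t * 2 ^ d"
proof (induction d)
  case 0
  show ?case by (simp add: even_part_def odd_part_def)
next
  case (Suc d)
  have t2: "t\<^sup>2 \<le> 1" using assms by (simp add: power_le_one)
  have "t\<^sup>2 * (2 ^ d - 1) \<le> 1 * (2 ^ d - 1 :: real)"
    using t2 by (intro mult_right_mono) auto
  then have e: "even_part (Suc d) t \<le> 2 ^ d" using Suc by simp
  have "t * odd_part (Suc d) t \<le> t * (t * 2 ^ d)" using Suc assms by (intro mult_left_mono) auto
  then have "even_part (Suc (Suc d)) t \<le> 1 + t\<^sup>2 * (2 ^ Suc d - 1)"
    using Suc by (simp add: even_part_Suc[of "Suc d"] power2_eq_square algebra_simps)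
  moreover have "t * even_part (Suc d) t \<le> t * 2 ^ d" using e assms by (intro mult_left_mono) auto
  then have "odd_part (Suc (Suc d)) t \<le> t * 2 ^ Suc d"
    using Suc by (simp add: odd_part_Suc[of "Suc d"] algebra_simps)
  ultimately show ?case ..
qed

text \<open>From \<open>d\<close> to \<open>d + 1\<close> the even part grows by a factor at most
  \<open>1 + d * t\<^sup>2\<close>, hence at most \<open>(1 + t\<^sup>2) ^ d\<close>. The exponent
  \<open>d choose 2\<close> grows by exactly \<open>d\<close>, and (1 - t^2)(1 + t^2) is at most
  1.\<close>

lemma even_part_mult_le_1:
  assumes "0 \<le> t" "t \<le> 1"
  shows "(1 - t\<^sup>2) ^ (d choose 2) * even_part d t \<le> 1"
proof (induction d)
  case (Suc d)
  have t2: "t\<^sup>2 \<le> 1" using assms by (simp add: power_le_one)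
  have e: "1 \<le> even_part d t" using even_odd_part_basic[OF assms(1)] by blast
  have "t * odd_part d t \<le> t * (real d * t * even_part d t)"
    using even_odd_part_basic[OF assms(1), of d] assms by (intro mult_left_mono) auto
  then have "even_part (Suc d) t \<le> (1 + real d * t\<^sup>2) * even_part d t"
    by (simp add: even_part_Suc power2_eq_square algebra_simps)
  also have "\<dots> \<le> (1 + t\<^sup>2) ^ d * even_part d t"
    using e Bernoulli_inequality[of "t\<^sup>2" d] order_trans[of "-1" 0 "t\<^sup>2"] by (intro mult_right_mono) auto
  finally have "(1 - t\<^sup>2) ^ (Suc d choose 2) * even_part (Suc d) t
      \<le> (1 - t\<^sup>2) ^ (Suc d choose 2) * ((1 + t\<^sup>2) ^ d * even_part d t)"
    using t2 by (intro mult_left_mono) auto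
  also have "Suc d choose 2 = d + (d choose 2)"
    by (simp add: numeral_2_eq_2)
  also have "(1 - t\<^sup>2) ^ (d + (d choose 2)) * ((1 + t\<^sup>2) ^ d * even_part d t)
      = ((1 - t\<^sup>2) * (1 + t\<^sup>2)) ^ d * ((1 - t\<^sup>2) ^ (d choose 2) * even_part d t)"
    by (simp add: power_add power_mult_distrib)
  also have "\<dots> \<le> 1 * 1"
  proof (intro mult_mono Suc.IH)
    show "((1 - t\<^sup>2) * (1 + t\<^sup>2)) ^ d \<le> 1"
      using t2 power_le_one[of "t\<^sup>2" 2]
      by (intro power_le_one) (auto simp: algebra_simps)
  qed (use t2 e in auto)
  finally show ?case by (simp add: numeral_2_eq_2)
qed (simp add: numeral_2_eq_2)

lemma even_part_abs: "even_part d \<bar>t\<bar> = even_part d t"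
  by (cases "0 \<le> t") (simp_all add: even_part_def add.commute)

text \<open>With \<open>t = (x - y) / (x + y)\<close> the coefficient of the balanced vector is
  \<open>1 - t\<^sup>2\<close>, and the first claim is the chord bound. For the second, (xy)^b
  supplies \<open>b\<close> factors \<open>1 - t\<^sup>2\<close>: one becomes the coefficient, and
  the hypothesis leaves at least \<open>(a - b) choose 2\<close> others to absorb
  \<open>even_part (a - b) t\<close>.\<close>

lemma
  fixes x y :: real
  assumes "0 \<le> x" "0 \<le> y" "0 < x + y"
  shows power_add_power_le: "1 \<le> \<alpha> \<Longrightarrow>
      x ^ \<alpha> + y ^ \<alpha> \<le> 4 * x * y / (x + y)\<^sup>2 * (2 * ((x + y) / 2) ^ \<alpha>)
           + (1 - 4 * x * y / (x + y)\<^sup>2) * (x + y) ^ \<alpha>"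
    and power_mult_power_le: "\<lbrakk>b \<le> a; (a - b) choose 2 < b\<rbrakk> \<Longrightarrow>
      x ^ a * y ^ b + x ^ b * y ^ a \<le> 4 * x * y / (x + y)\<^sup>2 * (2 * ((x + y) / 2) ^ (a + b))"
proof -
  define h where "h = (x + y) / 2"
  define t where "t = (x - y) / (x + y)"
  have h: "0 < h" and t: "0 \<le> \<bar>t\<bar>" "\<bar>t\<bar> \<le> 1" using assms by (auto simp: h_def t_def)
  have s: "x + y = 2 * h" by (simp add: h_def)
  have "h * t = (x - y) / 2" using h by (simp add: t_def s)
  then have xy: "x = h * (1 + t)" "y = h * (1 - t)"
    using s by (auto simp: distrib_left right_diff_distrib)
  have "4 * x * y = (2 * h)\<^sup>2 * (1 - t\<^sup>2)"
    by (simp add: xy power2_eq_square algebra_simps)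
  then have lam: "4 * x * y / (x + y)\<^sup>2 = 1 - t\<^sup>2"
    using h by (simp add: s)
  have t2: "0 \<le> 1 - t\<^sup>2" "1 - t\<^sup>2 \<le> 1" using t by (auto simp: abs_square_le_1)
  {
    assume "1 \<le> \<alpha>"
    then obtain d where d: "\<alpha> = Suc d" by (cases \<alpha>) auto
    have "x ^ \<alpha> + y ^ \<alpha> = h ^ \<alpha> * (2 * even_part \<alpha> t)"
      unfolding xy power_mult_distrib even_part_def by (simp add: distrib_left)
    also have "\<dots> \<le> h ^ \<alpha> * (2 * (1 + t\<^sup>2 * (2 ^ d - 1)))"
      using even_odd_part_le[OF t, of d] h by (simp add: d even_part_abs)
    also have "\<dots> = (1 - t\<^sup>2) * (2 * h ^ \<alpha>) + (1 - (1 - t\<^sup>2)) * (2 * h) ^ \<alpha>"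
      unfolding d power_mult_distrib by (simp add: algebra_simps)
    finally show "x ^ \<alpha> + y ^ \<alpha> \<le> 4 * x * y / (x + y)\<^sup>2 * (2 * ((x + y) / 2) ^ \<alpha>)
           + (1 - 4 * x * y / (x + y)\<^sup>2) * (x + y) ^ \<alpha>"
      unfolding lam by (simp add: s)
  next
    assume ab: "b \<le> a" "(a - b) choose 2 < b"
    define d where "d = a - b"
    have a: "a = b + d" using ab by (simp add: d_def)
    have e: "1 \<le> even_part d t" using even_odd_part_basic[OF t(1), of d] by (simp add: even_part_abs)
    have "x ^ a * y ^ b + x ^ b * y ^ a = (x * y) ^ b * (x ^ d + y ^ d)"
      unfolding a power_add power_mult_distrib by (simp add: algebra_simps)
    also have "x * y = h\<^sup>2 * (1 - t\<^sup>2)" by (simp add: xy power2_eq_square algebra_simps)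
    also have "x ^ d + y ^ d = h ^ d * (2 * even_part d t)"
      unfolding xy power_mult_distrib even_part_def by (simp add: distrib_left)
    also have "(h\<^sup>2 * (1 - t\<^sup>2)) ^ b * (h ^ d * (2 * even_part d t)) = 2 * h ^ (a + b) * ((1 - t\<^sup>2) ^ b * even_part d t)"
      unfolding a power_mult_distrib power_add by (simp add: power2_eq_square power_mult_distrib)
    also have "\<dots> \<le> 2 * h ^ (a + b) * ((1 - t\<^sup>2) * 1)"
    proof (rule mult_left_mono)
      have "(1 - t\<^sup>2) ^ b * even_part d t \<le> (1 - t\<^sup>2) ^ (1 + (d choose 2)) * even_part d t"
        using t2 e ab by (intro mult_right_mono power_decreasing) (auto simp: d_def)
      also have "\<dots> = (1 - t\<^sup>2) * ((1 - t\<^sup>2) ^ (d choose 2) * even_part d t)" by simp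
      also have "\<dots> \<le> (1 - t\<^sup>2) * 1"
        using even_part_mult_le_1[OF t, of d] t2 by (intro mult_left_mono) (auto simp: even_part_abs)
      finally show "(1 - t\<^sup>2) ^ b * even_part d t \<le> (1 - t\<^sup>2) * 1" .
    qed (use h in simp)
    finally show "x ^ a * y ^ b + x ^ b * y ^ a \<le> 4 * x * y / (x + y)\<^sup>2 * (2 * ((x + y) / 2) ^ (a + b))"
      unfolding lam by (simp add: h_def mult_ac)
  }
qed

lemma pw_0: "1 \<le> \<alpha> \<Longrightarrow> pw 0 \<alpha> = 0"
  by (simp add: pw_def)

text \<open>\<open>part_close\<close> states the condition on the extreme sizes for every ordered
  pair. For \<open>\<alpha> \<le> \<beta>\<close> the truncated difference is 0, and it only says
  that \<open>\<beta>\<close> is positive.\<close>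

locale balanced_parts =
  fixes M :: "nat multiset"
  assumes part_ge_1: "\<alpha> \<in># M \<Longrightarrow> 1 \<le> \<alpha>"
    and part_close: "\<alpha> \<in># M \<Longrightarrow> \<beta> \<in># M \<Longrightarrow> (\<alpha> - \<beta>) choose 2 < \<beta>"
    and part_ge_2: "\<exists>\<alpha>\<in>#M. 2 \<le> \<alpha>"
    and two_parts: "2 \<le> size M"
begin

lemma psum_pw_pair_le:
  assumes "0 \<le> x" "0 \<le> y" "0 < x + y" "\<forall>z\<in>set R. 0 \<le> z"
  shows "psum pw M (x # y # R) \<le> 4 * x * y / (x + y)\<^sup>2 * psum pw M ((x + y) / 2 # (x + y) / 2 # R)
           + (1 - 4 * x * y / (x + y)\<^sup>2) * psum pw M ((x + y) # R)"
proof -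
  define L where "L = 4 * x * y / (x + y)\<^sup>2"
  define h where "h = (x + y) / 2"
  have nn: "0 \<le> psum pw N R" for N using assms by (intro psum_nonneg pw_nonneg) auto
  have "2 * psum pw M (x # y # R) = 2 * psum pw M R
     + (\<Sum>\<alpha>\<in>set_mset M. 2 * ((pw x \<alpha> + pw y \<alpha>) * psum pw (M - {#\<alpha>#}) R))
     + (\<Sum>(\<alpha>, \<beta>)\<in>part_pairs M. (pw x \<alpha> * pw y \<beta> + pw x \<beta> * pw y \<alpha>) * psum pw (M - {#\<alpha>, \<beta>#}) R)"
    by (rule psum_two_symmetric)
  \<comment> \<open>The merged vector is written as the pair \<open>x + y\<close>, \<open>0\<close>,
    so that all three vectors have the same expansion and can be compared term by term. All sizes
    are positive, so the entry 0 contributes nothing.\<close>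
  also have "\<dots> \<le> 2 * psum pw M R
     + (\<Sum>\<alpha>\<in>set_mset M. 2 * ((L * (pw h \<alpha> + pw h \<alpha>) + (1 - L) * (pw (x + y) \<alpha> + pw 0 \<alpha>)) * psum pw (M - {#\<alpha>#}) R))
     + (\<Sum>(\<alpha>, \<beta>)\<in>part_pairs M. (L * (pw h \<alpha> * pw h \<beta> + pw h \<beta> * pw h \<alpha>)
          + (1 - L) * (pw (x + y) \<alpha> * pw 0 \<beta> + pw (x + y) \<beta> * pw 0 \<alpha>)) * psum pw (M - {#\<alpha>, \<beta>#}) R)"
  proof (intro add_mono order_refl sum_mono)
    fix \<alpha> assume a: "\<alpha> \<in># M"
    have "pw x \<alpha> + pw y \<alpha> = (x ^ \<alpha> + y ^ \<alpha>) / fact \<alpha>"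
      by (simp add: pw_def add_divide_distrib)
    also have "\<dots> \<le> (L * (2 * h ^ \<alpha>) + (1 - L) * (x + y) ^ \<alpha>) / fact \<alpha>"
      using power_add_power_le[OF assms(1-3) part_ge_1[OF a]]
      by (intro divide_right_mono) (auto simp: L_def h_def)
    also have "\<dots> = L * (pw h \<alpha> + pw h \<alpha>) + (1 - L) * (pw (x + y) \<alpha> + pw 0 \<alpha>)"
      using part_ge_1[OF a] by (simp add: pw_def add_divide_distrib power_0_left)
    finally show "2 * ((pw x \<alpha> + pw y \<alpha>) * psum pw (M - {#\<alpha>#}) R)
        \<le> 2 * ((L * (pw h \<alpha> + pw h \<alpha>) + (1 - L) * (pw (x + y) \<alpha> + pw 0 \<alpha>)) * psum pw (M - {#\<alpha>#}) R)"
      by (intro mult_left_mono mult_right_mono nn) auto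
  next
    fix p assume "p \<in> part_pairs M"
    then obtain \<alpha> \<beta> where p: "p = (\<alpha>, \<beta>)" "\<alpha> \<in># M" "\<beta> \<in># M" by (cases p) (auto dest: part_pairsD)
    have *: "x ^ a * y ^ b + x ^ b * y ^ a \<le> L * (2 * h ^ (a + b))" if "a \<in># M" "b \<in># M" "b \<le> a" for a b
      using power_mult_power_le[OF assms(1-3) that(3) part_close[OF that(1,2)]] by (simp add: L_def h_def)
    have "x ^ \<alpha> * y ^ \<beta> + x ^ \<beta> * y ^ \<alpha> \<le> L * (2 * h ^ (\<alpha> + \<beta>))"
    proof (cases "\<beta> \<le> \<alpha>")
      case True
      then show ?thesis using *[of \<alpha> \<beta>] p by simp
    next
      case False
      then show ?thesis using *[of \<beta> \<alpha>] p by (simp add: add.commute)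
    qed
    then have "(x ^ \<alpha> * y ^ \<beta> + x ^ \<beta> * y ^ \<alpha>) / (fact \<alpha> * fact \<beta>) \<le> L * (2 * h ^ (\<alpha> + \<beta>)) / (fact \<alpha> * fact \<beta>)"
      by (rule divide_right_mono) simp
    then have "pw x \<alpha> * pw y \<beta> + pw x \<beta> * pw y \<alpha> \<le> L * (pw h \<alpha> * pw h \<beta> + pw h \<beta> * pw h \<alpha>)"
      by (simp add: pw_def add_divide_distrib power_add mult.commute mult.left_commute)
    moreover have "pw 0 \<alpha> = 0" "pw 0 \<beta> = 0" using part_ge_1 p by (auto simp: pw_0)
    ultimately show "(case p of (\<alpha>, \<beta>) \<Rightarrow> (pw x \<alpha> * pw y \<beta> + pw x \<beta> * pw y \<alpha>) * psum pw (M - {#\<alpha>, \<beta>#}) R)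
      \<le> (case p of (\<alpha>, \<beta>) \<Rightarrow> (L * (pw h \<alpha> * pw h \<beta> + pw h \<beta> * pw h \<alpha>)
          + (1 - L) * (pw (x + y) \<alpha> * pw 0 \<beta> + pw (x + y) \<beta> * pw 0 \<alpha>)) * psum pw (M - {#\<alpha>, \<beta>#}) R)"
      unfolding p prod.case by (intro mult_right_mono nn) simp
  qed
  also have "\<dots> = L * (2 * psum pw M (h # h # R)) + (1 - L) * (2 * psum pw M ((x + y) # 0 # R))"
  proof -
    have 1: "(\<Sum>\<alpha>\<in>A. 2 * ((L * f \<alpha> + (1 - L) * g \<alpha>) * c \<alpha>))
        = L * (\<Sum>\<alpha>\<in>A. 2 * (f \<alpha> * c \<alpha>)) + (1 - L) * (\<Sum>\<alpha>\<in>A. 2 * (g \<alpha> * c \<alpha>))"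
      for f g c :: "nat \<Rightarrow> real" and A
      unfolding sum_distrib_left sum.distrib[symmetric] by (rule sum.cong) (auto simp: algebra_simps)
    have 2: "(\<Sum>(\<alpha>, \<beta>)\<in>A. (L * f \<alpha> \<beta> + (1 - L) * g \<alpha> \<beta>) * c \<alpha> \<beta>)
        = L * (\<Sum>(\<alpha>, \<beta>)\<in>A. f \<alpha> \<beta> * c \<alpha> \<beta>) + (1 - L) * (\<Sum>(\<alpha>, \<beta>)\<in>A. g \<alpha> \<beta> * c \<alpha> \<beta>)"
      for f g c :: "nat \<Rightarrow> nat \<Rightarrow> real" and A
      unfolding sum_distrib_left sum.distrib[symmetric] by (rule sum.cong) (auto simp: algebra_simps)
    have 3: "X + (L * P + (1 - L) * Q) + (L * P' + (1 - L) * Q') = L * (X + P + P') + (1 - L) * (X + Q + Q')"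
      for X P P' Q Q' :: real by (simp add: algebra_simps)
    show ?thesis
      unfolding psum_two_symmetric 1 2 by (rule 3)
  qed
  also have "psum pw M ((x + y) # 0 # R) = psum pw M ((x + y) # R)"
    unfolding psum_swap[of pw M "x + y"] using part_ge_1
    by (intro psum_zero_part pw_0) auto
  finally have "2 * psum pw M (x # y # R) \<le> L * (2 * psum pw M (h # h # R)) + (1 - L) * (2 * psum pw M ((x + y) # R))" .
  then have "2 * psum pw M (x # y # R) \<le> 2 * (L * psum pw M (h # h # R) + (1 - L) * psum pw M ((x + y) # R))"
    by (simp add: distrib_left del: psum.simps)
  then show ?thesis unfolding L_def h_def by (rule mult_left_le_imp_le) simp
qed

end

section \<open>Stability of near-optimal part sizes\<close>

definition unit_vectors :: "real list set" where
  "unit_vectors = {ys. (\<forall>y\<in>set ys. 0 \<le> y) \<and> sum_list ys = 1}"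

context balanced_parts
begin

abbreviation weight :: "real list \<Rightarrow> real" where
  "weight \<equiv> psum pw M"

text \<open>A supremum over vectors of every length. Boundedness is all that is known of it until
  \<open>weight_sup_eq\<close> identifies it with \<open>equal_weight m\<close>.\<close>

definition weight_sup :: real where
  "weight_sup = (SUP ys\<in>unit_vectors. weight ys)"

definition equal_weight :: "nat \<Rightarrow> real" where
  "equal_weight k = weight (replicate k (1 / real k))"

lemma weight_nonneg: "\<forall>y\<in>set ys. 0 \<le> y \<Longrightarrow> 0 \<le> weight ys"
  by (intro psum_nonneg pw_nonneg) auto

lemma weight_le_sup: "ys \<in> unit_vectors \<Longrightarrow> weight ys \<le> weight_sup"
  unfolding weight_sup_def
proof (rule cSUP_upper)
  have "weight ys \<le> 1" if "ys \<in> unit_vectors" for ys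
    using that by (intro psum_pw_le_1) (auto simp: unit_vectors_def dest: part_ge_1)
  then show "bdd_above (weight ` unit_vectors)"
    by (auto intro!: bdd_aboveI[of _ 1])
qed

lemma weight_mset_cong: "mset xs = mset ys \<Longrightarrow> weight xs = weight ys"
  by (rule psum_mset_cong)

lemma weight_singleton: "weight [x] = 0"
  using two_parts by (intro psum_size_gt_length) auto

lemma equal_weight_le_sup: "1 \<le> k \<Longrightarrow> equal_weight k \<le> weight_sup"
  unfolding equal_weight_def
  by (rule weight_le_sup) (auto simp: unit_vectors_def sum_list_replicate)

text \<open>The right-hand side is the square of (z-q)/(z+q), and (z+q)/(z-q) is at most
  \<open>1 + 2 * q / \<delta>\<close>. In exponential form the factors of successive merges combine
  into one that depends only on the total mass merged.\<close>

lemma exp_le_merge_factor: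
  fixes z q \<delta> :: real
  assumes "0 \<le> q" "q \<le> z - \<delta>" "0 < \<delta>"
  shows "exp (- (4 * q / \<delta>)) \<le> 1 - 4 * z * q / (z + q)\<^sup>2"
proof -
  have pos: "0 < z - q" "0 < z + q" using assms by auto
  have "(z + q) / (z - q) = 1 + 2 * q / (z - q)" using pos by (simp add: field_simps)
  also have "\<dots> \<le> 1 + 2 * q / \<delta>"
    using assms by (intro add_left_mono divide_left_mono) auto
  also have "\<dots> \<le> exp (2 * q / \<delta>)" by (rule exp_ge_add_one_self)
  finally have "exp (- (2 * q / \<delta>)) \<le> (z - q) / (z + q)"
    using pos by (simp add: exp_minus field_simps)
  then have "(exp (- (2 * q / \<delta>)))\<^sup>2 \<le> ((z - q) / (z + q))\<^sup>2"
    by (rule power_mono) simp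
  also have "(exp (- (2 * q / \<delta>)))\<^sup>2 = exp (- (4 * q / \<delta>))"
    by (simp add: exp_double[symmetric])
  also have "((z - q) / (z + q))\<^sup>2 = 1 - 4 * z * q / (z + q)\<^sup>2"
  proof -
    have "(z + q)\<^sup>2 - 4 * z * q = (z - q)\<^sup>2" by (simp add: power2_eq_square algebra_simps)
    then have "(z - q)\<^sup>2 / (z + q)\<^sup>2 = ((z + q)\<^sup>2 - 4 * z * q) / (z + q)\<^sup>2" by simp
    moreover have "((z + q)\<^sup>2 - 4 * z * q) / (z + q)\<^sup>2 = 1 - 4 * z * q / (z + q)\<^sup>2"
      using pos by (simp add: diff_divide_distrib)
    ultimately show ?thesis by (simp only: power_divide)
  qed
  finally show ?thesis .
qed

text \<open>In the two-part inequality the balanced vector is bounded by \<open>weight_sup\<close>,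
  so the deficit of the merged vector times the remaining coefficient is at most the old deficit.
  The entry \<open>z\<close> only grows, so the distance \<open>\<delta>\<close> to the parts still
  to be merged persists.\<close>

lemma merge_parts:
  assumes "\<forall>q\<in>set qs. 0 \<le> q \<and> q \<le> z - \<delta>" "0 < \<delta>" "0 \<le> z" "\<forall>y\<in>set R. 0 \<le> y"
    and "z + sum_list qs + sum_list R = 1"
  shows "weight_sup - weight ((z + sum_list qs) # R)
       \<le> exp (4 * sum_list qs / \<delta>) * (weight_sup - weight (z # qs @ R))"
  using assms
proof (induction qs arbitrary: z)
  case (Cons q qs)
  define L where "L = 4 * z * q / (z + q)\<^sup>2"
  have q: "0 \<le> q" "q \<le> z - \<delta>" and nn: "\<forall>y\<in>set (qs @ R). 0 \<le> y" using Cons.prems by auto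
  have L: "exp (- (4 * q / \<delta>)) \<le> 1 - L" "0 \<le> L"
    using exp_le_merge_factor[OF q \<open>0 < \<delta>\<close>] q Cons.prems by (auto simp: L_def)
  have "weight ((z + q) / 2 # (z + q) / 2 # qs @ R) \<le> weight_sup"
    using nn q Cons.prems by (intro weight_le_sup) (auto simp: unit_vectors_def)
  then have bal: "L * weight ((z + q) / 2 # (z + q) / 2 # qs @ R) \<le> L * weight_sup"
    using L by (intro mult_left_mono)
  have mer: "weight ((z + q) # qs @ R) \<le> weight_sup"
    using nn q Cons.prems by (intro weight_le_sup) (auto simp: unit_vectors_def)
  have "weight (z # q # qs @ R) \<le> L * weight ((z + q) / 2 # (z + q) / 2 # qs @ R) + (1 - L) * weight ((z + q) # qs @ R)"
    unfolding L_def using nn q Cons.prems by (intro psum_pw_pair_le) auto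
  with bal have "(1 - L) * (weight_sup - weight ((z + q) # qs @ R)) \<le> weight_sup - weight (z # q # qs @ R)"
    by (simp add: algebra_simps del: psum.simps)
  moreover have "exp (- (4 * q / \<delta>)) * (weight_sup - weight ((z + q) # qs @ R))
      \<le> (1 - L) * (weight_sup - weight ((z + q) # qs @ R))"
    using L mer by (intro mult_right_mono) auto
  ultimately have "exp (- (4 * q / \<delta>)) * (weight_sup - weight ((z + q) # qs @ R)) \<le> weight_sup - weight (z # q # qs @ R)"
    by (rule order_trans[rotated])
  then have "exp (4 * q / \<delta>) * (exp (- (4 * q / \<delta>)) * (weight_sup - weight ((z + q) # qs @ R)))
      \<le> exp (4 * q / \<delta>) * (weight_sup - weight (z # q # qs @ R))"
    by (rule mult_left_mono) simp
  then have *: "weight_sup - weight ((z + q) # qs @ R) \<le> exp (4 * q / \<delta>) * (weight_sup - weight (z # q # qs @ R))"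
    unfolding mult.assoc[symmetric] exp_add[symmetric] by (simp del: psum.simps)
  have "weight_sup - weight ((z + q + sum_list qs) # R)
      \<le> exp (4 * sum_list qs / \<delta>) * (weight_sup - weight ((z + q) # qs @ R))"
    using Cons.prems q by (intro Cons.IH) (auto simp: algebra_simps)
  also have "\<dots> \<le> exp (4 * sum_list qs / \<delta>) * (exp (4 * q / \<delta>) * (weight_sup - weight (z # q # qs @ R)))"
    using * by (intro mult_left_mono) auto
  also have "\<dots> = exp (4 * sum_list (q # qs) / \<delta>) * (weight_sup - weight (z # (q # qs) @ R))"
    by (simp add: exp_add[symmetric] add_divide_distrib distrib_left mult.assoc[symmetric] add.commute del: psum.simps)
  finally show ?case by (simp add: add.assoc del: psum.simps)
qed simp

text \<open>If the small parts had mass at least \<open>\<delta>\<close>, merging them into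
  \<open>Y\<close> would lift \<open>Y\<close> by \<open>\<delta>\<close> above all other parts, so
  these could be merged too. The result is a single part of weight 0, whose deficit is the whole of
  \<open>weight_sup\<close>, too much for a near-optimal start.\<close>

lemma small_parts_sum_less:
  assumes ys: "ys \<in> unit_vectors" and "0 < \<delta>" and Y: "Y \<in> set ys" "\<forall>y\<in>set ys. y \<le> Y"
    and near: "weight_sup - weight ys < weight_sup * exp (- (4 / \<delta>))"
  shows "sum_list (filter (\<lambda>y. y \<le> Y - \<delta>) ys) < \<delta>"
proof (rule ccontr)
  define S where "S = filter (\<lambda>y. y \<le> Y - \<delta>) ys"
  define R where "R = remove1 Y (filter (\<lambda>y. \<not> y \<le> Y - \<delta>) ys)"
  assume "\<not> ?thesis"
  then have D: "\<delta> \<le> sum_list S" by (simp add: S_def)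
  have "Y \<in> set (filter (\<lambda>y. \<not> y \<le> Y - \<delta>) ys)" using Y \<open>0 < \<delta>\<close> by simp
  then have ms: "mset ys = mset (Y # S @ R)"
    by (simp add: S_def R_def mset_filter)
  have nn: "\<forall>y\<in>set ys. 0 \<le> y" using ys by (simp add: unit_vectors_def)
  have sub: "set S \<subseteq> set ys" "set R \<subseteq> set ys"
    using set_remove1_subset by (fastforce simp: S_def R_def)+
  have sum: "Y + sum_list S + sum_list R = 1"
    using ys arg_cong[OF ms, of sum_mset] by (simp add: unit_vectors_def sum_mset_sum_list)
  have R0: "0 \<le> sum_list R" and S0: "0 \<le> sum_list S" using sub nn by (auto intro!: sum_list_nonneg)
  have "weight_sup - weight ((Y + sum_list S) # R) \<le> exp (4 * sum_list S / \<delta>) * (weight_sup - weight (Y # S @ R))"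
    using sub nn Y \<open>0 < \<delta>\<close> sum by (intro merge_parts) (auto simp: S_def)
  then have 1: "weight_sup - weight ((Y + sum_list S) # R) \<le> exp (4 * sum_list S / \<delta>) * (weight_sup - weight ys)"
    by (simp only: weight_mset_cong[OF ms])
  \<comment> \<open>The second round is possible because every entry of \<open>R\<close> is at most
    \<open>Y\<close>, hence at most the lifted part minus \<open>\<delta>\<close>.\<close>
  have "weight_sup - weight ((Y + sum_list S + sum_list R) # []) \<le> exp (4 * sum_list R / \<delta>) * (weight_sup - weight ((Y + sum_list S) # R @ []))"
    using sub nn Y \<open>0 < \<delta>\<close> sum D S0 by (intro merge_parts) (auto dest!: subsetD)
  also have "\<dots> \<le> exp (4 * sum_list R / \<delta>) * (exp (4 * sum_list S / \<delta>) * (weight_sup - weight ys))"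
    using 1 by (intro mult_left_mono) auto
  also have "\<dots> = exp (4 * (sum_list S + sum_list R) / \<delta>) * (weight_sup - weight ys)"
    by (simp add: exp_add[symmetric] add_divide_distrib distrib_left mult.assoc[symmetric] add.commute)
  also have "\<dots> \<le> exp (4 / \<delta>) * (weight_sup - weight ys)"
    using sum nn Y \<open>0 < \<delta>\<close> weight_le_sup[OF ys] by (intro mult_right_mono) (auto simp: divide_right_mono)
  also have "\<dots> < exp (4 / \<delta>) * (weight_sup * exp (- (4 / \<delta>)))"
    using near by (intro mult_strict_left_mono) auto
  also have "\<dots> = weight_sup" by (simp add: exp_minus)
  finally show False by (simp add: weight_singleton del: psum.simps)
qed

text \<open>Some size is at least 2, and placing it costs at most the sum of the
  \<open>y\<^sup>2\<close>, hence at most \<open>Y\<close>. This keeps the largest part of a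
  near-optimal vector away from 0 and so bounds the number of parts close to the largest.\<close>

lemma weight_le_max_part:
  assumes "\<forall>y\<in>set ys. 0 \<le> y \<and> y \<le> Y" "sum_list ys = 1"
  shows "weight ys \<le> Y"
proof -
  obtain \<gamma> where g: "\<gamma> \<in># M" "2 \<le> \<gamma>" using part_ge_2 by blast
  have ne: "ys \<noteq> []" using assms by auto
  then have Y: "0 \<le> Y" using assms by (cases ys) auto
  have le1: "y \<le> 1" if "y \<in> set ys" for y
    using member_le_sum_list[OF that] assms by auto
  have "weight ys \<le> (\<Sum>y\<leftarrow>ys. pw y \<gamma>) * psum pw (M - {#\<gamma>#}) ys"
    using assms g by (intro psum_le_remove_part pw_nonneg) auto
  also have "\<dots> \<le> (\<Sum>y\<leftarrow>ys. pw y \<gamma>) * 1"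
    using assms part_ge_1
    by (intro mult_left_mono psum_pw_le_1 sum_list_nonneg) (auto intro: pw_nonneg dest: in_diffD)
  also have "(\<Sum>y\<leftarrow>ys. pw y \<gamma>) \<le> (\<Sum>y\<leftarrow>ys. Y * y)"
  proof (rule sum_list_mono)
    fix y assume y: "y \<in> set ys"
    have "y ^ \<gamma> * 1 \<le> y ^ \<gamma> * fact \<gamma>" using assms y by (intro mult_left_mono) auto
    then have "pw y \<gamma> \<le> y ^ \<gamma>" by (simp add: pw_def pos_divide_le_eq)
    also have "\<dots> \<le> y ^ 2" using assms y g le1 by (intro power_decreasing) auto
    also have "\<dots> \<le> Y * y" using assms y by (auto simp: power2_eq_square intro: mult_right_mono)
    finally show "pw y \<gamma> \<le> Y * y" .
  qed
  also have "\<dots> = Y" using assms by (simp add: sum_list_const_mult)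
  finally show ?thesis by simp
qed

lemma weight_replicate:
  assumes "1 \<le> k"
  shows "weight (replicate k y) = (k * y) ^ sum_mset M * equal_weight k"
proof -
  have "psum pw M (map (\<lambda>x. (k * y) * x) (replicate k (1 / real k))) = (k * y) ^ sum_mset M * weight (replicate k (1 / real k))"
    by (rule psum_scale) (simp only: pw_def power_mult_distrib times_divide_eq_right)
  then show ?thesis using assms by (simp add: equal_weight_def)
qed

lemma weight_le_replicate:
  assumes "\<forall>t\<in>set T. 0 \<le> t \<and> t \<le> y"
  shows "weight T \<le> weight (replicate (length T) y)"
  using assms
  by (intro psum_mono[THEN conjunct2]) (auto simp: list_all2_conv_all_nth intro!: pw_nonneg pw_mono)

end

text \<open>Only vectors with equal entries are compared in the assumption. That \<open>m\<close>
  equal parts are optimal among all vectors is derived from it.\<close>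

locale balanced_parts_max = balanced_parts +
  fixes m :: nat
  assumes two_le_m: "2 \<le> m"
    and equal_weight_less: "1 \<le> k \<Longrightarrow> k \<noteq> m \<Longrightarrow> equal_weight k < equal_weight m"
begin

lemma equal_weight_pos: "0 < equal_weight m"
  using equal_weight_less[of 1] two_le_m by (simp add: equal_weight_def weight_singleton del: psum.simps)

text \<open>Measured against \<open>weight_sup\<close>, because its value is obtained from this very
  lemma.\<close>

lemma stability_aux:
  "\<exists>\<delta>0>0. \<forall>\<delta>. 0 < \<delta> \<and> \<delta> < \<delta>0 \<longrightarrow> (\<exists>\<theta>>0. \<theta> \<le> \<delta> \<and> (\<forall>ys\<in>unit_vectors. weight_sup - \<theta> < weight ys \<longrightarrow>
     (\<exists>T D. mset ys = mset (D @ T) \<and> length T = m \<and> (\<forall>t\<in>set T. \<bar>t - 1 / m\<bar> < 2 * \<delta>) \<and> sum_list D < \<delta>)))"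
proof -
  \<comment> \<open>The largest part of a near-optimal vector is at least \<open>c\<close>. For
    \<open>\<delta> \<le> c / 2\<close> all parts within \<open>\<delta>\<close> of it are at least
    \<open>c / 2\<close>, so there are at most \<open>2 / c\<close> of them.\<close>
  define c where "c = equal_weight m / 2"
  have c: "0 < c" using equal_weight_pos by (simp add: c_def)
  define K where "K = nat \<lceil>2 / c\<rceil>"
  \<comment> \<open>The best value for a wrong number of parts. Only finitely many numbers compete,
    so it stays strictly below \<open>equal_weight m\<close>; the inserted 0 makes the maximum
    meaningful for an empty set and \<open>e\<close> nonnegative.\<close>
  define e where "e = Max (insert 0 (equal_weight ` ({1..K} - {m})))"
  have e_less: "e < equal_weight m"
    unfolding e_def using equal_weight_pos equal_weight_less by (subst Max_less_iff) auto
  have e: "0 \<le> e" "\<And>k. 1 \<le> k \<Longrightarrow> k \<le> K \<Longrightarrow> k \<noteq> m \<Longrightarrow> equal_weight k \<le> e"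
    unfolding e_def by (auto intro!: Max_ge)
  \<comment> \<open>If the number of large parts differs from \<open>m\<close>, this expression
    bounds the weight plus \<open>\<delta>\<close>: the power accounts for rounding all large parts
    up to the largest, \<open>size M * \<delta>\<close> for discarding the small ones, and the last
    \<open>\<delta>\<close> is the tolerated deficit.\<close>
  have "((\<lambda>\<delta>::real. (1 + \<delta> * (2 / c)) ^ sum_mset M * e + size M * \<delta> + \<delta>) \<longlongrightarrow> (1 + 0 * (2 / c)) ^ sum_mset M * e + real (size M) * 0 + 0) (at_right 0)"
    by (intro tendsto_intros)
  then have "eventually (\<lambda>\<delta>::real. (1 + \<delta> * (2 / c)) ^ sum_mset M * e + size M * \<delta> + \<delta> < equal_weight m) (at_right 0)"
    by (rule order_tendstoD) (simp add: e_less)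
  then obtain \<delta>1 where \<delta>1: "0 < \<delta>1" "\<And>\<delta>::real. 0 < \<delta> \<Longrightarrow> \<delta> < \<delta>1 \<Longrightarrow> (1 + \<delta> * (2 / c)) ^ sum_mset M * e + size M * \<delta> + \<delta> < equal_weight m"
    unfolding eventually_at_right_field by auto
  have sup: "equal_weight m \<le> weight_sup" using two_le_m by (intro equal_weight_le_sup) auto
  \<comment> \<open>In the threshold for the deficit, the exponential is what
    \<open>small_parts_sum_less\<close> requires, and \<open>\<delta>\<close> is the slack in the
    comparison with \<open>e\<close>.\<close>
  have main: "\<exists>T D. mset ys = mset (D @ T) \<and> length T = m \<and> (\<forall>t\<in>set T. \<bar>t - 1 / m\<bar> < 2 * \<delta>) \<and> sum_list D < \<delta>"
    if \<delta>: "0 < \<delta>" "\<delta> < \<delta>1" "\<delta> \<le> c / 2" and ys: "ys \<in> unit_vectors"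
      and near: "weight_sup - min \<delta> (weight_sup * exp (- (4 / \<delta>))) < weight ys" for \<delta> ys
  proof -
    have nn: "\<forall>y\<in>set ys. 0 \<le> y" and s1: "sum_list ys = 1" using ys by (auto simp: unit_vectors_def)
    then have "set ys \<noteq> {}" by auto
    define Y where "Y = Max (set ys)"
    have Y: "Y \<in> set ys" "\<forall>y\<in>set ys. y \<le> Y" using \<open>set ys \<noteq> {}\<close> by (auto simp: Y_def)
    define D where "D = filter (\<lambda>y. y \<le> Y - \<delta>) ys"
    define T where "T = filter (\<lambda>y. \<not> y \<le> Y - \<delta>) ys"
    define k where "k = length T"
    have ms: "mset ys = mset (D @ T)" by (simp add: D_def T_def mset_filter)
    have Dl: "sum_list D < \<delta>"
      unfolding D_def using near \<delta> by (intro small_parts_sum_less[OF ys _ Y]) auto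
    have DT: "sum_list D + sum_list T = 1"
      using s1 arg_cong[OF ms, of sum_mset] by (simp add: sum_mset_sum_list)
    have D0: "0 \<le> sum_list D" using nn by (intro sum_list_nonneg) (auto simp: D_def)
    have T: "0 \<le> t \<and> Y - \<delta> < t \<and> t \<le> Y" if "t \<in> set T" for t using that nn Y by (auto simp: T_def)
    have "Y \<in> set T" using Y \<delta> by (simp add: T_def)
    then have k1: "1 \<le> k" by (cases T) (auto simp: k_def)
    have "c \<le> weight ys" using near \<delta> sup by (simp add: c_def)
    also have "\<dots> \<le> Y" using nn s1 Y by (intro weight_le_max_part) auto
    finally have cY: "c \<le> Y" .
    have "(\<Sum>t\<leftarrow>T. Y - \<delta>) \<le> (\<Sum>t\<leftarrow>T. t)" using T by (intro sum_list_mono) force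
    then have kY: "k * (Y - \<delta>) \<le> 1" using DT D0 by (simp add: k_def sum_list_triv)
    have "(\<Sum>t\<leftarrow>T. t) \<le> (\<Sum>t\<leftarrow>T. Y)" using T by (intro sum_list_mono) force
    then have kY': "1 - \<delta> < k * Y" using DT Dl by (simp add: k_def sum_list_triv)
    have "k * (c / 2) \<le> k * (Y - \<delta>)" using cY \<delta> by (intro mult_left_mono) auto
    with kY have k2: "k \<le> 2 / c" using c by (simp add: field_simps)
    have "weight ys = weight (D @ T)" by (rule weight_mset_cong[OF ms])
    also have "\<dots> \<le> weight T + size M * sum_list D"
      using nn DT part_ge_1 by (intro psum_pw_append_le) (auto simp: D_def T_def)
    also have "\<dots> \<le> weight (replicate k Y) + size M * \<delta>"
      unfolding k_def using T Dl by (intro add_mono weight_le_replicate mult_left_mono) auto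
    also have "weight (replicate k Y) = (k * Y) ^ sum_mset M * equal_weight k"
      by (rule weight_replicate[OF k1])
    finally have w: "weight ys \<le> (k * Y) ^ sum_mset M * equal_weight k + size M * \<delta>" .
    have km: "k = m"
    proof (rule ccontr)
      assume "k \<noteq> m"
      moreover have "k \<le> K" using k2 by (simp add: K_def) linarith
      ultimately have "equal_weight k \<le> e" using e k1 by blast
      moreover have "k * Y \<le> 1 + \<delta> * (2 / c)"
      proof -
        have "k * \<delta> \<le> 2 / c * \<delta>" using k2 \<delta> by (intro mult_right_mono) auto
        then show ?thesis using kY by (simp add: algebra_simps)
      qed
      moreover have "0 \<le> Y" using cY c by simp
      moreover have "0 \<le> equal_weight k" unfolding equal_weight_def by (intro weight_nonneg) auto
      ultimately have "(k * Y) ^ sum_mset M * equal_weight k \<le> (1 + \<delta> * (2 / c)) ^ sum_mset M * e"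
        using \<delta> c by (intro mult_mono power_mono) auto
      with w \<delta>1(2)[OF \<delta>(1,2)] have "weight ys + \<delta> < equal_weight m" by linarith
      with near sup show False by linarith
    qed
    have "1 * \<delta> \<le> real m * \<delta>" using two_le_m \<delta> by (intro mult_right_mono) auto
    then have "real m * Y \<le> 1 + m * \<delta>" "1 - m * \<delta> < real m * Y"
      using kY kY' km by (auto simp: algebra_simps)
    then have "Y \<le> 1 / m + \<delta>" "1 / m - \<delta> < Y"
      using two_le_m by (auto simp: field_simps)
    then have "\<forall>t\<in>set T. \<bar>t - 1 / m\<bar> < 2 * \<delta>" using T \<delta> by (force simp: abs_less_iff)
    with ms km Dl show ?thesis unfolding k_def by blast
  qed
  show ?thesis
  proof (rule exI[of _ "min \<delta>1 (c / 2)"], intro conjI allI impI)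
    show "0 < min \<delta>1 (c / 2)" using \<delta>1 c by simp
    fix \<delta> :: real assume d: "0 < \<delta> \<and> \<delta> < min \<delta>1 (c / 2)"
    show "\<exists>\<theta>>0. \<theta> \<le> \<delta> \<and> (\<forall>ys\<in>unit_vectors. weight_sup - \<theta> < weight ys \<longrightarrow>
     (\<exists>T D. mset ys = mset (D @ T) \<and> length T = m \<and> (\<forall>t\<in>set T. \<bar>t - 1 / m\<bar> < 2 * \<delta>) \<and> sum_list D < \<delta>))"
      using d main sup equal_weight_pos
      by (intro exI[of _ "min \<delta> (weight_sup * exp (- (4 / \<delta>)))"] conjI ballI impI) auto
  qed
qed

text \<open>Vectors approaching the supremum have \<open>m\<close> entries near \<open>1 / m\<close>
  and little else, so their weight is controlled by that of a slightly enlarged equal vector. Let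
  the tolerance tend to 0.\<close>

lemma weight_sup_eq: "weight_sup = equal_weight m"
proof (rule antisym)
  show "equal_weight m \<le> weight_sup" using two_le_m by (intro equal_weight_le_sup) auto
  obtain \<delta>0 where \<delta>0: "0 < \<delta>0" "\<And>\<delta>. 0 < \<delta> \<Longrightarrow> \<delta> < \<delta>0 \<Longrightarrow> (\<exists>\<theta>>0. \<theta> \<le> \<delta> \<and> (\<forall>ys\<in>unit_vectors. weight_sup - \<theta> < weight ys \<longrightarrow>
     (\<exists>T D. mset ys = mset (D @ T) \<and> length T = m \<and> (\<forall>t\<in>set T. \<bar>t - 1 / m\<bar> < 2 * \<delta>) \<and> sum_list D < \<delta>)))"
    using stability_aux by blast
  have *: "weight_sup \<le> weight (replicate m (1 / m + 2 * \<delta>)) + size M * \<delta> + \<delta>" if \<delta>: "0 < \<delta>" "\<delta> < \<delta>0" for \<delta> :: real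
  proof -
    obtain \<theta> where \<theta>: "0 < \<theta>" "\<theta> \<le> \<delta>" "\<And>ys. ys\<in>unit_vectors \<Longrightarrow> weight_sup - \<theta> < weight ys \<Longrightarrow>
     (\<exists>T D. mset ys = mset (D @ T) \<and> length T = m \<and> (\<forall>t\<in>set T. \<bar>t - 1 / m\<bar> < 2 * \<delta>) \<and> sum_list D < \<delta>)"
      using \<delta>0(2)[OF \<delta>] by blast
    have "[1] \<in> unit_vectors" by (simp add: unit_vectors_def)
    then have "\<exists>x\<in>weight ` unit_vectors. weight_sup - \<theta> < x"
      using \<theta> unfolding weight_sup_def by (intro less_cSupD) auto
    then obtain ys where ys: "ys \<in> unit_vectors" "weight_sup - \<theta> < weight ys" by blast
    obtain T D where TD: "mset ys = mset (D @ T)" "length T = m" "\<forall>t\<in>set T. \<bar>t - 1 / m\<bar> < 2 * \<delta>" "sum_list D < \<delta>"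
      using \<theta>(3)[OF ys] by blast
    have nn: "\<forall>y\<in>set (D @ T). 0 \<le> y" and s1: "sum_list (D @ T) = 1"
      using ys(1) mset_eq_setD[OF TD(1)] arg_cong[OF TD(1), of sum_mset]
      by (auto simp: unit_vectors_def sum_mset_sum_list)
    have "weight ys = weight (D @ T)" by (rule weight_mset_cong[OF TD(1)])
    also have "\<dots> \<le> weight T + size M * sum_list D"
      using nn s1 part_ge_1 by (intro psum_pw_append_le) auto
    also have "\<dots> \<le> weight (replicate m (1 / m + 2 * \<delta>)) + size M * \<delta>"
      unfolding TD(2)[symmetric] using TD nn
      by (intro add_mono weight_le_replicate mult_left_mono) (force simp: abs_less_iff)+
    finally show ?thesis using ys \<theta> by linarith
  qed
  have "((\<lambda>\<delta>::real. weight (replicate m (1 / m + 2 * \<delta>)) + size M * \<delta> + \<delta>) \<longlongrightarrow> weight (replicate m (1 / m + 2 * 0)) + real (size M) * 0 + 0) (at_right 0)"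
    by (intro tendsto_intros tendsto_psum_pw_replicate)
  moreover have "eventually (\<lambda>\<delta>::real. weight_sup \<le> weight (replicate m (1 / m + 2 * \<delta>)) + size M * \<delta> + \<delta>) (at_right 0)"
    unfolding eventually_at_right_field using * \<delta>0(1) by blast
  ultimately have "weight_sup \<le> weight (replicate m (1 / m + 2 * 0)) + real (size M) * 0 + 0"
    by (rule tendsto_lowerbound) simp
  then show "weight_sup \<le> equal_weight m" by (simp add: equal_weight_def)
qed

lemma weight_le: "ys \<in> unit_vectors \<Longrightarrow> weight ys \<le> equal_weight m"
  using weight_le_sup weight_sup_eq by simp

lemma stability:
  assumes "0 < \<epsilon>"
  obtains \<theta> where "0 < \<theta>" "\<And>ys. ys \<in> unit_vectors \<Longrightarrow> equal_weight m - \<theta> < weight ys \<Longrightarrow>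
     \<exists>T D. mset ys = mset (D @ T) \<and> length T = m \<and> (\<forall>t\<in>set T. \<bar>t - 1 / m\<bar> < \<epsilon>) \<and> sum_list D < \<epsilon>"
proof -
  obtain \<delta>0 where \<delta>0: "0 < \<delta>0" "\<And>\<delta>. 0 < \<delta> \<Longrightarrow> \<delta> < \<delta>0 \<Longrightarrow> (\<exists>\<theta>>0. \<theta> \<le> \<delta> \<and> (\<forall>ys\<in>unit_vectors. weight_sup - \<theta> < weight ys \<longrightarrow>
     (\<exists>T D. mset ys = mset (D @ T) \<and> length T = m \<and> (\<forall>t\<in>set T. \<bar>t - 1 / m\<bar> < 2 * \<delta>) \<and> sum_list D < \<delta>)))"
    using stability_aux by blast
  define \<delta> where "\<delta> = min (\<delta>0 / 2) (\<epsilon> / 2)"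
  have \<delta>: "0 < \<delta>" "\<delta> < \<delta>0" "2 * \<delta> \<le> \<epsilon>" using assms \<delta>0 by (auto simp: \<delta>_def)
  obtain \<theta> where \<theta>: "0 < \<theta>" "\<And>ys. ys\<in>unit_vectors \<Longrightarrow> weight_sup - \<theta> < weight ys \<Longrightarrow>
     (\<exists>T D. mset ys = mset (D @ T) \<and> length T = m \<and> (\<forall>t\<in>set T. \<bar>t - 1 / m\<bar> < 2 * \<delta>) \<and> sum_list D < \<delta>)"
    using \<delta>0(2)[OF \<delta>(1,2)] by blast
  show thesis
  proof (rule that[OF \<theta>(1)])
    fix ys assume "ys \<in> unit_vectors" "equal_weight m - \<theta> < weight ys"
    then obtain T D where TD: "mset ys = mset (D @ T)" "length T = m" "\<forall>t\<in>set T. \<bar>t - 1 / m\<bar> < 2 * \<delta>" "sum_list D < \<delta>"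
      using \<theta>(2)[of ys] by (auto simp: weight_sup_eq)
    have "\<forall>t\<in>set T. \<bar>t - 1 / m\<bar> < \<epsilon>" "sum_list D < \<epsilon>" using TD \<delta> by force+
    with TD show "\<exists>T D. mset ys = mset (D @ T) \<and> length T = m \<and> (\<forall>t\<in>set T. \<bar>t - 1 / m\<bar> < \<epsilon>) \<and> sum_list D < \<epsilon>"
      by blast
  qed
qed

text \<open>By \<open>stability\<close>, a vector attaining the optimum would have \<open>m\<close>
  entries within \<open>\<epsilon>\<close> of \<open>1 / m\<close>.\<close>

lemma weight_less_if_count_less:
  assumes ys: "ys \<in> unit_vectors" and "0 < \<epsilon>"
    and few: "\<And>T. mset T \<subseteq># mset ys \<Longrightarrow> \<forall>t\<in>set T. \<bar>t - 1 / m\<bar> < \<epsilon> \<Longrightarrow> length T < m"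
  shows "weight ys < equal_weight m"
proof (rule ccontr)
  assume "\<not> ?thesis"
  then have "weight ys = equal_weight m" using weight_le[OF ys] by simp
  moreover obtain \<theta> where "0 < \<theta>" "equal_weight m - \<theta> < weight ys \<Longrightarrow>
     \<exists>T D. mset ys = mset (D @ T) \<and> length T = m \<and> (\<forall>t\<in>set T. \<bar>t - 1 / m\<bar> < \<epsilon>) \<and> sum_list D < \<epsilon>"
    using stability[OF \<open>0 < \<epsilon>\<close>] ys by metis
  ultimately obtain T D where "mset ys = mset (D @ T)" "length T = m" "\<forall>t\<in>set T. \<bar>t - 1 / m\<bar> < \<epsilon>" by auto
  with few[of T] show False by simp
qed

text \<open>There are only \<open>m - 1\<close> entries, so any tolerance will do. This is the
  source of strictness for \<open>move_rate_0_pos\<close>.\<close>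

lemma weight_merged_less: "weight (2 / m # replicate (m - 2) (1 / m)) < equal_weight m"
proof (rule weight_less_if_count_less[where \<epsilon> = 1])
  show "2 / real m # replicate (m - 2) (1 / real m) \<in> unit_vectors"
    using two_le_m by (auto simp: unit_vectors_def sum_list_replicate of_nat_diff field_simps)
  fix T assume "mset T \<subseteq># mset (2 / real m # replicate (m - 2) (1 / real m))"
  from size_mset_mono[OF this] show "length T < m" using two_le_m by simp
qed simp

text \<open>The halves lie at distance exactly \<open>1 / (2 * m)\<close> from \<open>1 / m\<close>,
  hence not strictly within that tolerance, and \<open>m - 1\<close> entries remain. This is the
  source of strictness for \<open>merge_rate_0_pos\<close>.\<close>

lemma weight_split_less:
  "weight (1 / (2 * real m) # 1 / (2 * real m) # replicate (m - 1) (1 / real m)) < equal_weight m"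
proof (rule weight_less_if_count_less[where \<epsilon> = "1 / (2 * real m)"])
  let ?ys = "1 / (2 * real m) # 1 / (2 * real m) # replicate (m - 1) (1 / real m)"
  show "?ys \<in> unit_vectors"
    using two_le_m by (auto simp: unit_vectors_def sum_list_replicate of_nat_diff field_simps)
  show "0 < 1 / (2 * real m)" using two_le_m by simp
  fix T assume sub: "mset T \<subseteq># mset ?ys" and near: "\<forall>t\<in>set T. \<bar>t - 1 / m\<bar> < 1 / (2 * real m)"
  have "1 / m - 1 / (2 * real m) = 1 / (2 * real m)" by (simp add: field_simps)
  then have far: "\<not> \<bar>1 / (2 * real m) - 1 / m\<bar> < 1 / (2 * real m)" by linarith
  have "t = 1 / m" if "t \<in> set T" for t
    using near that far mset_subset_eqD[OF sub, of t] by (auto split: if_splits)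
  then have "T = replicate (length T) (1 / m)" by (simp add: replicate_length_same[symmetric])
  then have "length T = count (mset T) (1 / m)" by (metis count_replicate_mset mset_replicate)
  also have "\<dots> \<le> count (mset ?ys) (1 / m)" by (rule mset_subset_eq_count[OF sub])
  also have "\<dots> < m" using two_le_m by (simp add: field_simps)
  finally show "length T < m" .
qed

end

section \<open>Discrete local moves\<close>

text \<open>The derivative of \<^term>\<open>\<lambda>x. pw x j\<close>.\<close>

definition dpw :: "real \<Rightarrow> nat \<Rightarrow> real" where
  "dpw x j = (if j = 0 then 0 else pw x (j - 1))"

lemma pw_scale: "pw (c * x) \<alpha> = c ^ \<alpha> * pw x \<alpha>"
  by (simp add: pw_def power_mult_distrib)

lemma dpw_scale: "c * dpw (c * x) j = c ^ j * dpw x j"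
  by (cases j) (simp_all add: dpw_def pw_scale)

lemma dpw_nonneg: "0 \<le> x \<Longrightarrow> 0 \<le> dpw x j"
  by (simp add: dpw_def pw_nonneg)

lemma pw_pred: "1 \<le> \<alpha> \<Longrightarrow> x * pw x (\<alpha> - 1) = \<alpha> * pw x \<alpha>"
  by (cases \<alpha>) (simp_all add: pw_def del: of_nat_Suc)

lemma dpw_mult: "x * dpw x j = j * pw x j"
  by (cases j) (simp_all add: dpw_def pw_pred[of "Suc _", simplified])

lemma cw_Suc_diff: "1 \<le> \<alpha> \<Longrightarrow> cw (Suc x) \<alpha> = cw x \<alpha> + cw x (\<alpha> - 1)"
  by (cases \<alpha>) (simp_all add: cw_def)

lemma cw_mono: "x \<le> y \<Longrightarrow> cw x \<alpha> \<le> cw y \<alpha>"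
  by (simp add: cw_def binomial_right_mono)

text \<open>By Pascal's rule the difference is the sum of \<open>cw x j\<close> over
  \<open>Y \<le> x < X\<close>, and each summand lies between \<open>cw Y j\<close> and
  \<open>cw X j\<close>.\<close>

lemma cw_diff_bounds:
  assumes "Y \<le> X"
  shows "cw X (Suc j) - cw Y (Suc j) \<le> real (X - Y) * cw X j"
    and "real (X - Y) * cw Y j \<le> cw X (Suc j) - cw Y (Suc j)"
  using assms
proof (induction X rule: dec_induct)
  case (step X)
  { case 1
    have "real (X - Y) * cw X j \<le> real (X - Y) * cw (Suc X) j" by (intro mult_left_mono cw_mono) auto
    moreover have "cw X j \<le> cw (Suc X) j" by (intro cw_mono) auto
    ultimately show ?case using step by (simp add: cw_Suc_diff Suc_diff_le distrib_right) }
  { case 2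
    have "cw Y j \<le> cw X j" using step by (intro cw_mono) auto
    then show ?case using step by (simp add: cw_Suc_diff Suc_diff_le distrib_right) }
qed simp_all

text \<open>A discrete mean value estimate. The extra factor \<open>c\<close> replaces the power
  lost by differentiation, so that \<open>c ^ j\<close> also fits for \<open>j = 0\<close>, where
  both sides vanish.\<close>

lemma cw_diff_le_dpw:
  assumes "Y \<le> X" "real X \<le> c * u" "0 \<le> c" "0 \<le> u"
  shows "c * (cw X j - cw Y j) \<le> real (X - Y) * (c ^ j * dpw u j)"
proof (cases j)
  case (Suc i)
  have "c * (cw X j - cw Y j) \<le> c * (real (X - Y) * cw X i)"
    using cw_diff_bounds(1)[OF assms(1), of i] assms by (intro mult_left_mono) (auto simp: Suc)
  also have "\<dots> \<le> c * (real (X - Y) * pw (c * u) i)"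
    using assms by (intro mult_left_mono order_trans[OF cw_le_pw pw_mono]) auto
  also have "\<dots> = real (X - Y) * (c * dpw (c * u) j)" by (simp add: Suc dpw_def)
  finally show ?thesis by (simp only: dpw_scale)
qed (simp add: dpw_def cw_def)

lemma dpw_le_cw_diff:
  assumes "Y \<le> X" "c * v \<le> real Y - j" "0 \<le> c" "0 \<le> v"
  shows "real (X - Y) * (c ^ j * dpw v j) \<le> c * (cw X j - cw Y j)"
proof (cases j)
  case (Suc i)
  have "real (X - Y) * (c ^ j * dpw v j) = c * (real (X - Y) * pw (c * v) i)"
    by (simp add: dpw_scale[symmetric]) (simp add: Suc dpw_def)
  also have "\<dots> \<le> c * (real (X - Y) * cw Y i)"
    using assms by (intro mult_left_mono pw_le_cw) (auto simp: Suc)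
  also have "\<dots> \<le> c * (cw X j - cw Y j)"
    using cw_diff_bounds(2)[OF assms(1), of i] assms by (intro mult_left_mono) (auto simp: Suc)
  finally show ?thesis .
qed (simp add: dpw_def cw_def)

lemma cw_absorb: "real (Suc i) * cw x (Suc i) = (real x - real i) * cw x i"
proof -
  have "fact i * (real (Suc i) * cw x (Suc i)) = fact (Suc i) * cw x (Suc i)" by simp
  also have "\<dots> = (fact i * cw x i) * (real x - real i)"
    by (simp only: fact_mult_cw prod.lessThan_Suc)
  finally have "fact i * (real (Suc i) * cw x (Suc i)) = fact i * ((real x - real i) * cw x i)"
    by simp
  then show ?thesis by simp
qed

text \<open>Raising \<open>i\<close> by one multiplies the left-hand side by (Y-i)/(i+1) and the
  right-hand side by the larger (X-i)/(i+1).\<close>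

lemma cw_cross_mult_le:
  assumes "Y \<le> X" "j \<le> i"
  shows "cw X j * cw Y i \<le> cw X i * cw Y j"
  using assms(2)
proof (induction i rule: dec_induct)
  case (step i)
  show ?case
  proof (cases "Suc i \<le> Y")
    case True
    have "real (Suc i) * (cw X j * cw Y (Suc i)) = cw X j * (real (Suc i) * cw Y (Suc i))"
      by (rule mult.left_commute)
    also have "\<dots> = (real Y - real i) * (cw X j * cw Y i)"
      unfolding cw_absorb by (rule mult.left_commute)
    also have "\<dots> \<le> (real X - real i) * (cw X i * cw Y j)"
      using True assms step by (intro mult_mono[OF _ step.IH]) (auto simp: cw_nonneg)
    also have "\<dots> = real (Suc i) * cw X (Suc i) * cw Y j"
      unfolding cw_absorb by (rule mult.assoc[symmetric])
    also have "\<dots> = real (Suc i) * (cw X (Suc i) * cw Y j)" by (rule mult.assoc)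
    finally show ?thesis by (rule mult_left_le_imp_le) simp
  next
    case False
    then have "cw Y (Suc i) = 0" by (simp add: cw_def binomial_eq_0)
    then show ?thesis by (simp add: cw_nonneg)
  qed
qed simp

text \<open>For two parts of sizes between \<open>c * v\<close> and \<open>c * u\<close>, a lower bound for the gain from moving one vertex
  from the larger to the smaller part, counting only the copies whose parts of sizes \<open>a\<close> and \<open>b\<close> lie in
  these two parts, and normalised by the appropriate power of \<open>c\<close>.\<close>

definition move_gain :: "real \<Rightarrow> real \<Rightarrow> nat \<Rightarrow> nat \<Rightarrow> real" where
  "move_gain v u a b = pw v (a - 1) * pw v (b - 1) * (1 / a + 1 / b)
     - u * ((real a - real b) / (a * b)) * (dpw u (a - 1) * pw u (b - 1) - dpw v (b - 1) * pw v (a - 1))"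

lemma move_gain_le:
  assumes "Y \<le> X" "real X \<le> c * u" "real Y + 1 \<le> c * u" "c * v \<le> real Y - a" "0 \<le> c" "0 \<le> v"
    and ab: "1 \<le> b" "b \<le> a"
  shows "real (X - Y) * (c ^ (a + b) * move_gain v u a b)
     \<le> c\<^sup>2 * (cw X a * cw (Suc Y) b + cw X b * cw (Suc Y) a - cw (Suc X) a * cw Y b - cw (Suc X) b * cw Y a)"
proof -
  obtain i j where ij: "a = Suc i" "b = Suc j" "j \<le> i" using ab by (cases a; cases b) auto
  define U where "U = cw X i * cw Y j"
  define V where "V = cw X j * cw Y i"
  define d where "d = real a - real b"
  define W where "W = dpw u i * pw u j - dpw v j * pw v i"
  have d: "0 \<le> d" using ab by (simp add: d_def)
  have XY: "real (X - Y) = real X - real Y" using assms by simp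
  have cu: "0 \<le> c * u" using assms by linarith
  have u: "0 \<le> u" if "c \<noteq> 0" using that cu assms by (simp add: zero_le_mult_iff)
  have UV: "V \<le> U" unfolding U_def V_def using assms ij by (intro cw_cross_mult_le)
  have abs: "cw x (Suc k) = (real x - k) / Suc k * cw x k" for x k
    using cw_absorb[of k x] by (simp add: field_simps del: of_nat_Suc)
  have shift: "(real x - real k) / Suc k = (real x + 1) / Suc k - 1" for x k
    by (simp add: field_simps)
  have "cw X a * cw (Suc Y) b + cw X b * cw (Suc Y) a - cw (Suc X) a * cw Y b - cw (Suc X) b * cw Y a
      = cw X a * cw Y j + cw X b * cw Y i - cw X i * cw Y b - cw X j * cw Y a"
    by (simp add: cw_Suc_diff ij algebra_simps)
  also have "\<dots> = U * ((real X - i) / a) + V * ((real X - j) / b) - U * ((real Y - j) / b) - V * ((real Y - i) / a)"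
    unfolding U_def V_def ij(1,2) abs by (simp only: mult_ac)
  also have "\<dots> = V * ((real X + 1) / a - (real Y + 1) / a + ((real X + 1) / b - (real Y + 1) / b))
      + (U - V) * ((real X + 1) / a - (real Y + 1) / b)"
    unfolding ij(1,2) shift by (simp only: algebra_simps)
  also have "(real X + 1) / a - (real Y + 1) / a + ((real X + 1) / b - (real Y + 1) / b) = real (X - Y) * (1 / a + 1 / b)"
    unfolding XY by (simp add: diff_divide_distrib[symmetric] distrib_left)
  \<comment> \<open>The first summand is proportional to \<open>X - Y\<close>. In the second,
    \<open>U - V\<close> is nonnegative and at most of the order of \<open>X - Y\<close> as well, so
    a negative second factor can be paid for by the first summand.\<close>
  finally have eq: "cw X a * cw (Suc Y) b + cw X b * cw (Suc Y) a - cw (Suc X) a * cw Y b - cw (Suc X) b * cw Y a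
      = V * (real (X - Y) * (1 / a + 1 / b)) + (U - V) * ((real X + 1) / a - (real Y + 1) / b)" .
  show ?thesis
  proof (cases "c = 0")
    case True
    then show ?thesis using ij by simp
  next
    case False
    note u = u[OF False]
    have "(real Y + 1) / a \<le> (real X + 1) / a" using assms by (intro divide_right_mono) auto
    then have "- ((real Y + 1) * (d / (a * b))) \<le> (real X + 1) / a - (real Y + 1) / b"
      using ab by (simp add: d_def field_simps)
    moreover have "(real Y + 1) * (d / (a * b)) \<le> c * u * (d / (a * b))"
      using assms d by (intro mult_right_mono) auto
    ultimately have "- (c * u * (d / (a * b))) \<le> (real X + 1) / a - (real Y + 1) / b" by linarith
    then have 1: "- ((U - V) * (c * u * (d / (a * b)))) \<le> (U - V) * ((real X + 1) / a - (real Y + 1) / b)"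
      using UV mult_left_mono[of "- (c * u * (d / (a * b)))" "(real X + 1) / a - (real Y + 1) / b" "U - V"] by simp
    \<comment> \<open>Both products contain an increment from \<open>Y\<close> to \<open>X\<close>,
      which brings out the factor \<open>X - Y\<close>.\<close>
    have "c * (U - V) = c * (cw X i - cw Y i) * cw Y j - c * (cw X j - cw Y j) * cw Y i"
      by (simp add: U_def V_def algebra_simps)
    also have "\<dots> \<le> (real (X - Y) * (c ^ i * dpw u i)) * pw (c * u) j - (real (X - Y) * (c ^ j * dpw v j)) * pw (c * v) i"
    proof (rule diff_mono[OF mult_mono mult_mono])
      show "c * (cw X i - cw Y i) \<le> real (X - Y) * (c ^ i * dpw u i)"
        using assms u by (intro cw_diff_le_dpw)
      show "cw Y j \<le> pw (c * u) j"
        using assms by (intro order_trans[OF cw_le_pw pw_mono]) auto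
      show "real (X - Y) * (c ^ j * dpw v j) \<le> c * (cw X j - cw Y j)"
        using assms ij by (intro dpw_le_cw_diff) auto
      show "pw (c * v) i \<le> cw Y i" using assms ij by (intro pw_le_cw) auto
    qed (use assms u in \<open>auto simp: cw_nonneg dpw_nonneg pw_nonneg cw_mono\<close>)
    also have "\<dots> = real (X - Y) * (c ^ (i + j) * W)"
      by (simp add: W_def pw_scale power_add algebra_simps)
    finally have "c * (U - V) * (c\<^sup>2 * (u * (d / (a * b)))) \<le> real (X - Y) * (c ^ (i + j) * W) * (c\<^sup>2 * (u * (d / (a * b))))"
      using u d by (intro mult_right_mono) auto
    then have 2: "c\<^sup>2 * ((U - V) * (c * u * (d / (a * b)))) \<le> real (X - Y) * (c ^ (a + b) * (u * (d / (a * b)) * W))"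
      by (simp add: ij power_add power2_eq_square mult_ac)
    have "pw (c * v) j * pw (c * v) i \<le> V"
      unfolding V_def using assms ij
      by (intro mult_mono order_trans[OF pw_le_cw cw_mono[OF assms(1)]] pw_le_cw) (auto simp: cw_nonneg pw_nonneg)
    then have "c\<^sup>2 * ((pw (c * v) j * pw (c * v) i) * (real (X - Y) * (1 / a + 1 / b)))
        \<le> c\<^sup>2 * (V * (real (X - Y) * (1 / a + 1 / b)))"
      by (intro mult_left_mono mult_right_mono) auto
    also have "c\<^sup>2 * ((pw (c * v) j * pw (c * v) i) * (real (X - Y) * (1 / a + 1 / b)))
        = real (X - Y) * (c ^ (a + b) * (pw v i * pw v j * (1 / a + 1 / b)))"
      by (simp only: pw_scale ij power_add power2_eq_square power_Suc) (simp only: mult_ac)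
    finally have 3: "real (X - Y) * (c ^ (a + b) * (pw v i * pw v j * (1 / a + 1 / b)))
        \<le> c\<^sup>2 * (V * (real (X - Y) * (1 / a + 1 / b)))" .
    have "move_gain v u a b = pw v i * pw v j * (1 / a + 1 / b) - u * (d / (a * b)) * W"
      unfolding move_gain_def W_def d_def ij(1,2) by (simp only: of_nat_mult diff_Suc_1)
    then have "real (X - Y) * (c ^ (a + b) * move_gain v u a b)
        = real (X - Y) * (c ^ (a + b) * (pw v i * pw v j * (1 / a + 1 / b))) - real (X - Y) * (c ^ (a + b) * (u * (d / (a * b)) * W))"
      by (simp only: right_diff_distrib)
    also have "\<dots> \<le> c\<^sup>2 * (V * (real (X - Y) * (1 / a + 1 / b))) - c\<^sup>2 * ((U - V) * (c * u * (d / (a * b))))"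
      using 2 3 by linarith
    also have "\<dots> = c\<^sup>2 * (V * (real (X - Y) * (1 / a + 1 / b))) + c\<^sup>2 * (- ((U - V) * (c * u * (d / (a * b)))))" by simp
    also have "\<dots> \<le> c\<^sup>2 * (V * (real (X - Y) * (1 / a + 1 / b))) + c\<^sup>2 * ((U - V) * ((real X + 1) / a - (real Y + 1) / b))"
      using 1 by (intro add_left_mono mult_left_mono) auto
    finally show ?thesis unfolding eq by (simp only: distrib_left)
  qed
qed

text \<open>After multiplication by \<open>z\<^sup>2\<close> everything is a multiple of
  \<open>pw z a * pw z b\<close>. With d = a - b the multiple is a + b - d^2 = 2 (b - (d choose 2)),
  which is at least 2.\<close>

lemma move_gain_diagonal_ge:
  assumes "0 < z" "1 \<le> b" "b \<le> a" "(a - b) choose 2 < b"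
  shows "2 * (pw z a * pw z b) \<le> z\<^sup>2 * move_gain z z a b"
proof -
  define d where "d = a - b"
  have a: "real a = real b + real d" using assms by (simp add: d_def)
  have "2 * (d choose 2) = d * (d - 1)" by (cases d) (simp_all add: choose_two)
  then have "real (2 * (d choose 2)) = real (d * (d - 1))" by (rule arg_cong)
  then have ch: "2 * real (d choose 2) = real d * real d - real d" by (cases d) (auto simp: algebra_simps)
  have "real (d choose 2) + 1 \<le> real b" using assms by (simp add: d_def)
  then have ge2: "2 \<le> real a + real b - real d * real d" using ch a by linarith
  have "z\<^sup>2 * move_gain z z a b = (z * pw z (a - 1)) * (z * pw z (b - 1)) * (1 / a + 1 / b)
      - (real d / (a * b)) * ((z * (z * dpw z (a - 1))) * (z * pw z (b - 1)) - (z * (z * dpw z (b - 1))) * (z * pw z (a - 1)))"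
    by (simp add: move_gain_def a power2_eq_square algebra_simps)
  also have "\<dots> = (z * pw z (a - 1)) * (z * pw z (b - 1)) * ((1 / a + 1 / b) - (real d / (a * b)) * (real (a - 1) - real (b - 1)))"
    unfolding dpw_mult by (simp add: algebra_simps)
  also have "real (a - 1) - real (b - 1) = d" using assms a by (simp add: of_nat_diff)
  also have "(z * pw z (a - 1)) * (z * pw z (b - 1)) * ((1 / a + 1 / b) - (real d / (a * b)) * real d)
      = pw z a * pw z b * (real a + real b - real d * real d)"
    unfolding pw_pred[OF \<open>1 \<le> b\<close>] pw_pred[OF order_trans[OF \<open>1 \<le> b\<close> \<open>b \<le> a\<close>]]
    using assms by (simp add: field_simps)
  also have "2 * (pw z a * pw z b) \<le> \<dots>"
    using ge2 assms mult_left_mono[OF ge2, of "pw z a * pw z b"] by (simp add: pw_nonneg mult_ac)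
  finally show ?thesis .
qed

text \<open>Compares the second derivative of a power with the finite difference
  \<open>2 ^ n - 2\<close> that arises when two equal parts are merged.\<close>

lemma pred_mult_le_two_power: "1 \<le> n \<Longrightarrow> n * (n - 1) + 2 \<le> (2::nat) ^ n"
proof (induction n rule: dec_induct)
  case (step n)
  have "2 * n \<le> 2 ^ n" using step.hyps
  proof (induction n rule: dec_induct)
    case (step k) then show ?case using one_le_power[of "2::nat" k] self_le_power by (auto intro: le_trans)
  qed simp
  with step show ?case by (cases n) auto
qed simp

text \<open>Three terms of Vandermonde's identity; they are distinct because
  \<open>\<alpha> \<ge> 2\<close>.\<close>

lemma binomial_add_ge:
  assumes "2 \<le> \<alpha>"
  shows "cw x \<alpha> + real q * cw x (\<alpha> - 1) + cw q \<alpha> \<le> cw (x + q) \<alpha>"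
proof -
  have "(\<Sum>k\<in>{0, \<alpha> - 1, \<alpha>}. (x choose k) * (q choose (\<alpha> - k))) \<le> (\<Sum>k\<le>\<alpha>. (x choose k) * (q choose (\<alpha> - k)))"
    by (rule sum_mono2) auto
  also have "\<dots> = (x + q) choose \<alpha>" by (rule vandermonde)
  finally have "(x choose \<alpha>) + q * (x choose (\<alpha> - 1)) + (q choose \<alpha>) \<le> (x + q) choose \<alpha>"
    using assms by (auto simp: mult.commute)
  then have "real ((x choose \<alpha>) + q * (x choose (\<alpha> - 1)) + (q choose \<alpha>)) \<le> real ((x + q) choose \<alpha>)"
    by (rule of_nat_mono)
  then show ?thesis by (simp add: cw_def)
qed

context balanced_parts_max
begin

definition z where "z = 1 / real m"

lemma z_pos: "0 < z"
  using two_le_m by (simp add: z_def)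

lemma equal_weight_split: "equal_weight m = weight (z # z # replicate (m - 2) z)"
proof -
  have "replicate m z = z # z # replicate (m - 2) z"
    using two_le_m by (metis Suc_diff_Suc add_2_eq_Suc le_add_diff_inverse replicate_Suc)
  then show ?thesis by (simp add: equal_weight_def z_def del: psum.simps)
qed

lemma psum_cw_ge_replicate:
  assumes "\<forall>t\<in>set T. c * v \<le> real t - sum_mset M" "0 \<le> c" "0 \<le> v" "N \<subseteq># M"
  shows "c ^ sum_mset N * psum pw N (replicate (length T) v) \<le> psum cw N T"
proof -
  have "psum pw N (map ((*) c) (replicate (length T) v)) = c ^ sum_mset N * psum pw N (replicate (length T) v)"
    by (rule psum_scale) (rule pw_scale)
  moreover have "psum pw N (map ((*) c) (replicate (length T) v)) \<le> psum cw N T"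
  proof (intro psum_mono[THEN conjunct2])
    have "pw (c * v) \<alpha> \<le> cw t \<alpha>" if "t \<in> set T" "\<alpha> \<in># N" for t \<alpha>
    proof (rule pw_le_cw)
      have "\<alpha> \<in># M" using that assms(4) by (meson mset_subset_eqD)
      then have "\<alpha> \<le> sum_mset M" by (simp add: sum_mset.remove)
      then have "real \<alpha> \<le> real (sum_mset M)" by (rule of_nat_mono)
      with assms(1) that(1) show "c * v \<le> real t - real \<alpha>" by fastforce
    qed (use assms in simp)
    then show "list_all2 (\<lambda>x y. \<forall>\<alpha>\<in>#N. 0 \<le> pw x \<alpha> \<and> pw x \<alpha> \<le> cw y \<alpha>) (map ((*) c) (replicate (length T) v)) T"
      using assms by (auto simp: list_all2_conv_all_nth intro!: pw_nonneg)
  qed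
  ultimately show ?thesis by simp
qed

lemma sum_list_map_real: "sum_list (map real xs) = real (sum_list xs)"
  by (induction xs) auto

lemma psum_cw_le_pw: "psum cw N T \<le> psum pw N (map real T)"
  by (intro psum_mono[THEN conjunct2]) (auto simp: list_all2_conv_all_nth cw_nonneg cw_le_pw)

lemma psum_cw_le_replicate:
  assumes "\<forall>t\<in>set T. real t \<le> c * u" "0 < c" "0 \<le> u"
    and D: "real (sum_list T) + real (sum_list D) \<le> c" and N: "N \<subseteq># M"
  shows "psum cw N (D @ T) \<le> c ^ sum_mset N * (psum pw N (replicate (length T) u) + size M * (real (sum_list D) / c))"
proof -
  let ?s = "\<lambda>t. real t / c"
  have "psum cw N (D @ T) \<le> psum pw N (map real (D @ T))" by (rule psum_cw_le_pw)
  also have "\<dots> = c ^ sum_mset N * psum pw N (map ?s (D @ T))"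
  proof -
    have "map real (D @ T) = map ((*) c) (map ?s (D @ T))" using assms by simp
    then show ?thesis by (simp only:) (rule psum_scale, rule pw_scale)
  qed
  also have "psum pw N (map ?s (D @ T)) \<le> psum pw N (map ?s T) + size N * sum_list (map ?s D)"
    unfolding map_append
  proof (rule psum_pw_append_le)
    show "\<forall>\<alpha>\<in>#N. 1 \<le> \<alpha>" using N part_ge_1 by (meson mset_subset_eqD)
    have "sum_list (map ?s xs) = sum_list xs / c" for xs
      by (induction xs) (auto simp: add_divide_distrib)
    then show "sum_list (map ?s D @ map ?s T) \<le> 1"
      using D assms by (simp add: add_divide_distrib[symmetric] divide_le_eq sum_list_map_real)
  qed (use assms in auto)
  also have "\<dots> \<le> psum pw N (replicate (length T) u) + size M * (real (sum_list D) / c)"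
  proof (intro add_mono mult_mono)
    show "psum pw N (map ?s T) \<le> psum pw N (replicate (length T) u)"
      using assms by (intro psum_mono[THEN conjunct2])
         (auto simp: list_all2_conv_all_nth pos_divide_le_eq mult.commute intro!: pw_nonneg pw_mono)
    show "real (size N) \<le> real (size M)" using N by (simp add: size_mset_mono)
    show "sum_list (map ?s D) \<le> real (sum_list D) / c" by (induction D) (auto simp: add_divide_distrib)
  qed (use assms in \<open>auto intro!: sum_list_nonneg\<close>)
  finally show ?thesis using assms by (simp add: mult_left_mono)
qed

lemma psum_nonneg_cw: "0 \<le> psum cw N T"
  by (intro psum_nonneg cw_nonneg)

lemma sum_mset_pair:
  assumes "(\<alpha>, \<beta>) \<in> part_pairs M"
  shows "sum_mset M = \<alpha> + \<beta> + sum_mset (M - {#\<alpha>, \<beta>#})"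
proof -
  have "M = {#\<alpha>, \<beta>#} + (M - {#\<alpha>, \<beta>#})"
    using assms unfolding part_pairs_iff by (rule subset_mset.add_diff_inverse[symmetric])
  then show ?thesis by (metis add.assoc sum_mset.add_mset sum_mset.union sum_mset.empty add_mset_add_single add.right_neutral union_mset_add_mset_left add_0)
qed


section \<open>Merging a small leftover part into a large part\<close>

text \<open>A lower bound for the net gain, in units of \<open>q * n ^ (sum_mset M - 1)\<close>,
  when a part of \<open>q \<le> \<epsilon> * n\<close> vertices is merged into one of about
  \<open>z * n\<close>. The gain comes from \<open>binomial_add_ge\<close>, the loss from copies
  using both parts. The loss is linear in \<open>q\<close> too: the other \<open>\<beta> - 1\<close>
  factors are bounded by \<open>\<epsilon> * n\<close>, so at \<open>\<epsilon> = 0\<close> only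
  \<open>\<beta> = 1\<close> survives.\<close>

definition merge_rate :: "real \<Rightarrow> real" where
  "merge_rate \<epsilon> =
     (\<Sum>\<alpha>\<in>set_mset M. (if 2 \<le> \<alpha> then pw (z - 2 * \<epsilon>) (\<alpha> - 1) else 0) * psum pw (M - {#\<alpha>#}) (replicate (m - 1) (z - 2 * \<epsilon>)))
     - (\<Sum>(\<alpha>, \<beta>)\<in>part_pairs M. pw (z + \<epsilon>) \<alpha> * \<epsilon> ^ (\<beta> - 1) * (psum pw (M - {#\<alpha>, \<beta>#}) (replicate (m - 1) (z + \<epsilon>)) + real (size M) * \<epsilon>))"

lemma psum_replicate_pw_nonneg: "0 \<le> x \<Longrightarrow> 0 \<le> psum pw N (replicate k x)"
  by (intro psum_nonneg pw_nonneg) auto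

text \<open>The constant 4 is the largest that works: the claim reduces to 4 (1 - 2 / 2^\<alpha>)
  being at most \<alpha> for \<alpha> \<ge> 2, with equality for 2 and 3. For \<alpha> = 1 both
  sides vanish.\<close>

lemma split_one_le:
  assumes "0 < x" "1 \<le> \<alpha>"
  shows "4 * (pw x \<alpha> - 2 * pw (x / 2) \<alpha>) \<le> (if 2 \<le> \<alpha> then x * pw x (\<alpha> - 1) else 0)"
proof -
  have half: "pw (x / 2) \<alpha> = pw x \<alpha> / 2 ^ \<alpha>" by (simp add: pw_def power_divide)
  have "4 * (1 - 2 / 2 ^ \<alpha>) \<le> (if 2 \<le> \<alpha> then real \<alpha> else 0)"
  proof -
    consider "\<alpha> = 1" | "\<alpha> = 2" | "\<alpha> = 3" | "4 \<le> \<alpha>" using assms by linarith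
    then show ?thesis
    proof cases
      case 4
      have "4 * (1 - 2 / 2 ^ \<alpha>) \<le> (4::real)" by simp
      also have "\<dots> \<le> (if 2 \<le> \<alpha> then real \<alpha> else 0)" using 4 by simp
      finally show ?thesis .
    qed simp_all
  qed
  from mult_left_mono[OF this pw_nonneg, of x \<alpha>] show ?thesis
    using assms by (cases "2 \<le> \<alpha>") (simp_all add: half pw_pred[OF assms(2), unfolded One_nat_def] algebra_simps)
qed

text \<open>The powers of 0 single out sizes equal to 1. By \<open>part_close\<close> such a size
  forces the other one to be at most 2, and then equality holds; otherwise the left-hand side is
  0.\<close>

lemma split_pair_ge:
  assumes "\<alpha> \<in># M" "\<beta> \<in># M"
  shows "z * (pw z \<alpha> * 0 ^ (\<beta> - 1) + pw z \<beta> * 0 ^ (\<alpha> - 1)) \<le> 8 * (pw (z / 2) \<alpha> * pw (z / 2) \<beta>)"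
proof -
  have one: "z * (pw z \<alpha> * 0 ^ (1 - 1) + pw z 1 * 0 ^ (\<alpha> - 1)) \<le> 8 * (pw (z / 2) \<alpha> * pw (z / 2) 1)"
    if "\<alpha> \<in># M" "1 \<in># M" for \<alpha>
  proof -
    have c: "(\<alpha> - 1) choose 2 < 1" by (rule part_close[OF that])
    have "\<alpha> - 1 < 2"
    proof (rule ccontr)
      assume "\<not> ?thesis"
      then have "0 < (\<alpha> - 1) choose 2" by (intro zero_less_binomial) simp
      with c show False by simp
    qed
    moreover have "1 \<le> \<alpha>" using that(1) by (rule part_ge_1)
    ultimately consider "\<alpha> = 1" | "\<alpha> = 2" by linarith
    then show ?thesis by cases (simp_all add: pw_def power2_eq_square)
  qed
  consider "\<alpha> = 1" | "\<beta> = 1" | "\<alpha> \<noteq> 1" "\<beta> \<noteq> 1" by blast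
  then show ?thesis
  proof cases
    case 1
    then show ?thesis using one[of \<beta>] assms
      by (simp add: add.commute[of "pw z \<beta>"] mult.commute[of "pw (z / 2) \<beta>"])
  next
    case 2
    then show ?thesis using one[of \<alpha>] assms by simp
  next
    case 3
    have "1 \<le> \<alpha>" "1 \<le> \<beta>" using assms part_ge_1 by blast+
    with 3 have "0 < \<alpha> - 1" "0 < \<beta> - 1" by linarith+
    then have "(0::real) ^ (\<alpha> - 1) = 0" "(0::real) ^ (\<beta> - 1) = 0" by (simp_all only: zero_power)
    moreover have "0 \<le> 8 * (pw (z / 2) \<alpha> * pw (z / 2) \<beta>)" using z_pos by (simp add: pw_nonneg)
    ultimately show ?thesis by (simp only: mult_zero_right add_0)
  qed
qed

text \<open>Halving one part of the equal vector strictly lowers its weight. By the two preceding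
  lemmas \<open>z\<close> times the gain is at least 4 times the part of the difference due to
  single sizes, and \<open>z\<close> times the loss is at most 4 times the part due to
  pairs.\<close>

lemma merge_rate_0_pos: "0 < merge_rate 0"
proof -
  define R where "R = replicate (m - 1) z"
  define C1 where "C1 \<alpha> = psum pw (M - {#\<alpha>#}) R" for \<alpha>
  define C2 where "C2 \<alpha> \<beta> = psum pw (M - {#\<alpha>, \<beta>#}) R" for \<alpha> \<beta>
  have C: "0 \<le> C1 \<alpha>" "0 \<le> C2 \<alpha> \<beta>" "C2 \<alpha> \<beta> = C2 \<beta> \<alpha>" for \<alpha> \<beta>
    using z_pos by (auto simp: C1_def C2_def R_def psum_replicate_pw_nonneg add_mset_commute)
  have "z # R = replicate m z" using two_le_m by (cases m) (auto simp: R_def)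
  then have eq: "weight (z # R) = equal_weight m" by (simp only: equal_weight_def z_def)
  have less: "weight (z / 2 # z / 2 # R) < equal_weight m"
    using weight_split_less by (simp only: R_def z_def divide_divide_eq_left mult.commute)
  define S1 where "S1 = (\<Sum>\<alpha>\<in>set_mset M. (pw z \<alpha> - 2 * pw (z / 2) \<alpha>) * C1 \<alpha>)"
  define S2 where "S2 = (\<Sum>(\<alpha>, \<beta>)\<in>part_pairs M. pw (z / 2) \<alpha> * pw (z / 2) \<beta> * C2 \<alpha> \<beta>)"
  define G1 where "G1 = (\<Sum>\<alpha>\<in>set_mset M. (if 2 \<le> \<alpha> then pw z (\<alpha> - 1) else 0) * C1 \<alpha>)"
  define G2 where "G2 = (\<Sum>(\<alpha>, \<beta>)\<in>part_pairs M. pw z \<alpha> * 0 ^ (\<beta> - 1) * C2 \<alpha> \<beta>)"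
  have "weight (z # R) - weight (z / 2 # z / 2 # R) = S1 - S2"
    unfolding psum_two S1_def S2_def
    by (simp add: C1_def C2_def sum_subtractf[symmetric] left_diff_distrib add_mset_commute sum_distrib_left algebra_simps)
  with eq less have "S2 < S1" by simp
  have "4 * S1 \<le> z * G1"
    unfolding S1_def G1_def sum_distrib_left
  proof (rule sum_mono)
    fix \<alpha> assume "\<alpha> \<in># M"
    from mult_right_mono[OF split_one_le[OF z_pos part_ge_1[OF this]] C(1)[of \<alpha>]]
    show "4 * ((pw z \<alpha> - 2 * pw (z / 2) \<alpha>) * C1 \<alpha>) \<le> z * ((if 2 \<le> \<alpha> then pw z (\<alpha> - 1) else 0) * C1 \<alpha>)"
      by (simp only: mult.assoc[symmetric] if_distrib[of "(*) z"] mult_zero_right)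
  qed
  moreover have "z * G2 \<le> 4 * S2"
  proof -
    have "2 * (z * G2) = z * (\<Sum>(\<alpha>, \<beta>)\<in>part_pairs M. (pw z \<alpha> * 0 ^ (\<beta> - 1) + pw z \<beta> * 0 ^ (\<alpha> - 1)) * C2 \<alpha> \<beta>)"
      unfolding G2_def by (subst sum_part_pairs_symmetrize[OF C(3), symmetric]) simp
    also have "\<dots> \<le> (\<Sum>(\<alpha>, \<beta>)\<in>part_pairs M. 8 * (pw (z / 2) \<alpha> * pw (z / 2) \<beta> * C2 \<alpha> \<beta>))"
      unfolding sum_distrib_left
    proof (rule sum_mono)
      fix p assume "p \<in> part_pairs M"
      then obtain \<alpha> \<beta> where p: "p = (\<alpha>, \<beta>)" "\<alpha> \<in># M" "\<beta> \<in># M" by (cases p) (auto dest: part_pairsD)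
      from mult_right_mono[OF split_pair_ge[OF p(2,3)] C(2)[of \<alpha> \<beta>]]
      show "z * (case p of (\<alpha>, \<beta>) \<Rightarrow> (pw z \<alpha> * 0 ^ (\<beta> - 1) + pw z \<beta> * 0 ^ (\<alpha> - 1)) * C2 \<alpha> \<beta>)
          \<le> (case p of (\<alpha>, \<beta>) \<Rightarrow> 8 * (pw (z / 2) \<alpha> * pw (z / 2) \<beta> * C2 \<alpha> \<beta>))"
        unfolding p(1) prod.case by (simp only: mult.assoc)
    qed
    also have "\<dots> = 8 * S2" by (simp add: S2_def sum_distrib_left case_prod_unfold)
    finally show ?thesis by linarith
  qed
  moreover have "4 * S2 < 4 * S1" using \<open>S2 < S1\<close> by simp
  ultimately have "z * G2 < z * G1" by linarith
  then have "G2 < G1" using z_pos by simp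
  moreover have "merge_rate 0 = G1 - G2"
    by (simp add: merge_rate_def G1_def G2_def C1_def C2_def R_def cong: if_cong)
  ultimately show ?thesis by simp
qed

lemma merge_rate_tendsto: "(merge_rate \<longlongrightarrow> merge_rate 0) (at_right 0)"
proof -
  have if_t: "((\<lambda>\<epsilon>. if 2 \<le> \<alpha> then pw (z - 2 * \<epsilon>) (\<alpha> - 1) else 0) \<longlongrightarrow> (if 2 \<le> \<alpha> then pw (z - 2 * 0) (\<alpha> - 1) else 0)) (at_right 0)" for \<alpha>
    unfolding pw_def by (cases "2 \<le> \<alpha>") (auto intro!: tendsto_eq_intros)
  have *: "((\<lambda>\<epsilon>. (\<Sum>\<alpha>\<in>set_mset M. (if 2 \<le> \<alpha> then pw (z - 2 * \<epsilon>) (\<alpha> - 1) else 0) * psum pw (M - {#\<alpha>#}) (replicate (m - 1) (z - 2 * \<epsilon>)))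
     - (\<Sum>p\<in>part_pairs M. pw (z + \<epsilon>) (fst p) * \<epsilon> ^ (snd p - 1) * (psum pw (M - {#fst p, snd p#}) (replicate (m - 1) (z + \<epsilon>)) + real (size M) * \<epsilon>)))
     \<longlongrightarrow> (\<Sum>\<alpha>\<in>set_mset M. (if 2 \<le> \<alpha> then pw (z - 2 * 0) (\<alpha> - 1) else 0) * psum pw (M - {#\<alpha>#}) (replicate (m - 1) (z - 2 * 0)))
     - (\<Sum>p\<in>part_pairs M. pw (z + 0) (fst p) * 0 ^ (snd p - 1) * (psum pw (M - {#fst p, snd p#}) (replicate (m - 1) (z + 0)) + real (size M) * 0))) (at_right 0)"
    by (intro tendsto_diff tendsto_sum tendsto_mult if_t tendsto_add tendsto_psum_pw_replicate tendsto_const tendsto_ident_at tendsto_power)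
       (auto simp: pw_def intro!: tendsto_eq_intros)
  then show ?thesis unfolding merge_rate_def by (simp add: case_prod_unfold)
qed


lemma part_le_sum_mset: "\<alpha> \<in># M \<Longrightarrow> sum_mset M = \<alpha> + sum_mset (M - {#\<alpha>#})"
  by (rule sum_mset.remove)

lemma merge_small_part_aux:
  fixes n x q :: nat and T D :: "nat list"
  assumes \<epsilon>: "0 < \<epsilon>" "2 * \<epsilon> < z" "0 < merge_rate \<epsilon>"
    and n: "0 < n" "real (sum_mset M) \<le> \<epsilon> * n"
    and T: "length T = m - 1" "\<forall>t\<in>set (x # T). \<bar>real t / n - z\<bar> < \<epsilon>"
    and q: "1 \<le> q" "real (q + sum_list D) \<le> \<epsilon> * n" "x + q + sum_list T + sum_list D = n"
  shows "psum cw M (x # q # D @ T) < psum cw M ((x + q) # D @ T)"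
proof -
  \<comment> \<open>One \<open>\<epsilon>\<close> covers the deviation of the parts from
    \<open>z * n\<close>. The other covers \<open>sum_mset M \<le> \<epsilon> * n\<close>, the price
    of bounding binomials below by powers.\<close>
  define v where "v = z - 2 * \<epsilon>"
  define u where "u = z + \<epsilon>"
  define c where "c = real n"
  define R where "R = D @ T"
  define L where "L = sum_mset M"
  have c: "0 < c" using n by (simp add: c_def)
  have uv: "0 \<le> v" "0 \<le> u" using \<epsilon> by (auto simp: v_def u_def)
  have lo: "c * v \<le> real t - L" and hi: "real t \<le> c * u" if "t \<in> set (x # T)" for t
  proof -
    have "c * (real t / n - z) < c * \<epsilon>" "c * (z - real t / n) < c * \<epsilon>"
      using bspec[OF T(2) that] c by (simp_all add: abs_less_iff)
    moreover have "c * (real t / n) = real t" using n by (simp add: c_def)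
    ultimately have "real t - c * z < c * \<epsilon>" "c * z - real t < c * \<epsilon>" by (auto simp: right_diff_distrib)
    then show "c * v \<le> real t - L" "real t \<le> c * u"
      using n(2) by (simp_all add: v_def u_def c_def L_def algebra_simps)
  qed
  define g where "g \<alpha> = (if 2 \<le> \<alpha> then pw v (\<alpha> - 1) else 0)" for \<alpha>
  define A where "A \<alpha> = psum pw (M - {#\<alpha>#}) (replicate (m - 1) v)" for \<alpha>
  define B where "B \<alpha> \<beta> = psum pw (M - {#\<alpha>, \<beta>#}) (replicate (m - 1) u) + real (size M) * \<epsilon>" for \<alpha> \<beta>
  have A0: "0 \<le> A \<alpha>" and B0: "0 \<le> B \<alpha> \<beta>" for \<alpha> \<beta>
    using uv \<epsilon> by (auto simp: A_def B_def psum_replicate_pw_nonneg)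
  have gain: "real q * (c ^ L * (g \<alpha> * A \<alpha>))
      \<le> c * ((cw (x + q) \<alpha> - cw x \<alpha> - cw q \<alpha>) * psum cw (M - {#\<alpha>#}) R)" if a: "\<alpha> \<in># M" for \<alpha>
  proof -
    have L: "L = \<alpha> + sum_mset (M - {#\<alpha>#})" unfolding L_def using a by (rule part_le_sum_mset)
    have "c ^ sum_mset (M - {#\<alpha>#}) * A \<alpha> \<le> psum cw (M - {#\<alpha>#}) T"
      unfolding A_def T(1)[symmetric] using lo c uv
      by (intro psum_cw_ge_replicate) (auto simp: L_def)
    also have "\<dots> \<le> psum cw (M - {#\<alpha>#}) R"
      unfolding R_def by (intro psum_append_ge cw_nonneg)
    finally have 1: "c ^ sum_mset (M - {#\<alpha>#}) * A \<alpha> \<le> psum cw (M - {#\<alpha>#}) R" .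
    have 2: "real q * (c ^ \<alpha> * g \<alpha>) \<le> c * (cw (x + q) \<alpha> - cw x \<alpha> - cw q \<alpha>)"
    proof (cases "2 \<le> \<alpha>")
      case True
      have "c ^ \<alpha> * g \<alpha> = c * pw (c * v) (\<alpha> - 1)"
        using True by (cases \<alpha>) (auto simp: g_def pw_scale)
      also have "\<dots> \<le> c * cw x (\<alpha> - 1)"
      proof (intro mult_left_mono pw_le_cw)
        have "real (\<alpha> - 1) \<le> real L" using L by (intro of_nat_mono) simp
        with lo[of x] show "c * v \<le> real x - real (\<alpha> - 1)" by simp
      qed (use c uv in auto)
      finally have "real q * (c ^ \<alpha> * g \<alpha>) \<le> real q * (c * cw x (\<alpha> - 1))" by (rule mult_left_mono) simp
      also have "\<dots> = c * (real q * cw x (\<alpha> - 1))" by simp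
      also have "\<dots> \<le> c * (cw (x + q) \<alpha> - cw x \<alpha> - cw q \<alpha>)"
        using binomial_add_ge[OF True, of x q] c by (intro mult_left_mono) auto
      finally show ?thesis .
    next
      case False
      with part_ge_1[OF a] have "\<alpha> = 1" by simp
      then show ?thesis by (simp add: g_def cw_def)
    qed
    have "real q * (c ^ L * (g \<alpha> * A \<alpha>)) = (real q * (c ^ \<alpha> * g \<alpha>)) * (c ^ sum_mset (M - {#\<alpha>#}) * A \<alpha>)"
      unfolding L power_add by (simp only: mult_ac)
    also have "\<dots> \<le> (c * (cw (x + q) \<alpha> - cw x \<alpha> - cw q \<alpha>)) * psum cw (M - {#\<alpha>#}) R"
    proof (rule mult_mono[OF 2 1])
      have "0 \<le> real q * (c ^ \<alpha> * g \<alpha>)" using c uv by (auto simp: g_def pw_nonneg)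
      with 2 show "0 \<le> c * (cw (x + q) \<alpha> - cw x \<alpha> - cw q \<alpha>)" by linarith
      show "0 \<le> c ^ sum_mset (M - {#\<alpha>#}) * A \<alpha>" using c A0 by simp
    qed
    finally show ?thesis by (simp only: mult.assoc)
  qed
  have loss: "c * (cw x \<alpha> * cw q \<beta> * psum cw (M - {#\<alpha>, \<beta>#}) R) \<le> real q * (c ^ L * (pw u \<alpha> * \<epsilon> ^ (\<beta> - 1) * B \<alpha> \<beta>))"
    if p: "(\<alpha>, \<beta>) \<in> part_pairs M" for \<alpha> \<beta>
  proof -
    have L: "L = \<alpha> + \<beta> + sum_mset (M - {#\<alpha>, \<beta>#})" unfolding L_def by (rule sum_mset_pair[OF p])
    have "\<beta> \<in># M" using part_pairsD[OF p] by simp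
    then have b1: "1 \<le> \<beta>" by (rule part_ge_1)
    have 1: "cw x \<alpha> \<le> c ^ \<alpha> * pw u \<alpha>"
      unfolding pw_scale[symmetric] using hi[of x] by (intro order_trans[OF cw_le_pw pw_mono]) auto
    have 2: "c * cw q \<beta> \<le> real q * (c ^ \<beta> * \<epsilon> ^ (\<beta> - 1))"
    proof -
      have "cw q \<beta> \<le> pw (real q) \<beta>" by (rule cw_le_pw)
      also have "\<dots> \<le> real q ^ \<beta>"
        by (simp add: pw_def pos_divide_le_eq mult_le_cancel_left1)
      also have "\<dots> = real q * real q ^ (\<beta> - 1)" using b1 by (cases \<beta>) auto
      also have "\<dots> \<le> real q * (\<epsilon> * c) ^ (\<beta> - 1)"
        using q by (intro mult_left_mono power_mono) (auto simp: c_def)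
      finally have "c * cw q \<beta> \<le> c * (real q * (\<epsilon> * c) ^ (\<beta> - 1))" using c by (intro mult_left_mono) auto
      also have "\<dots> = real q * (c ^ \<beta> * \<epsilon> ^ (\<beta> - 1))"
        using b1 by (cases \<beta>) (auto simp: power_mult_distrib)
      finally show ?thesis .
    qed
    have 3: "psum cw (M - {#\<alpha>, \<beta>#}) R \<le> c ^ sum_mset (M - {#\<alpha>, \<beta>#}) * B \<alpha> \<beta>"
    proof -
      have s: "real (sum_list T) + real (sum_list D) \<le> c" using q(3) by (simp add: c_def)
      have "psum cw (M - {#\<alpha>, \<beta>#}) R \<le> c ^ sum_mset (M - {#\<alpha>, \<beta>#})
         * (psum pw (M - {#\<alpha>, \<beta>#}) (replicate (length T) u) + size M * (real (sum_list D) / c))"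
        unfolding R_def using hi c uv s by (intro psum_cw_le_replicate) auto
      also have "\<dots> \<le> c ^ sum_mset (M - {#\<alpha>, \<beta>#}) * B \<alpha> \<beta>"
        unfolding B_def T(1)[symmetric] using q c
        by (intro mult_left_mono add_left_mono) (auto simp: c_def pos_divide_le_eq)
      finally show ?thesis .
    qed
    have "c * (cw x \<alpha> * cw q \<beta> * psum cw (M - {#\<alpha>, \<beta>#}) R) = cw x \<alpha> * (c * cw q \<beta>) * psum cw (M - {#\<alpha>, \<beta>#}) R"
      by (simp only: mult_ac)
    also have "\<dots> \<le> (c ^ \<alpha> * pw u \<alpha>) * (real q * (c ^ \<beta> * \<epsilon> ^ (\<beta> - 1))) * (c ^ sum_mset (M - {#\<alpha>, \<beta>#}) * B \<alpha> \<beta>)"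
      using c uv \<epsilon> by (intro mult_mono[OF mult_mono[OF 1 2] 3]) (auto simp: cw_nonneg pw_nonneg psum_nonneg_cw)
    also have "\<dots> = real q * (c ^ L * (pw u \<alpha> * \<epsilon> ^ (\<beta> - 1) * B \<alpha> \<beta>))"
      unfolding L power_add by (simp only: mult_ac)
    finally show ?thesis .
  qed
  define G where "G = (\<Sum>\<alpha>\<in>set_mset M. (cw (x + q) \<alpha> - cw x \<alpha> - cw q \<alpha>) * psum cw (M - {#\<alpha>#}) R)"
  define H where "H = (\<Sum>(\<alpha>, \<beta>)\<in>part_pairs M. cw x \<alpha> * cw q \<beta> * psum cw (M - {#\<alpha>, \<beta>#}) R)"
  have "real q * (c ^ L * merge_rate \<epsilon>)
      = (\<Sum>\<alpha>\<in>set_mset M. real q * (c ^ L * (g \<alpha> * A \<alpha>)))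
        - (\<Sum>(\<alpha>, \<beta>)\<in>part_pairs M. real q * (c ^ L * (pw u \<alpha> * \<epsilon> ^ (\<beta> - 1) * B \<alpha> \<beta>)))"
    unfolding merge_rate_def u_def[symmetric] v_def[symmetric] g_def A_def B_def
    by (simp only: right_diff_distrib sum_distrib_left case_prod_unfold)
  also have "\<dots> \<le> c * G - c * H"
    unfolding G_def H_def sum_distrib_left
  proof (intro diff_mono sum_mono gain)
    fix p assume "p \<in> part_pairs M"
    then show "c * (case p of (\<alpha>, \<beta>) \<Rightarrow> cw x \<alpha> * cw q \<beta> * psum cw (M - {#\<alpha>, \<beta>#}) R)
      \<le> (case p of (\<alpha>, \<beta>) \<Rightarrow> real q * (c ^ L * (pw u \<alpha> * \<epsilon> ^ (\<beta> - 1) * B \<alpha> \<beta>)))"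
      by (cases p) (simp only: prod.case loss)
  qed
  finally have "real q * (c ^ L * merge_rate \<epsilon>) \<le> c * (G - H)" by (simp only: right_diff_distrib)
  moreover have "0 < real q * (c ^ L * merge_rate \<epsilon>)" using q(1) c \<epsilon> by simp
  ultimately have "0 < c * (G - H)" by linarith
  then have "H < G" using c by (simp add: zero_less_mult_iff)
  moreover have "psum cw M ((x + q) # R) - psum cw M (x # q # R) = G - H"
    unfolding psum_two G_def H_def
    by (simp add: left_diff_distrib sum_subtractf distrib_right sum.distrib add_mset_commute)
  ultimately show ?thesis by (simp add: R_def del: psum.simps)
qed

lemma merge_small_part:
  obtains \<epsilon> :: real and N :: nat where "0 < \<epsilon>"
    "\<And>(n::nat) x q T D. \<lbrakk>N \<le> n; length T = m - 1; \<forall>t\<in>set (x # T). \<bar>real t / n - z\<bar> < \<epsilon>; 1 \<le> q;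
        real (q + sum_list D) \<le> \<epsilon> * n; x + q + sum_list T + sum_list D = n\<rbrakk>
      \<Longrightarrow> psum cw M (x # q # D @ T) < psum cw M ((x + q) # D @ T)"
proof -
  have "eventually (\<lambda>\<epsilon>. 0 < merge_rate \<epsilon>) (at_right 0)"
    using order_tendstoD(1)[OF merge_rate_tendsto merge_rate_0_pos] .
  then obtain \<epsilon>0 where \<epsilon>0: "0 < \<epsilon>0" "\<And>\<epsilon>. 0 < \<epsilon> \<Longrightarrow> \<epsilon> < \<epsilon>0 \<Longrightarrow> 0 < merge_rate \<epsilon>"
    unfolding eventually_at_right_field by auto
  define \<epsilon> where "\<epsilon> = min (\<epsilon>0 / 2) (z / 3)"
  have \<epsilon>: "0 < merge_rate \<epsilon>" "\<epsilon> < z / 2" "0 < \<epsilon>"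
    using \<epsilon>0 z_pos by (auto simp: \<epsilon>_def)
  define N where "N = Suc (nat \<lceil>real (sum_mset M) / \<epsilon>\<rceil>)"
  have "real (sum_mset M) \<le> \<epsilon> * n" "0 < n" if "N \<le> n" for n
  proof -
    have "real (sum_mset M) / \<epsilon> \<le> real n" using that unfolding N_def by linarith
    then show "real (sum_mset M) \<le> \<epsilon> * n" using \<epsilon> by (simp add: pos_divide_le_eq mult.commute)
    show "0 < n" using that by (simp add: N_def)
  qed
  note large = this
  show thesis
  proof (rule that[OF \<epsilon>(3)])
    fix n x q :: nat and T D
    assume "N \<le> n" and *: "length T = m - 1" "\<forall>t\<in>set (x # T). \<bar>real t / n - z\<bar> < \<epsilon>" "1 \<le> q"
        "real (q + sum_list D) \<le> \<epsilon> * n" "x + q + sum_list T + sum_list D = n"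
    have "2 * \<epsilon> < z" using \<epsilon> by simp
    from merge_small_part_aux[OF \<epsilon>(3) this \<epsilon>(1) large(2,1)[OF \<open>N \<le> n\<close>] *]
    show "psum cw M (x # q # D @ T) < psum cw M ((x + q) # D @ T)" .
  qed
qed


section \<open>Moving one vertex between two large parts\<close>

text \<open>\<open>move_gain\<close> expects the larger size first.\<close>

definition pair_gain :: "real \<Rightarrow> nat \<Rightarrow> nat \<Rightarrow> real" where
  "pair_gain \<epsilon> \<alpha> \<beta> = move_gain (z - 2 * \<epsilon>) (z + 2 * \<epsilon>) (max \<alpha> \<beta>) (min \<alpha> \<beta>)"

text \<open>A lower bound for twice the net gain in units of
  \<open>(X - Y) * n ^ (sum_mset M - 2)\<close>; the doubling is that of
  \<open>psum_two_symmetric\<close>. For a single size the loss is a second difference of binomials,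
  hence the derivative \<open>dpw\<close> at \<open>\<alpha> - 1\<close>.\<close>

definition move_rate :: "real \<Rightarrow> real" where
  "move_rate \<epsilon> =
     (\<Sum>(\<alpha>, \<beta>)\<in>part_pairs M. pair_gain \<epsilon> \<alpha> \<beta> * psum pw (M - {#\<alpha>, \<beta>#}) (replicate (m - 2) (z - 2 * \<epsilon>)))
     - (\<Sum>\<alpha>\<in>set_mset M. 2 * (dpw (z + 2 * \<epsilon>) (\<alpha> - 1) * psum pw (M - {#\<alpha>#}) (replicate (m - 2) (z + 2 * \<epsilon>))))"

lemma pair_gain_0_ge:
  assumes "\<alpha> \<in># M" "\<beta> \<in># M"
  shows "2 * (pw z \<alpha> * pw z \<beta>) \<le> z\<^sup>2 * pair_gain 0 \<alpha> \<beta>"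
proof -
  have "2 * (pw z (max \<alpha> \<beta>) * pw z (min \<alpha> \<beta>)) \<le> z\<^sup>2 * move_gain z z (max \<alpha> \<beta>) (min \<alpha> \<beta>)"
  proof (rule move_gain_diagonal_ge[OF z_pos])
    show "1 \<le> min \<alpha> \<beta>" using assms part_ge_1 by simp
    show "(max \<alpha> \<beta> - min \<alpha> \<beta>) choose 2 < min \<alpha> \<beta>"
      using part_close[OF assms] part_close[OF assms(2,1)] by (simp add: max_def min_def)
  qed simp
  then show ?thesis by (simp add: pair_gain_def max_def min_def mult.commute split: if_splits)
qed

lemma pair_gain_0_pos:
  assumes "\<alpha> \<in># M" "\<beta> \<in># M"
  shows "0 < pair_gain 0 \<alpha> \<beta>"
proof -
  have "0 < 2 * (pw z \<alpha> * pw z \<beta>)" using z_pos by (simp add: pw_def)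
  also have "\<dots> \<le> z\<^sup>2 * pair_gain 0 \<alpha> \<beta>" by (rule pair_gain_0_ge[OF assms])
  finally show ?thesis using z_pos by (simp add: zero_less_mult_iff)
qed

text \<open>Merging two parts of the equal vector strictly lowers its weight. The loss rate is
  compared with the change in single sizes by \<open>pred_mult_le_two_power\<close>, the gain rate
  with the lost pairs by \<open>pair_gain_0_ge\<close>; both comparisons have the constant 2 over
  \<open>z\<^sup>2\<close>.\<close>

lemma move_rate_0_pos: "0 < move_rate 0"
proof -
  define R where "R = replicate (m - 2) z"
  define C1 where "C1 \<alpha> = psum pw (M - {#\<alpha>#}) R" for \<alpha>
  define C2 where "C2 \<alpha> \<beta> = psum pw (M - {#\<alpha>, \<beta>#}) R" for \<alpha> \<beta>
  have C: "0 \<le> C1 \<alpha>" "0 \<le> C2 \<alpha> \<beta>" for \<alpha> \<beta>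
    using z_pos by (auto simp: C1_def C2_def R_def psum_replicate_pw_nonneg)
  have eq: "weight (z # z # R) = equal_weight m" unfolding R_def by (rule equal_weight_split[symmetric])
  have "2 * z = 2 / real m" by (simp add: z_def)
  then have less: "weight (2 * z # R) < equal_weight m"
    using weight_merged_less by (simp only: R_def z_def)
  define S1 where "S1 = (\<Sum>\<alpha>\<in>set_mset M. (pw (2 * z) \<alpha> - 2 * pw z \<alpha>) * C1 \<alpha>)"
  define S2 where "S2 = (\<Sum>(\<alpha>, \<beta>)\<in>part_pairs M. pw z \<alpha> * pw z \<beta> * C2 \<alpha> \<beta>)"
  define G1 where "G1 = (\<Sum>\<alpha>\<in>set_mset M. 2 * (dpw z (\<alpha> - 1) * C1 \<alpha>))"
  define G2 where "G2 = (\<Sum>(\<alpha>, \<beta>)\<in>part_pairs M. pair_gain 0 \<alpha> \<beta> * C2 \<alpha> \<beta>)"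
  have "weight (2 * z # R) = weight R + (\<Sum>\<alpha>\<in>set_mset M. pw (2 * z) \<alpha> * C1 \<alpha>)"
    by (simp add: C1_def)
  moreover have "weight (z # z # R) = weight R + (\<Sum>\<alpha>\<in>set_mset M. (pw z \<alpha> + pw z \<alpha>) * C1 \<alpha>) + S2"
    unfolding psum_two S2_def C1_def C2_def by (simp add: add_mset_commute)
  moreover have "S1 = (\<Sum>\<alpha>\<in>set_mset M. pw (2 * z) \<alpha> * C1 \<alpha>) - (\<Sum>\<alpha>\<in>set_mset M. (pw z \<alpha> + pw z \<alpha>) * C1 \<alpha>)"
    unfolding S1_def sum_subtractf[symmetric] by (rule sum.cong) (auto simp: algebra_simps)
  ultimately have "weight (2 * z # R) - weight (z # z # R) = S1 - S2" by linarith
  with eq less have "S1 < S2" by simp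
  have "z\<^sup>2 * G1 \<le> 2 * S1"
    unfolding S1_def G1_def sum_distrib_left
  proof (rule sum_mono)
    fix \<alpha> assume "\<alpha> \<in># M"
    then have a: "1 \<le> \<alpha>" by (rule part_ge_1)
    have "z\<^sup>2 * dpw z (\<alpha> - 1) = z * (z * dpw z (\<alpha> - 1))" by (simp add: power2_eq_square)
    also have "\<dots> = real (\<alpha> - 1) * (z * pw z (\<alpha> - 1))" by (simp only: dpw_mult mult.left_commute)
    also have "\<dots> = real (\<alpha> * (\<alpha> - 1)) * pw z \<alpha>" by (simp only: pw_pred[OF a] of_nat_mult mult_ac)
    also have "\<dots> \<le> (2 ^ \<alpha> - 2) * pw z \<alpha>"
    proof (rule mult_right_mono)
      have "real (\<alpha> * (\<alpha> - 1) + 2) \<le> real (2 ^ \<alpha>)" using pred_mult_le_two_power[OF a] by (rule of_nat_mono)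
      then show "real (\<alpha> * (\<alpha> - 1)) \<le> 2 ^ \<alpha> - 2" by simp
    qed (use z_pos in \<open>simp add: pw_nonneg\<close>)
    also have "\<dots> = pw (2 * z) \<alpha> - 2 * pw z \<alpha>" by (simp add: pw_scale left_diff_distrib)
    finally have "(z\<^sup>2 * dpw z (\<alpha> - 1)) * C1 \<alpha> \<le> (pw (2 * z) \<alpha> - 2 * pw z \<alpha>) * C1 \<alpha>"
      using C(1) by (rule mult_right_mono)
    then show "z\<^sup>2 * (2 * (dpw z (\<alpha> - 1) * C1 \<alpha>)) \<le> 2 * ((pw (2 * z) \<alpha> - 2 * pw z \<alpha>) * C1 \<alpha>)"
      by (simp add: mult.assoc)
  qed
  moreover have "2 * S2 \<le> z\<^sup>2 * G2"
    unfolding S2_def G2_def sum_distrib_left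
  proof (rule sum_mono)
    fix p assume "p \<in> part_pairs M"
    then obtain \<alpha> \<beta> where p: "p = (\<alpha>, \<beta>)" "\<alpha> \<in># M" "\<beta> \<in># M" by (cases p) (auto dest: part_pairsD)
    from mult_right_mono[OF pair_gain_0_ge[OF p(2,3)] C(2)[of \<alpha> \<beta>]]
    show "2 * (case p of (\<alpha>, \<beta>) \<Rightarrow> pw z \<alpha> * pw z \<beta> * C2 \<alpha> \<beta>) \<le> z\<^sup>2 * (case p of (\<alpha>, \<beta>) \<Rightarrow> pair_gain 0 \<alpha> \<beta> * C2 \<alpha> \<beta>)"
      unfolding p(1) prod.case by (simp only: mult.assoc)
  qed
  ultimately have "z\<^sup>2 * G1 < z\<^sup>2 * G2" using \<open>S1 < S2\<close> by linarith
  then have "G1 < G2" using z_pos by simp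
  moreover have "move_rate 0 = G2 - G1"
    by (simp add: move_rate_def G1_def G2_def C1_def C2_def R_def)
  ultimately show ?thesis by simp
qed

lemma pw_tendsto: "(f \<longlongrightarrow> x) F \<Longrightarrow> ((\<lambda>t. pw (f t) j) \<longlongrightarrow> pw x j) F"
  unfolding pw_def by (intro tendsto_intros) auto

lemma dpw_tendsto: "(f \<longlongrightarrow> x) F \<Longrightarrow> ((\<lambda>t. dpw (f t) j) \<longlongrightarrow> dpw x j) F"
  unfolding dpw_def by (cases "j = 0") (auto intro: pw_tendsto)

lemma shrink_tendsto:
  "((\<lambda>\<epsilon>. z - 2 * \<epsilon>) \<longlongrightarrow> z - 2 * 0) (at_right 0)" "((\<lambda>\<epsilon>. z + 2 * \<epsilon>) \<longlongrightarrow> z + 2 * 0) (at_right 0)"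
  by (intro tendsto_intros)+

lemma pair_gain_tendsto: "((\<lambda>\<epsilon>. pair_gain \<epsilon> \<alpha> \<beta>) \<longlongrightarrow> pair_gain 0 \<alpha> \<beta>) (at_right 0)"
  unfolding pair_gain_def move_gain_def
  by (intro tendsto_diff tendsto_mult tendsto_const pw_tendsto dpw_tendsto shrink_tendsto)

lemma move_rate_tendsto: "(move_rate \<longlongrightarrow> move_rate 0) (at_right 0)"
  unfolding move_rate_def case_prod_unfold
  by (intro tendsto_diff tendsto_sum tendsto_mult tendsto_const dpw_tendsto pair_gain_tendsto
      tendsto_psum_pw_replicate shrink_tendsto)

text \<open>Positivity of each \<open>pair_gain\<close> is required separately, because its lower
  bound is multiplied by a lower bound for the weight of the remaining parts.\<close>

lemma balance_parts_aux:
  fixes n X Y :: nat and T :: "nat list"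
  assumes \<epsilon>: "0 < \<epsilon>" "2 * \<epsilon> < z" "0 < move_rate \<epsilon>"
    and pg: "\<And>\<alpha> \<beta>. (\<alpha>, \<beta>) \<in> part_pairs M \<Longrightarrow> 0 < pair_gain \<epsilon> \<alpha> \<beta>"
    and n: "0 < n" "real (Suc (sum_mset M)) \<le> \<epsilon> * n"
    and T: "length T = m - 2" "\<forall>t\<in>set (Suc X # Y # T). \<bar>real t / n - z\<bar> < \<epsilon>"
    and XY: "Y < X" "sum_list T \<le> n"
  shows "psum cw M (Suc X # Y # T) < psum cw M (X # Suc Y # T)"
proof -
  \<comment> \<open>As for merging, one \<open>\<epsilon>\<close> is for the deviation of the parts,
    and the other one, times \<open>n\<close>, exceeds \<open>sum_mset M\<close> and the one vertex
    that moves.\<close>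
  define v where "v = z - 2 * \<epsilon>"
  define u where "u = z + 2 * \<epsilon>"
  define c where "c = real n"
  define L where "L = sum_mset M"
  define k where "k = real (X - Y)"
  have c: "0 < c" using n by (simp add: c_def)
  have k: "0 < k" using XY by (simp add: k_def)
  have uv: "0 \<le> v" "0 \<le> u" using \<epsilon> by (auto simp: v_def u_def)
  have lo: "c * v \<le> real t - L" and hi: "real t + 1 \<le> c * u" if "t \<in> set (Suc X # Y # T)" for t
  proof -
    have "c * (real t / n - z) < c * \<epsilon>" "c * (z - real t / n) < c * \<epsilon>"
      using bspec[OF T(2) that] c by (simp_all add: abs_less_iff)
    moreover have "c * (real t / n) = real t" using n by (simp add: c_def)
    ultimately have "real t - c * z < c * \<epsilon>" "c * z - real t < c * \<epsilon>" by (auto simp: right_diff_distrib)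
    moreover have "real L + 1 \<le> c * \<epsilon>" using n(2) unfolding c_def L_def by (simp only: of_nat_Suc mult.commute add.commute)
    ultimately show "c * v \<le> real t - L" "real t + 1 \<le> c * u"
      by (simp_all add: v_def u_def algebra_simps)
  qed
  have XYb: "real X \<le> c * u" "real Y + 1 \<le> c * u" "c * v \<le> real Y - L"
    using hi[of "Suc X"] hi[of Y] lo[of Y] by auto
  define A where "A \<alpha> = psum pw (M - {#\<alpha>#}) (replicate (m - 2) u)" for \<alpha>
  define B where "B \<alpha> \<beta> = psum pw (M - {#\<alpha>, \<beta>#}) (replicate (m - 2) v)" for \<alpha> \<beta>
  have A0: "0 \<le> A \<alpha>" and B0: "0 \<le> B \<alpha> \<beta>" for \<alpha> \<beta>
    using uv by (auto simp: A_def B_def psum_replicate_pw_nonneg)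
  have loss: "c\<^sup>2 * ((cw (Suc X) \<alpha> + cw Y \<alpha> - cw X \<alpha> - cw (Suc Y) \<alpha>) * psum cw (M - {#\<alpha>#}) T)
      \<le> k * (c ^ L * (dpw u (\<alpha> - 1) * A \<alpha>))" if a: "\<alpha> \<in># M" for \<alpha>
  proof -
    have a1: "1 \<le> \<alpha>" using a by (rule part_ge_1)
    have L: "L = \<alpha> + sum_mset (M - {#\<alpha>#})" unfolding L_def using a by (rule part_le_sum_mset)
    have "psum cw (M - {#\<alpha>#}) ([] @ T) \<le> c ^ sum_mset (M - {#\<alpha>#})
         * (psum pw (M - {#\<alpha>#}) (replicate (length T) u) + size M * (real (sum_list []) / c))"
      using hi c uv XY by (intro psum_cw_le_replicate) (force simp: c_def)+
    then have 1: "psum cw (M - {#\<alpha>#}) T \<le> c ^ sum_mset (M - {#\<alpha>#}) * A \<alpha>"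
      by (simp add: A_def T(1))
    have "c * (c * (cw X (\<alpha> - 1) - cw Y (\<alpha> - 1))) \<le> c * (k * (c ^ (\<alpha> - 1) * dpw u (\<alpha> - 1)))"
      unfolding k_def using XY XYb c uv by (intro mult_left_mono cw_diff_le_dpw) auto
    also have "\<dots> = k * (c ^ \<alpha> * dpw u (\<alpha> - 1))" using a1 by (cases \<alpha>) auto
    also have "c * (c * (cw X (\<alpha> - 1) - cw Y (\<alpha> - 1))) = c\<^sup>2 * (cw (Suc X) \<alpha> + cw Y \<alpha> - cw X \<alpha> - cw (Suc Y) \<alpha>)"
      using a1 by (simp add: cw_Suc_diff power2_eq_square)
    finally have 2: "c\<^sup>2 * (cw (Suc X) \<alpha> + cw Y \<alpha> - cw X \<alpha> - cw (Suc Y) \<alpha>) \<le> k * (c ^ \<alpha> * dpw u (\<alpha> - 1))" .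
    have "c\<^sup>2 * ((cw (Suc X) \<alpha> + cw Y \<alpha> - cw X \<alpha> - cw (Suc Y) \<alpha>) * psum cw (M - {#\<alpha>#}) T)
        = (c\<^sup>2 * (cw (Suc X) \<alpha> + cw Y \<alpha> - cw X \<alpha> - cw (Suc Y) \<alpha>)) * psum cw (M - {#\<alpha>#}) T"
      by (simp only: mult.assoc)
    also have "\<dots> \<le> (k * (c ^ \<alpha> * dpw u (\<alpha> - 1))) * (c ^ sum_mset (M - {#\<alpha>#}) * A \<alpha>)"
      using c k uv by (intro mult_mono[OF 2 1]) (auto simp: dpw_nonneg psum_nonneg_cw)
    also have "\<dots> = k * (c ^ L * (dpw u (\<alpha> - 1) * A \<alpha>))"
      unfolding L power_add by (simp only: mult_ac)
    finally show ?thesis .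
  qed
  have gain: "k * (c ^ L * (pair_gain \<epsilon> \<alpha> \<beta> * B \<alpha> \<beta>))
      \<le> c\<^sup>2 * ((cw X \<alpha> * cw (Suc Y) \<beta> + cw X \<beta> * cw (Suc Y) \<alpha> - (cw (Suc X) \<alpha> * cw Y \<beta> + cw (Suc X) \<beta> * cw Y \<alpha>))
          * psum cw (M - {#\<alpha>, \<beta>#}) T)"
    if p: "(\<alpha>, \<beta>) \<in> part_pairs M" for \<alpha> \<beta>
  proof -
    define a where "a = max \<alpha> \<beta>"
    define b where "b = min \<alpha> \<beta>"
    have L: "L = \<alpha> + \<beta> + sum_mset (M - {#\<alpha>, \<beta>#})" unfolding L_def by (rule sum_mset_pair[OF p])
    have ab: "a + b = \<alpha> + \<beta>" "b \<le> a" by (auto simp: a_def b_def)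
    have b1: "1 \<le> b" using part_pairsD[OF p] part_ge_1 by (simp add: b_def)
    have aL: "real a \<le> real L" using L ab by (intro of_nat_mono) simp
    have "k * (c ^ (a + b) * move_gain v u a b)
       \<le> c\<^sup>2 * (cw X a * cw (Suc Y) b + cw X b * cw (Suc Y) a - cw (Suc X) a * cw Y b - cw (Suc X) b * cw Y a)"
      unfolding k_def using XY XYb c uv ab b1 aL by (intro move_gain_le) auto
    also have "cw X a * cw (Suc Y) b + cw X b * cw (Suc Y) a - cw (Suc X) a * cw Y b - cw (Suc X) b * cw Y a
        = cw X \<alpha> * cw (Suc Y) \<beta> + cw X \<beta> * cw (Suc Y) \<alpha> - (cw (Suc X) \<alpha> * cw Y \<beta> + cw (Suc X) \<beta> * cw Y \<alpha>)"
      by (cases "\<alpha> \<le> \<beta>") (simp_all add: a_def b_def)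
    finally have 1: "k * (c ^ (\<alpha> + \<beta>) * pair_gain \<epsilon> \<alpha> \<beta>)
      \<le> c\<^sup>2 * (cw X \<alpha> * cw (Suc Y) \<beta> + cw X \<beta> * cw (Suc Y) \<alpha> - (cw (Suc X) \<alpha> * cw Y \<beta> + cw (Suc X) \<beta> * cw Y \<alpha>))"
      by (simp only: ab pair_gain_def a_def[symmetric] b_def[symmetric] u_def v_def)
    have "M - {#\<alpha>, \<beta>#} \<subseteq># M" by simp
    then have 2: "c ^ sum_mset (M - {#\<alpha>, \<beta>#}) * B \<alpha> \<beta> \<le> psum cw (M - {#\<alpha>, \<beta>#}) T"
      unfolding B_def T(1)[symmetric] using lo c uv
      by (intro psum_cw_ge_replicate) (auto simp: L_def)
    have pos: "0 \<le> k * (c ^ (\<alpha> + \<beta>) * pair_gain \<epsilon> \<alpha> \<beta>)" using k c pg[OF p] by simp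
    have "k * (c ^ L * (pair_gain \<epsilon> \<alpha> \<beta> * B \<alpha> \<beta>))
        = (k * (c ^ (\<alpha> + \<beta>) * pair_gain \<epsilon> \<alpha> \<beta>)) * (c ^ sum_mset (M - {#\<alpha>, \<beta>#}) * B \<alpha> \<beta>)"
      unfolding L power_add by (simp only: mult_ac)
    also have "\<dots> \<le> (c\<^sup>2 * (cw X \<alpha> * cw (Suc Y) \<beta> + cw X \<beta> * cw (Suc Y) \<alpha> - (cw (Suc X) \<alpha> * cw Y \<beta> + cw (Suc X) \<beta> * cw Y \<alpha>)))
        * psum cw (M - {#\<alpha>, \<beta>#}) T"
      by (rule mult_mono[OF 1 2 order_trans[OF pos 1]]) (use c B0 in simp)
    finally show ?thesis by (simp only: mult.assoc)
  qed
  define G where "G = (\<Sum>(\<alpha>, \<beta>)\<in>part_pairs M. (cw X \<alpha> * cw (Suc Y) \<beta> + cw X \<beta> * cw (Suc Y) \<alpha>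
      - (cw (Suc X) \<alpha> * cw Y \<beta> + cw (Suc X) \<beta> * cw Y \<alpha>)) * psum cw (M - {#\<alpha>, \<beta>#}) T)"
  define H where "H = (\<Sum>\<alpha>\<in>set_mset M. 2 * ((cw (Suc X) \<alpha> + cw Y \<alpha> - cw X \<alpha> - cw (Suc Y) \<alpha>) * psum cw (M - {#\<alpha>#}) T))"
  have "k * (c ^ L * move_rate \<epsilon>)
      = (\<Sum>(\<alpha>, \<beta>)\<in>part_pairs M. k * (c ^ L * (pair_gain \<epsilon> \<alpha> \<beta> * B \<alpha> \<beta>)))
        - (\<Sum>\<alpha>\<in>set_mset M. 2 * (k * (c ^ L * (dpw u (\<alpha> - 1) * A \<alpha>))))"
    unfolding move_rate_def u_def[symmetric] v_def[symmetric] A_def B_def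
    by (simp only: right_diff_distrib sum_distrib_left case_prod_unfold mult.left_commute[of _ 2])
  also have "\<dots> \<le> c\<^sup>2 * G - c\<^sup>2 * H"
    unfolding G_def H_def sum_distrib_left
  proof (intro diff_mono sum_mono)
    fix p assume "p \<in> part_pairs M"
    then show "(case p of (\<alpha>, \<beta>) \<Rightarrow> k * (c ^ L * (pair_gain \<epsilon> \<alpha> \<beta> * B \<alpha> \<beta>)))
      \<le> c\<^sup>2 * (case p of (\<alpha>, \<beta>) \<Rightarrow> (cw X \<alpha> * cw (Suc Y) \<beta> + cw X \<beta> * cw (Suc Y) \<alpha>
      - (cw (Suc X) \<alpha> * cw Y \<beta> + cw (Suc X) \<beta> * cw Y \<alpha>)) * psum cw (M - {#\<alpha>, \<beta>#}) T)"
      by (cases p) (simp only: prod.case gain)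
  next
    fix \<alpha> assume "\<alpha> \<in># M"
    from mult_left_mono[OF loss[OF this], of 2]
    show "c\<^sup>2 * (2 * ((cw (Suc X) \<alpha> + cw Y \<alpha> - cw X \<alpha> - cw (Suc Y) \<alpha>) * psum cw (M - {#\<alpha>#}) T))
        \<le> 2 * (k * (c ^ L * (dpw u (\<alpha> - 1) * A \<alpha>)))"
      by (simp only: mult.left_commute[of _ 2])
  qed
  finally have "k * (c ^ L * move_rate \<epsilon>) \<le> c\<^sup>2 * (G - H)" by (simp only: right_diff_distrib)
  moreover have "0 < k * (c ^ L * move_rate \<epsilon>)" using k c \<epsilon> by simp
  ultimately have "0 < c\<^sup>2 * (G - H)" by linarith
  then have "H < G" using c by (simp add: zero_less_mult_iff)
  moreover have "2 * psum cw M (X # Suc Y # T) - 2 * psum cw M (Suc X # Y # T) = G - H"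
  proof -
    define c1 where "c1 \<alpha> = psum cw (M - {#\<alpha>#}) T" for \<alpha>
    define c2 where "c2 \<alpha> \<beta> = psum cw (M - {#\<alpha>, \<beta>#}) T" for \<alpha> \<beta>
    have "G = (\<Sum>(\<alpha>, \<beta>)\<in>part_pairs M. (cw X \<alpha> * cw (Suc Y) \<beta> + cw X \<beta> * cw (Suc Y) \<alpha>) * c2 \<alpha> \<beta>)
       - (\<Sum>(\<alpha>, \<beta>)\<in>part_pairs M. (cw (Suc X) \<alpha> * cw Y \<beta> + cw (Suc X) \<beta> * cw Y \<alpha>) * c2 \<alpha> \<beta>)"
      unfolding G_def c2_def[symmetric] case_prod_unfold sum_subtractf[symmetric] left_diff_distrib by (rule refl)
    moreover have "H = (\<Sum>\<alpha>\<in>set_mset M. 2 * ((cw (Suc X) \<alpha> + cw Y \<alpha>) * c1 \<alpha>)) - (\<Sum>\<alpha>\<in>set_mset M. 2 * ((cw X \<alpha> + cw (Suc Y) \<alpha>) * c1 \<alpha>))"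
      unfolding H_def c1_def[symmetric] sum_subtractf[symmetric] by (rule sum.cong) (auto simp: algebra_simps)
    ultimately show ?thesis
      unfolding psum_two_symmetric c1_def[symmetric] c2_def[symmetric] by linarith
  qed
  ultimately show ?thesis by linarith
qed

lemma balance_parts:
  obtains \<epsilon> :: real and N :: nat where "0 < \<epsilon>"
    "\<And>(n::nat) X Y T. \<lbrakk>N \<le> n; length T = m - 2; \<forall>t\<in>set (Suc X # Y # T). \<bar>real t / n - z\<bar> < \<epsilon>; Y < X;
        sum_list T \<le> n\<rbrakk> \<Longrightarrow> psum cw M (Suc X # Y # T) < psum cw M (X # Suc Y # T)"
proof -
  have "eventually (\<lambda>\<epsilon>. 0 < move_rate \<epsilon>) (at_right 0)"
    using order_tendstoD(1)[OF move_rate_tendsto move_rate_0_pos] .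
  moreover have "eventually (\<lambda>\<epsilon>. \<forall>p\<in>part_pairs M. 0 < pair_gain \<epsilon> (fst p) (snd p)) (at_right 0)"
  proof (intro eventually_ball_finite ballI)
    fix p assume "p \<in> part_pairs M"
    then have "0 < pair_gain 0 (fst p) (snd p)" by (cases p) (auto dest: part_pairsD intro: pair_gain_0_pos)
    then show "eventually (\<lambda>\<epsilon>. 0 < pair_gain \<epsilon> (fst p) (snd p)) (at_right 0)"
      by (rule order_tendstoD(1)[OF pair_gain_tendsto])
  qed simp
  ultimately have "eventually (\<lambda>\<epsilon>. 0 < move_rate \<epsilon> \<and> (\<forall>p\<in>part_pairs M. 0 < pair_gain \<epsilon> (fst p) (snd p))) (at_right 0)"
    by (rule eventually_conj)
  then obtain \<epsilon>0 where \<epsilon>0: "0 < \<epsilon>0" "\<And>\<epsilon>. 0 < \<epsilon> \<Longrightarrow> \<epsilon> < \<epsilon>0 \<Longrightarrow> 0 < move_rate \<epsilon> \<and> (\<forall>p\<in>part_pairs M. 0 < pair_gain \<epsilon> (fst p) (snd p))"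
    unfolding eventually_at_right_field by auto
  define \<epsilon> where "\<epsilon> = min (\<epsilon>0 / 2) (z / 3)"
  have \<epsilon>: "2 * \<epsilon> < z" "0 < \<epsilon>" "\<epsilon> < \<epsilon>0"
    using \<epsilon>0 z_pos by (auto simp: \<epsilon>_def)
  have rate: "0 < move_rate \<epsilon>" and pg: "\<And>\<alpha> \<beta>. (\<alpha>, \<beta>) \<in> part_pairs M \<Longrightarrow> 0 < pair_gain \<epsilon> \<alpha> \<beta>"
    using \<epsilon>0(2)[OF \<epsilon>(2,3)] by auto
  define N where "N = Suc (nat \<lceil>real (Suc (sum_mset M)) / \<epsilon>\<rceil>)"
  have large: "real (Suc (sum_mset M)) \<le> \<epsilon> * n" "0 < n" if "N \<le> n" for n
  proof -
    have "real (Suc (sum_mset M)) / \<epsilon> \<le> real n" using that unfolding N_def by linarith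
    then show "real (Suc (sum_mset M)) \<le> \<epsilon> * n" using \<epsilon> by (simp only: pos_divide_le_eq mult.commute)
    show "0 < n" using that by (simp add: N_def)
  qed
  show thesis
  proof (rule that[OF \<epsilon>(2)])
    fix n X Y :: nat and T
    assume "N \<le> n" and *: "length T = m - 2" "\<forall>t\<in>set (Suc X # Y # T). \<bar>real t / n - z\<bar> < \<epsilon>" "Y < X" "sum_list T \<le> n"
    from balance_parts_aux[OF \<epsilon>(2,1) rate pg large(2,1)[OF \<open>N \<le> n\<close>] *]
    show "psum cw M (Suc X # Y # T) < psum cw M (X # Suc Y # T)" .
  qed
qed

end

section \<open>Optimal part sizes\<close>

definition balanced_list :: "nat list \<Rightarrow> bool" where
  "balanced_list xs \<longleftrightarrow> (\<forall>x\<in>set xs. \<forall>y\<in>set xs. x \<le> y + 1)"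

lemma balanced_list_ge:
  assumes "balanced_list xs" "y \<in> set xs"
  shows "real (sum_list xs) / real (length xs) - 1 \<le> real y"
proof -
  have "sum_list xs \<le> (\<Sum>x\<leftarrow>xs. y + 1)"
    using sum_list_mono[of xs "\<lambda>x. x" "\<lambda>x. y + 1"] assms by (simp add: balanced_list_def)
  also have "\<dots> = length xs * (y + 1)" by (simp only: sum_list_triv of_nat_id)
  finally have "real (sum_list xs) \<le> real (length xs * (y + 1))" by (rule of_nat_mono)
  moreover have "0 < length xs" using assms by (cases xs) auto
  ultimately show ?thesis by (simp add: pos_divide_le_eq diff_le_eq algebra_simps)
qed

context balanced_parts_max
begin

lemma psum_cw_le_equal_weight:
  assumes "sum_list xs = n" "0 < n"
  shows "psum cw M xs \<le> real n ^ sum_mset M * weight (map (\<lambda>x. real x / n) xs)"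
    and "map (\<lambda>x. real x / n) xs \<in> unit_vectors"
proof -
  have "map real xs = map ((*) (real n)) (map (\<lambda>x. real x / n) xs)" using assms by simp
  moreover have "psum pw M (map ((*) (real n)) (map (\<lambda>x. real x / n) xs)) = real n ^ sum_mset M * weight (map (\<lambda>x. real x / n) xs)"
    by (rule psum_scale) (rule pw_scale)
  ultimately show "psum cw M xs \<le> real n ^ sum_mset M * weight (map (\<lambda>x. real x / n) xs)"
    using psum_cw_le_pw[of M xs] by (simp del: map_map)
  have "sum_list (map (\<lambda>x. real x / n) xs) = real (sum_list xs) / n"
    by (induction xs) (auto simp: add_divide_distrib)
  then show "map (\<lambda>x. real x / n) xs \<in> unit_vectors" using assms by (auto simp: unit_vectors_def)
qed

lemma balanced_list_psum_ge:
  assumes "0 < \<theta>"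
  obtains N where "\<And>n xs. \<lbrakk>N \<le> n; balanced_list xs; length xs = m; sum_list xs = n\<rbrakk>
      \<Longrightarrow> real n ^ sum_mset M * (equal_weight m - \<theta>) \<le> psum cw M xs"
proof -
  have "((\<lambda>\<epsilon>. weight (replicate m (z - \<epsilon>))) \<longlongrightarrow> weight (replicate m (z - 0))) (at_right 0)"
    by (intro tendsto_psum_pw_replicate tendsto_intros)
  then have "eventually (\<lambda>\<epsilon>. equal_weight m - \<theta> < weight (replicate m (z - \<epsilon>))) (at_right 0)"
    by (rule order_tendstoD) (use assms in \<open>simp add: equal_weight_def z_def\<close>)
  then obtain \<epsilon>0 where \<epsilon>0: "0 < \<epsilon>0" "\<And>\<epsilon>. 0 < \<epsilon> \<Longrightarrow> \<epsilon> < \<epsilon>0 \<Longrightarrow> equal_weight m - \<theta> < weight (replicate m (z - \<epsilon>))"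
    unfolding eventually_at_right_field by auto
  define \<epsilon> where "\<epsilon> = min (\<epsilon>0 / 2) (z / 2)"
  have \<epsilon>: "0 < \<epsilon>" "\<epsilon> < \<epsilon>0" "\<epsilon> < z" using \<epsilon>0 z_pos by (auto simp: \<epsilon>_def)
  define N where "N = nat \<lceil>(real (sum_mset M) + 1) / \<epsilon>\<rceil>"
  show thesis
  proof (rule that)
    fix n :: nat and xs
    assume n: "N \<le> n" and xs: "balanced_list xs" "length xs = m" "sum_list xs = n"
    have "(real (sum_mset M) + 1) / \<epsilon> \<le> real n" using n unfolding N_def by linarith
    then have big: "real (sum_mset M) + 1 \<le> real n * \<epsilon>" using \<epsilon>(1) by (simp only: pos_divide_le_eq)
    have "real n ^ sum_mset M * weight (replicate (length xs) (z - \<epsilon>)) \<le> psum cw M xs"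
    proof (rule psum_cw_ge_replicate)
      show "\<forall>t\<in>set xs. real n * (z - \<epsilon>) \<le> real t - real (sum_mset M)"
      proof
        fix t assume "t \<in> set xs"
        from balanced_list_ge[OF xs(1) this] have "real n * z - 1 \<le> real t"
          by (simp add: xs z_def)
        with big show "real n * (z - \<epsilon>) \<le> real t - real (sum_mset M)"
          unfolding right_diff_distrib by linarith
      qed
    qed (use \<epsilon> in auto)
    moreover have "real n ^ sum_mset M * (equal_weight m - \<theta>) \<le> real n ^ sum_mset M * weight (replicate (length xs) (z - \<epsilon>))"
      using \<epsilon>0(2)[OF \<epsilon>(1,2)] by (intro mult_left_mono) (auto simp: xs)
    ultimately show "real n ^ sum_mset M * (equal_weight m - \<theta>) \<le> psum cw M xs" by linarith
  qed
qed

lemma ex_balanced_list: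
  assumes "m \<le> n"
  obtains xs where "balanced_list xs" "length xs = m" "sum_list xs = n" "\<forall>x\<in>set xs. 1 \<le> x"
proof
  define q where "q = n div m"
  define r where "r = n mod m"
  let ?xs = "replicate r (q + 1) @ replicate (m - r) q"
  have r: "r < m" using two_le_m by (simp add: r_def)
  have q: "1 \<le> q" unfolding q_def using assms two_le_m by (metis One_nat_def Suc_leI div_greater_zero_iff less_le_trans pos2)
  show "balanced_list ?xs" by (auto simp: balanced_list_def)
  show "length ?xs = m" using r by simp
  have "sum_list ?xs = m * q + r"
    using r by (simp add: sum_list_replicate algebra_simps)
  then show "sum_list ?xs = n" by (simp add: q_def r_def)
  show "\<forall>x\<in>set ?xs. 1 \<le> x" using q by auto
qed

lemma near_optimal_parts:
  assumes "0 < \<epsilon>"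
  obtains N :: nat and \<theta> :: real where "0 < \<theta>" "\<And>n xs. \<lbrakk>N \<le> n; sum_list xs = n; real n ^ sum_mset M * (equal_weight m - \<theta>) \<le> psum cw M xs\<rbrakk>
     \<Longrightarrow> \<exists>T D. mset xs = mset (D @ T) \<and> length T = m \<and> (\<forall>t\<in>set T. \<bar>real t / n - z\<bar> < \<epsilon>) \<and> real (sum_list D) < \<epsilon> * n"
proof -
  obtain \<theta> where \<theta>: "0 < \<theta>" "\<And>ys. ys \<in> unit_vectors \<Longrightarrow> equal_weight m - \<theta> < weight ys \<Longrightarrow>
     \<exists>T D. mset ys = mset (D @ T) \<and> length T = m \<and> (\<forall>t\<in>set T. \<bar>t - 1 / m\<bar> < \<epsilon>) \<and> sum_list D < \<epsilon>"
    using stability[OF assms] by blast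
  show thesis
  \<comment> \<open>Half of \<open>\<theta>\<close> turns the weak inequality at hand into the
    strict one that \<open>stability\<close> asks for.\<close>
  proof (rule that[of "\<theta> / 2" 1])
    fix n :: nat and xs
    assume n: "1 \<le> n" and xs: "sum_list xs = n" and ge: "real n ^ sum_mset M * (equal_weight m - \<theta> / 2) \<le> psum cw M xs"
    have n0: "0 < n" using n by simp
    let ?f = "\<lambda>x. real x / n"
    have "real n ^ sum_mset M * (equal_weight m - \<theta> / 2) \<le> real n ^ sum_mset M * weight (map ?f xs)"
      using psum_cw_le_equal_weight(1)[OF xs n0] ge by linarith
    then have "equal_weight m - \<theta> / 2 \<le> weight (map ?f xs)"
      using n0 by (simp add: mult_le_cancel_left_pos)
    then have "equal_weight m - \<theta> < weight (map ?f xs)" using \<theta>(1) by linarith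
    from \<theta>(2)[OF psum_cw_le_equal_weight(2)[OF xs n0] this]
    obtain T' D' where TD: "mset (map ?f xs) = mset (D' @ T')" "length T' = m" "\<forall>t\<in>set T'. \<bar>t - 1 / m\<bar> < \<epsilon>" "sum_list D' < \<epsilon>"
      by blast
    have "image_mset ?f (mset xs) = mset D' + mset T'" using TD(1) by simp
    from image_mset_eq_plusD[OF this]
    obtain DD TT where DDTT: "mset xs = DD + TT" "mset D' = image_mset ?f DD" "mset T' = image_mset ?f TT" by auto
    obtain D where D: "mset D = DD" using ex_mset by auto
    obtain T where T: "mset T = TT" using ex_mset by auto
    have DT: "mset xs = mset (D @ T)" "mset D' = mset (map ?f D)" "mset T' = mset (map ?f T)"
      unfolding mset_map mset_append D T by (rule DDTT)+
    have "length T = m" using TD(2) arg_cong[OF DT(3), of size] by simp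
    moreover have "\<forall>t\<in>set T. \<bar>real t / n - z\<bar> < \<epsilon>"
      using TD(3) mset_eq_setD[OF DT(3)] by (auto simp: z_def)
    moreover have "real (sum_list D) < \<epsilon> * n"
    proof -
      have "sum_list (map ?f D) = real (sum_list D) / n" by (induction D) (auto simp: add_divide_distrib)
      moreover have "sum_list D' = sum_list (map ?f D)" using arg_cong[OF DT(2), of sum_mset] by (simp only: sum_mset_sum_list)
      ultimately show ?thesis using TD(4) n0 by (simp add: pos_divide_less_eq)
    qed
    ultimately show "\<exists>T D. mset xs = mset (D @ T) \<and> length T = m \<and> (\<forall>t\<in>set T. \<bar>real t / n - z\<bar> < \<epsilon>) \<and> real (sum_list D) < \<epsilon> * n"
      using DT(1) by (intro exI[of _ T] exI[of _ D] conjI)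
  qed (use \<theta> in simp)
qed

theorem optimal_parts_balanced:
  obtains N where "\<And>n xs. \<lbrakk>N \<le> n; sum_list xs = n; \<forall>x\<in>set xs. 1 \<le> x;
      \<forall>ys. sum_list ys = n \<and> (\<forall>y\<in>set ys. 1 \<le> y) \<longrightarrow> psum cw M ys \<le> psum cw M xs\<rbrakk>
      \<Longrightarrow> length xs = m \<and> balanced_list xs"
proof -
  obtain \<epsilon>1 :: real and N1 :: nat where 1: "0 < \<epsilon>1"
    "\<And>(n::nat) x q T D. \<lbrakk>N1 \<le> n; length T = m - 1; \<forall>t\<in>set (x # T). \<bar>real t / n - z\<bar> < \<epsilon>1; 1 \<le> q;
        real (q + sum_list D) \<le> \<epsilon>1 * n; x + q + sum_list T + sum_list D = n\<rbrakk>
      \<Longrightarrow> psum cw M (x # q # D @ T) < psum cw M ((x + q) # D @ T)"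
    by (rule merge_small_part) (rule that)
  obtain \<epsilon>2 :: real and N2 :: nat where 2: "0 < \<epsilon>2"
    "\<And>(n::nat) X Y T. \<lbrakk>N2 \<le> n; length T = m - 2; \<forall>t\<in>set (Suc X # Y # T). \<bar>real t / n - z\<bar> < \<epsilon>2; Y < X;
        sum_list T \<le> n\<rbrakk> \<Longrightarrow> psum cw M (Suc X # Y # T) < psum cw M (X # Suc Y # T)"
    by (rule balance_parts) (rule that)
  define \<epsilon> where "\<epsilon> = min \<epsilon>1 \<epsilon>2"
  have \<epsilon>: "0 < \<epsilon>" "\<epsilon> \<le> \<epsilon>1" "\<epsilon> \<le> \<epsilon>2" using 1(1) 2(1) by (auto simp: \<epsilon>_def)
  obtain N3 :: nat and \<theta> :: real where 3: "0 < \<theta>" "\<And>n xs. \<lbrakk>N3 \<le> n; sum_list xs = n; real n ^ sum_mset M * (equal_weight m - \<theta>) \<le> psum cw M xs\<rbrakk>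
     \<Longrightarrow> \<exists>T D. mset xs = mset (D @ T) \<and> length T = m \<and> (\<forall>t\<in>set T. \<bar>real t / n - z\<bar> < \<epsilon>) \<and> real (sum_list D) < \<epsilon> * n"
    by (rule near_optimal_parts[OF \<epsilon>(1)]) (rule that)
  obtain N4 where 4: "\<And>n xs. \<lbrakk>N4 \<le> n; balanced_list xs; length xs = m; sum_list xs = n\<rbrakk>
      \<Longrightarrow> real n ^ sum_mset M * (equal_weight m - \<theta>) \<le> psum cw M xs"
    by (rule balanced_list_psum_ge[OF 3(1)]) (rule that)
  show thesis
  proof (rule that[of "N1 + N2 + N3 + N4 + m"])
    fix n xs
    assume "N1 + N2 + N3 + N4 + m \<le> n" and xs: "sum_list xs = n" "\<forall>x\<in>set xs. 1 \<le> x"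
      and max: "\<forall>ys. sum_list ys = n \<and> (\<forall>y\<in>set ys. 1 \<le> y) \<longrightarrow> psum cw M ys \<le> psum cw M xs"
    then have n: "N1 \<le> n" "N2 \<le> n" "N3 \<le> n" "N4 \<le> n" "m \<le> n" by auto
    have opt: "psum cw M ys \<le> psum cw M xs" if "sum_list ys = n" "\<forall>y\<in>set ys. 1 \<le> y" for ys
      using max that by blast
    obtain bs where bs: "balanced_list bs" "length bs = m" "sum_list bs = n" "\<forall>x\<in>set bs. 1 \<le> x"
      by (rule ex_balanced_list[OF n(5)]) (rule that)
    have "real n ^ sum_mset M * (equal_weight m - \<theta>) \<le> psum cw M xs"
      using 4[OF n(4) bs(1-3)] opt[OF bs(3,4)] by linarith
    from 3(2)[OF n(3) xs(1) this] obtain T D where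
      TD: "mset xs = mset (D @ T)" "length T = m" "\<forall>t\<in>set T. \<bar>real t / n - z\<bar> < \<epsilon>" "real (sum_list D) < \<epsilon> * n"
      by blast
    have sum: "sum_list D + sum_list T = n"
      using arg_cong[OF TD(1), of sum_mset] xs by (simp add: sum_mset_sum_list)
    have near: "\<bar>real t / n - z\<bar> < \<epsilon>1" "\<bar>real t / n - z\<bar> < \<epsilon>2" if "t \<in> set T" for t
      using bspec[OF TD(3) that] \<epsilon>(2,3) by linarith+
    have pos: "\<forall>x\<in>set (D @ T). 1 \<le> x" using xs(2) mset_eq_setD[OF TD(1)] by simp
    have opt': "\<not> psum cw M us < psum cw M ys"
      if "mset us = mset xs" "sum_list ys = n" "\<forall>y\<in>set ys. 1 \<le> y" for us ys
      using opt[OF that(2,3)] psum_mset_cong[OF that(1)] by (simp add: not_less)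
    \<comment> \<open>Merging a single leftover part already contradicts optimality; the other
      leftovers stay where they are.\<close>
    have "D = []"
    proof (rule ccontr)
      assume "D \<noteq> []"
      then obtain q D2 where D: "D = q # D2" by (meson neq_Nil_conv)
      have "T \<noteq> []" using TD(2) two_le_m by auto
      then obtain x T2 where T: "T = x # T2" by (meson neq_Nil_conv)
      have "psum cw M (x # q # D2 @ T2) < psum cw M ((x + q) # D2 @ T2)"
      proof (rule 1(2)[OF n(1)])
        show "length T2 = m - 1" using TD(2) T by simp
        show "\<forall>t\<in>set (x # T2). \<bar>real t / n - z\<bar> < \<epsilon>1" unfolding T[symmetric] using near(1) by blast
        show "1 \<le> q" using pos D by simp
        have "\<epsilon> * real n \<le> \<epsilon>1 * real n" using \<epsilon>(2) by (intro mult_right_mono) auto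
        then show "real (q + sum_list D2) \<le> \<epsilon>1 * real n" using TD(4) D by simp
        show "x + q + sum_list T2 + sum_list D2 = n" using sum D T by simp
      qed
      moreover have "mset (x # q # D2 @ T2) = mset xs" using TD(1) D T by simp
      moreover have "sum_list ((x + q) # D2 @ T2) = n" using sum D T by simp
      moreover have "\<forall>y\<in>set ((x + q) # D2 @ T2). 1 \<le> y" using pos D T by auto
      ultimately show False using opt' by blast
    qed
    then have xsT: "mset xs = mset T" using TD(1) by simp
    have "balanced_list xs"
      unfolding balanced_list_def
    proof (intro ballI, rule ccontr)
      fix x y assume xy: "x \<in> set xs" "y \<in> set xs" "\<not> x \<le> y + 1"
      from xy(3) obtain X where X: "x = Suc X" "y < X" by (cases x) auto
      have "x \<in># mset T" "y \<in># mset T" "x \<noteq> y"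
        unfolding xsT[symmetric] using xy by auto
      then have "y \<in># mset T - {#x#}" by (simp add: in_diff_count)
      then have "mset T = add_mset x (add_mset y (mset T - {#x#} - {#y#}))"
        using \<open>x \<in># mset T\<close> by (simp only: insert_DiffM)
      moreover obtain T2 where "mset T2 = mset T - {#x#} - {#y#}" using ex_mset by auto
      ultimately have T2: "mset T = mset (x # y # T2)" by simp
      have len: "length T2 = m - 2" using arg_cong[OF T2, of size] TD(2) by simp
      have sets: "set T = set (x # y # T2)" using mset_eq_setD[OF T2] .
      have sum2: "x + y + sum_list T2 = n"
        using sum \<open>D = []\<close> arg_cong[OF T2, of sum_mset] by (simp add: sum_mset_sum_list)
      have "psum cw M (Suc X # y # T2) < psum cw M (X # Suc y # T2)"
      proof (rule 2(2)[OF n(2) len])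
        show "\<forall>t\<in>set (Suc X # y # T2). \<bar>real t / n - z\<bar> < \<epsilon>2"
          unfolding X(1)[symmetric] sets[symmetric] using near(2) by blast
        show "y < X" by fact
        show "sum_list T2 \<le> n" using sum2 by simp
      qed
      moreover have "mset (Suc X # y # T2) = mset xs" using xsT T2 X by simp
      moreover have "sum_list (X # Suc y # T2) = n" using sum2 X by simp
      moreover have "\<forall>v\<in>set (X # Suc y # T2). 1 \<le> v" using pos sets \<open>D = []\<close> X by auto
      ultimately show False using opt' by blast
    qed
    moreover have "length xs = m" using arg_cong[OF xsT, of size] TD(2) by simp
    ultimately show "length xs = m \<and> balanced_list xs" by simp
  qed
qed

end

section \<open>Fibre sizes and copies in complete multipartite graphs\<close>

text \<open>The multiset of colour class sizes: a complete isomorphism invariant of the complete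
  multipartite graph with colouring \<open>c\<close>, by \<open>fibre_sizes_eq_iff\<close>.\<close>

definition fibre_sizes :: "('a \<Rightarrow> 'b) \<Rightarrow> 'a set \<Rightarrow> nat multiset" where
  "fibre_sizes c X = image_mset (\<lambda>k. card {i\<in>X. c i = k}) (mset_set (c ` X))"

lemma fibre_sizes_empty [simp]: "fibre_sizes c {} = {#}"
  by (simp add: fibre_sizes_def)

lemma fibre_sizes_Un:
  assumes "finite T" "finite S" "c ` T \<subseteq> {k}" "k \<notin> c ` S"
  shows "fibre_sizes c (T \<union> S) = (if T = {} then {#} else {#card T#}) + fibre_sizes c S"
proof (cases "T = {}")
  case False
  then have im: "c ` (T \<union> S) = insert k (c ` S)" using assms by auto
  have k: "{i \<in> T \<union> S. c i = k} = T" using assms by auto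
  have o: "{i \<in> T \<union> S. c i = k'} = {i \<in> S. c i = k'}" if "k' \<in> c ` S" for k'
    using that assms by auto
  have "image_mset (\<lambda>k. card {i \<in> T \<union> S. c i = k}) (mset_set (c ` S)) = fibre_sizes c S"
    unfolding fibre_sizes_def using assms by (intro image_mset_cong) (simp add: o del: Un_iff)
  then show ?thesis using False assms by (simp add: fibre_sizes_def[of c "T \<union> S"] im k del: Un_iff)
qed simp

lemma size_fibre_sizes: "size (fibre_sizes c X) = card (c ` X)"
  by (simp add: fibre_sizes_def)

lemma fibre_sizes_pos: "finite X \<Longrightarrow> x \<in># fibre_sizes c X \<Longrightarrow> 1 \<le> x"
  by (auto simp: fibre_sizes_def Suc_le_eq card_gt_0_iff)

lemma sum_fibre_sizes:
  assumes "finite X"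
  shows "sum_mset (fibre_sizes c X) = card X"
proof -
  have "sum_mset (fibre_sizes c X) = (\<Sum>k\<in>c ` X. card {i\<in>X. c i = k})"
    by (simp add: fibre_sizes_def sum_unfold_sum_mset)
  also have "\<dots> = card X" using sum.image_gen[OF assms, of "\<lambda>_. 1::nat" c] by simp
  finally show ?thesis .
qed

lemma ex_bij_betw_image_mset:
  assumes "finite A" "finite B" "image_mset f (mset_set A) = image_mset g (mset_set B)"
  shows "\<exists>\<phi>. bij_betw \<phi> A B \<and> (\<forall>a\<in>A. f a = g (\<phi> a))"
  using assms
proof (induction A arbitrary: B rule: finite_induct)
  case empty
  then show ?case by (auto simp: mset_set_empty_iff bij_betw_def)
next
  case (insert a A)
  then have e: "add_mset (f a) (image_mset f (mset_set A)) = image_mset g (mset_set B)" by simp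
  then have "f a \<in># image_mset g (mset_set B)" by (metis union_single_eq_member)
  then obtain b where b: "b \<in> B" "f a = g b" using insert.prems by auto
  have "mset_set B = add_mset b (mset_set (B - {b}))"
    using b insert.prems by (simp add: mset_set.remove)
  then have "image_mset f (mset_set A) = image_mset g (mset_set (B - {b}))" using e b by simp
  from insert.IH[OF _ this] insert.prems obtain \<phi> where \<phi>: "bij_betw \<phi> A (B - {b})" "\<forall>a\<in>A. f a = g (\<phi> a)" by auto
  have "bij_betw (\<phi>(a := b)) A (B - {b})"
    using \<phi>(1) insert.hyps by (subst bij_betw_cong[of A _ \<phi>]) auto
  then have "bij_betw (\<phi>(a := b)) (insert a A) (insert b (B - {b}))"
    using insert.hyps notIn_Un_bij_betw[of a A "\<phi>(a := b)" "B - {b}"] by simp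
  then have "bij_betw (\<phi>(a := b)) (insert a A) B" using b by (simp add: insert_absorb)
  moreover have "\<forall>x\<in>insert a A. f x = g ((\<phi>(a := b)) x)" using \<phi> b insert.hyps by auto
  ultimately show ?case by blast
qed

text \<open>Equal multisets allow the classes to be matched by size, and bijections between matched
  classes are glued together. Conversely \<open>f\<close> induces a bijection between the colours
  that preserves class sizes.\<close>

lemma fibre_sizes_eq_iff:
  assumes "finite X" "finite Y"
  shows "fibre_sizes c X = fibre_sizes d Y \<longleftrightarrow>
     (\<exists>f. bij_betw f X Y \<and> (\<forall>i\<in>X. \<forall>j\<in>X. c i = c j \<longleftrightarrow> d (f i) = d (f j)))"
proof
  assume "fibre_sizes c X = fibre_sizes d Y"
  then obtain \<phi> where \<phi>: "bij_betw \<phi> (c ` X) (d ` Y)" "\<forall>k\<in>c ` X. card {i\<in>X. c i = k} = card {i\<in>Y. d i = \<phi> k}"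
    using ex_bij_betw_image_mset[of "c ` X" "d ` Y" "\<lambda>k. card {i\<in>X. c i = k}" "\<lambda>k. card {i\<in>Y. d i = k}"] assms
    unfolding fibre_sizes_def by blast
  have "\<exists>h. bij_betw h {i\<in>X. c i = k} {i\<in>Y. d i = \<phi> k}" if "k \<in> c ` X" for k
    using \<phi>(2) that assms by (intro finite_same_card_bij) auto
  then obtain h where h: "\<And>k. k \<in> c ` X \<Longrightarrow> bij_betw (h k) {i\<in>X. c i = k} {i\<in>Y. d i = \<phi> k}" by metis
  define f where "f i = h (c i) i" for i
  have f: "f i \<in> Y" "d (f i) = \<phi> (c i)" if "i \<in> X" for i
    using bij_betwE[OF h[of "c i"]] that by (auto simp: f_def)
  have sep: "c i = c j \<longleftrightarrow> d (f i) = d (f j)" if "i \<in> X" "j \<in> X" for i j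
    using f(2) that bij_betw_imp_inj_on[OF \<phi>(1)] by (auto dest: inj_onD)
  have "inj_on f X"
  proof (rule inj_onI)
    fix i j assume ij: "i \<in> X" "j \<in> X" "f i = f j"
    then have "c i = c j" using sep by simp
    then show "i = j" using ij inj_onD[OF bij_betw_imp_inj_on[OF h[of "c i"]], of i j] by (auto simp: f_def)
  qed
  moreover have "f ` X = Y"
  proof (intro equalityI subsetI)
    fix y assume y: "y \<in> Y"
    then have "d y \<in> \<phi> ` c ` X" using bij_betw_imp_surj_on[OF \<phi>(1)] by auto
    then obtain k where k: "k \<in> c ` X" "d y = \<phi> k" by blast
    then have "y \<in> h k ` {i\<in>X. c i = k}" using y bij_betw_imp_surj_on[OF h[OF k(1)]] by auto
    then show "y \<in> f ` X" by (auto simp: f_def)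
  qed (use f in auto)
  ultimately have "bij_betw f X Y" by (simp add: bij_betw_def)
  with sep show "\<exists>f. bij_betw f X Y \<and> (\<forall>i\<in>X. \<forall>j\<in>X. c i = c j \<longleftrightarrow> d (f i) = d (f j))" by blast
next
  assume "\<exists>f. bij_betw f X Y \<and> (\<forall>i\<in>X. \<forall>j\<in>X. c i = c j \<longleftrightarrow> d (f i) = d (f j))"
  then obtain f where f: "bij_betw f X Y" "\<And>i j. i \<in> X \<Longrightarrow> j \<in> X \<Longrightarrow> c i = c j \<longleftrightarrow> d (f i) = d (f j)" by blast
  define \<phi> where "\<phi> k = d (f (SOME i. i \<in> X \<and> c i = k))" for k
  have \<phi>: "\<phi> (c i) = d (f i)" if "i \<in> X" for i
  proof -
    have "(SOME i'. i' \<in> X \<and> c i' = c i) \<in> X \<and> c (SOME i'. i' \<in> X \<and> c i' = c i) = c i"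
      by (rule someI[of _ i]) (use that in simp)
    then show ?thesis unfolding \<phi>_def using f(2) that by blast
  qed
  have Y: "Y = f ` X" using f(1) by (simp add: bij_betw_def)
  have inj: "inj_on \<phi> (c ` X)" using \<phi> f(2) by (auto intro!: inj_onI)
  have im: "\<phi> ` c ` X = d ` Y" unfolding Y image_image using \<phi> by (intro image_cong) auto
  have "card {y\<in>Y. d y = \<phi> k} = card {i\<in>X. c i = k}" if k: "k \<in> c ` X" for k
  proof -
    obtain i where i: "i \<in> X" "k = c i" using k by blast
    have "{y\<in>Y. d y = \<phi> k} = f ` {j\<in>X. c j = k}"
      unfolding Y using f(2)[OF _ i(1)] \<phi>[OF i(1)] i by auto
    moreover have "inj_on f {j\<in>X. c j = k}" using f(1) by (auto simp: bij_betw_def inj_on_def)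
    ultimately show ?thesis by (simp add: card_image)
  qed
  then have "image_mset (\<lambda>k. card {i\<in>X. c i = k}) (mset_set (c ` X)) = image_mset (\<lambda>k. card {y\<in>Y. d y = \<phi> k}) (mset_set (c ` X))"
    using assms by (intro image_mset_cong) auto
  also have "\<dots> = image_mset (\<lambda>k. card {y\<in>Y. d y = k}) (image_mset \<phi> (mset_set (c ` X)))"
    by (simp add: multiset.map_comp o_def)
  also have "image_mset \<phi> (mset_set (c ` X)) = mset_set (d ` Y)"
    using image_mset_mset_set[OF inj] im by simp
  finally show "fibre_sizes c X = fibre_sizes d Y" by (simp add: fibre_sizes_def)
qed

text \<open>Induction on the colours, splitting \<open>S\<close> into its part in the first colour
  class and the rest. This is the recursion of \<open>psum\<close>.\<close>

lemma card_fibre_sizes_eq: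
  assumes "finite X" "distinct ks" "c ` X \<subseteq> set ks" "0 \<notin># M"
  shows "real (card {S. S \<subseteq> X \<and> fibre_sizes c S = M}) = psum cw M (map (\<lambda>k. card {i\<in>X. c i = k}) ks)"
  using assms
proof (induction ks arbitrary: X M)
  case Nil
  then have "{S. S \<subseteq> X \<and> fibre_sizes c S = M} = (if M = {#} then {{}} else {})" by auto
  then show ?case by simp
next
  case (Cons k ks)
  define X1 where "X1 = {i\<in>X. c i = k}"
  define X2 where "X2 = {i\<in>X. c i \<noteq> k}"
  have fin: "finite X1" "finite X2" using Cons.prems by (auto simp: X1_def X2_def)
  have X: "X = X1 \<union> X2" "X1 \<inter> X2 = {}" by (auto simp: X1_def X2_def)
  have eqs: "map (\<lambda>k'. card {i\<in>X. c i = k'}) ks = map (\<lambda>k'. card {i\<in>X2. c i = k'}) ks"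
  proof (rule map_cong[OF refl])
    fix k' assume "k' \<in> set ks"
    with Cons.prems(2) have "{i\<in>X. c i = k'} = {i\<in>X2. c i = k'}" by (auto simp: X2_def)
    then show "card {i\<in>X. c i = k'} = card {i\<in>X2. c i = k'}" by (rule arg_cong)
  qed
  have IH: "real (card {S. S \<subseteq> X2 \<and> fibre_sizes c S = N}) = psum cw N (map (\<lambda>k'. card {i\<in>X. c i = k'}) ks)"
    if "0 \<notin># N" for N
  proof -
    have "c ` X2 \<subseteq> set ks" using Cons.prems(3) by (auto simp: X2_def)
    from Cons.IH[OF fin(2) _ this that] Cons.prems(2) show ?thesis unfolding eqs by simp
  qed
  have fs: "fibre_sizes c (T \<union> S) = (if T = {} then {#} else {#card T#}) + fibre_sizes c S" if "T \<subseteq> X1" "S \<subseteq> X2" for T S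
    using that fin by (intro fibre_sizes_Un[where k = k]) (auto simp: X1_def X2_def intro: finite_subset)
  \<comment> \<open>\<open>P 0\<close> collects the sets that avoid the first colour and gives the
    first summand of \<open>psum\<close>; as \<open>0 \<notin># M\<close>, it does not overlap with
    the sets for \<open>\<alpha> \<in># M\<close>.\<close>
  define P where "P \<alpha> = {S. S \<subseteq> X \<and> card (S \<inter> X1) = \<alpha> \<and> fibre_sizes c S = M}" for \<alpha>
  have card_P: "card (P \<alpha>) = (card X1 choose \<alpha>) * card {S. S \<subseteq> X2 \<and> (if \<alpha> = 0 then {#} else {#\<alpha>#}) + fibre_sizes c S = M}" for \<alpha>
  proof -
    let ?A = "{T. T \<subseteq> X1 \<and> card T = \<alpha>}" and ?B = "{S. S \<subseteq> X2 \<and> (if \<alpha> = 0 then {#} else {#\<alpha>#}) + fibre_sizes c S = M}"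
    have "bij_betw (\<lambda>(T, S). T \<union> S) (?A \<times> ?B) (P \<alpha>)"
    proof (rule bij_betwI[where g = "\<lambda>S. (S \<inter> X1, S \<inter> X2)"])
      show "(\<lambda>(T, S). T \<union> S) \<in> ?A \<times> ?B \<rightarrow> P \<alpha>"
      proof (rule Pi_I)
        fix p assume p: "p \<in> ?A \<times> ?B"
        obtain T S where pTS: "p = (T, S)" by (cases p)
        have TS: "T \<subseteq> X1" "S \<subseteq> X2" "card T = \<alpha>" "(if \<alpha> = 0 then {#} else {#\<alpha>#}) + fibre_sizes c S = M"
          using p unfolding pTS by auto
        have "(T \<union> S) \<inter> X1 = T" using TS X by auto
        moreover have "\<alpha> = 0 \<longleftrightarrow> T = {}" using TS finite_subset[OF TS(1) fin(1)] by auto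
        ultimately show "(case p of (T, S) \<Rightarrow> T \<union> S) \<in> P \<alpha>"
          using fs[OF TS(1,2)] TS X by (auto simp: P_def pTS)
      qed
      show "(\<lambda>S. (S \<inter> X1, S \<inter> X2)) \<in> P \<alpha> \<rightarrow> ?A \<times> ?B"
      proof
        fix S assume S: "S \<in> P \<alpha>"
        then have "S = (S \<inter> X1) \<union> (S \<inter> X2)" using X by (auto simp: P_def)
        moreover have "card (S \<inter> X1) = 0 \<longleftrightarrow> S \<inter> X1 = {}" using fin by auto
        ultimately show "(S \<inter> X1, S \<inter> X2) \<in> ?A \<times> ?B"
          using S fs[of "S \<inter> X1" "S \<inter> X2"] by (auto simp: P_def)
      qed
    qed (use X in \<open>auto simp: P_def\<close>)
    then have "card (P \<alpha>) = card (?A \<times> ?B)" by (rule bij_betw_same_card[symmetric])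
    then show ?thesis using fin by (simp add: n_subsets card_cartesian_product)
  qed
  have "{S. S \<subseteq> X \<and> fibre_sizes c S = M} = P 0 \<union> (\<Union>\<alpha>\<in>set_mset M. P \<alpha>)"
  proof (intro equalityI subsetI)
    fix S assume S: "S \<in> {S. S \<subseteq> X \<and> fibre_sizes c S = M}"
    then have "S = (S \<inter> X1) \<union> (S \<inter> X2)" using X by auto
    then have "M = (if S \<inter> X1 = {} then {#} else {#card (S \<inter> X1)#}) + fibre_sizes c (S \<inter> X2)"
      using S fs[of "S \<inter> X1" "S \<inter> X2"] by auto
    then have "S \<inter> X1 = {} \<or> card (S \<inter> X1) \<in># M" by (auto split: if_splits)
    then show "S \<in> P 0 \<union> (\<Union>\<alpha>\<in>set_mset M. P \<alpha>)" using S by (auto simp: P_def)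
  qed (auto simp: P_def)
  moreover have "finite (P \<alpha>)" for \<alpha>
    using Cons.prems by (auto simp: P_def intro: finite_subset[of _ "Pow X"])
  moreover have "P 0 \<inter> (\<Union>\<alpha>\<in>set_mset M. P \<alpha>) = {}" using Cons.prems by (auto simp: P_def)
  moreover have "card (\<Union>\<alpha>\<in>set_mset M. P \<alpha>) = (\<Sum>\<alpha>\<in>set_mset M. card (P \<alpha>))"
    using \<open>\<And>\<alpha>. finite (P \<alpha>)\<close> by (intro card_UN_disjoint) (auto simp: P_def)
  ultimately have "card {S. S \<subseteq> X \<and> fibre_sizes c S = M} = card (P 0) + (\<Sum>\<alpha>\<in>set_mset M. card (P \<alpha>))"
    by (simp add: card_Un_disjoint)
  moreover have "real (card (P 0)) = psum cw M (map (\<lambda>k'. card {i\<in>X. c i = k'}) ks)"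
    using IH[of M] Cons.prems by (simp add: card_P)
  moreover have "real (card (P \<alpha>)) = cw (card X1) \<alpha> * psum cw (M - {#\<alpha>#}) (map (\<lambda>k'. card {i\<in>X. c i = k'}) ks)"
    if a: "\<alpha> \<in># M" for \<alpha>
  proof -
    have "\<alpha> \<noteq> 0" using a Cons.prems(4) by metis
    moreover have "{#\<alpha>#} + N = M \<longleftrightarrow> N = M - {#\<alpha>#}" for N
      using insert_DiffM[OF a] by (metis add_diff_cancel_left' add_mset_add_single union_commute)
    moreover have "0 \<notin># M - {#\<alpha>#}" using Cons.prems by (auto dest: in_diffD)
    ultimately show ?thesis using IH[of "M - {#\<alpha>#}"] by (simp add: card_P cw_def)
  qed
  ultimately show ?case by (simp add: X1_def)
qed

section \<open>Induced copies in complete multipartite graphs\<close>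

lemma part_index_Cons_less: "i < x \<Longrightarrow> part_index (x # xs) i = 0"
  by (simp add: part_index_def Least_eq_0)

lemma part_index_Cons_ge:
  assumes "x \<le> i" "i < x + sum_list xs"
  shows "part_index (x # xs) i = Suc (part_index xs (i - x))"
proof -
  have "(LEAST p. i < sum_list (take (Suc p) (x # xs))) = Suc (LEAST p. i < sum_list (take (Suc (Suc p)) (x # xs)))"
    by (rule Least_Suc[of _ "length xs"]) (use assms in auto)
  also have "(\<lambda>p. i < sum_list (take (Suc (Suc p)) (x # xs))) = (\<lambda>p. i - x < sum_list (take (Suc p) xs))"
    using assms by (auto simp: fun_eq_iff)
  finally show ?thesis by (simp add: part_index_def)
qed

lemma fibre_sizes_part_index: "\<forall>x\<in>set a. 1 \<le> x \<Longrightarrow> fibre_sizes (part_index a) {0..<sum_list a} = mset a"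
proof (induction a)
  case (Cons x xs)
  have split: "{0..<sum_list (x # xs)} = {0..<x} \<union> {x..<x + sum_list xs}" by auto
  have "fibre_sizes (part_index (x # xs)) ({0..<x} \<union> {x..<x + sum_list xs})
      = (if {0..<x} = {} then {#} else {#card {0..<x}#}) + fibre_sizes (part_index (x # xs)) {x..<x + sum_list xs}"
    by (rule fibre_sizes_Un[where k = 0]) (auto simp: part_index_Cons_less part_index_Cons_ge)
  also have "fibre_sizes (part_index (x # xs)) {x..<x + sum_list xs} = fibre_sizes (part_index xs) {0..<sum_list xs}"
  proof (subst fibre_sizes_eq_iff)
    have "bij_betw (\<lambda>i. i - x) {x..<x + sum_list xs} {0..<sum_list xs}"
      by (rule bij_betwI[where g = "\<lambda>i. i + x"]) auto
    then show "\<exists>f. bij_betw f {x..<x + sum_list xs} {0..<sum_list xs} \<and>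
        (\<forall>i\<in>{x..<x + sum_list xs}. \<forall>j\<in>{x..<x + sum_list xs}. part_index (x # xs) i = part_index (x # xs) j
            \<longleftrightarrow> part_index xs (f i) = part_index xs (f j))"
      by (intro exI[of _ "\<lambda>i. i - x"]) (auto simp: part_index_Cons_ge)
  qed auto
  finally have "fibre_sizes (part_index (x # xs)) {0..<sum_list (x # xs)} = (if {0..<x} = {} then {#} else {#card {0..<x}#}) + mset xs"
    unfolding split using Cons by simp
  then show ?case using Cons.prems by simp
qed simp

definition multipartite :: "nat \<Rightarrow> (nat \<Rightarrow> nat \<Rightarrow> bool) \<Rightarrow> (nat \<Rightarrow> nat) \<Rightarrow> bool" where
  "multipartite n E c \<longleftrightarrow> (\<forall>i<n. \<forall>j<n. E i j \<longleftrightarrow> c i \<noteq> c j)"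

lemma induced_count_multipartite:
  assumes "\<forall>x\<in>set a. 1 \<le> x" "multipartite n E c" "mset xs = fibre_sizes c {0..<n}"
  shows "real (induced_count (sum_list a) (complete_multipartite a) n E) = psum cw (mset a) xs"
proof -
  let ?l = "sum_list a"
  have *: "card S = ?l \<and> (\<exists>f. bij_betw f {0..<?l} S \<and> (\<forall>i<?l. \<forall>j<?l. complete_multipartite a i j \<longleftrightarrow> E (f i) (f j)))
      \<longleftrightarrow> fibre_sizes c S = mset a" if S: "S \<subseteq> {0..<n}" for S
  proof -
    have fin: "finite S" using S finite_subset by blast
    have eq: "(complete_multipartite a i j \<longleftrightarrow> E (f i) (f j)) \<longleftrightarrow> (part_index a i = part_index a j \<longleftrightarrow> c (f i) = c (f j))"
      if "bij_betw f {0..<?l} S" "i < ?l" "j < ?l" for f i j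
    proof -
      have "f ` {0..<?l} \<subseteq> {0..<n}" using bij_betw_imp_surj_on[OF that(1)] S by simp
      moreover have "f i \<in> f ` {0..<?l}" "f j \<in> f ` {0..<?l}" using that(2,3) by auto
      ultimately have "f i \<in> {0..<n}" "f j \<in> {0..<n}" by blast+
      then have "f i < n" "f j < n" by simp_all
      then show ?thesis using assms(2) that by (simp add: multipartite_def complete_multipartite_def)
    qed
    have "(\<exists>f. bij_betw f {0..<?l} S \<and> (\<forall>i<?l. \<forall>j<?l. complete_multipartite a i j \<longleftrightarrow> E (f i) (f j)))
      \<longleftrightarrow> (\<exists>f. bij_betw f {0..<?l} S \<and> (\<forall>i\<in>{0..<?l}. \<forall>j\<in>{0..<?l}. part_index a i = part_index a j \<longleftrightarrow> c (f i) = c (f j)))"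
    proof (rule iff_exI, rule conj_cong[OF refl])
      fix f assume "bij_betw f {0..<?l} S"
      from eq[OF this] show "(\<forall>i<?l. \<forall>j<?l. complete_multipartite a i j \<longleftrightarrow> E (f i) (f j))
        \<longleftrightarrow> (\<forall>i\<in>{0..<?l}. \<forall>j\<in>{0..<?l}. part_index a i = part_index a j \<longleftrightarrow> c (f i) = c (f j))"
        by (simp add: Ball_def)
    qed
    also have "\<dots> \<longleftrightarrow> fibre_sizes (part_index a) {0..<?l} = fibre_sizes c S"
      by (rule fibre_sizes_eq_iff[symmetric]) (use fin in auto)
    also have "\<dots> \<longleftrightarrow> fibre_sizes c S = mset a"
      unfolding fibre_sizes_part_index[OF assms(1)] by (rule eq_commute)
    finally have iff: "(\<exists>f. bij_betw f {0..<?l} S \<and> (\<forall>i<?l. \<forall>j<?l. complete_multipartite a i j \<longleftrightarrow> E (f i) (f j)))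
      \<longleftrightarrow> fibre_sizes c S = mset a" .
    have "card S = ?l" if "bij_betw f {0..<?l} S" for f
      using bij_betw_same_card[OF that] by simp
    then show ?thesis unfolding iff[symmetric] by blast
  qed
  have "induced_count ?l (complete_multipartite a) n E = card {S. S \<subseteq> {0..<n} \<and> fibre_sizes c S = mset a}"
    unfolding induced_count_def 
    by (rule arg_cong[where f = card], rule Collect_cong, rule conj_cong[OF refl], rule *)
  moreover have "real (card {S. S \<subseteq> {0..<n} \<and> fibre_sizes c S = mset a})
      = psum cw (mset a) (map (\<lambda>k. card {i\<in>{0..<n}. c i = k}) (sorted_list_of_set (c ` {0..<n})))"
    by (rule card_fibre_sizes_eq) (use assms in auto)
  moreover have "psum cw (mset a) (map (\<lambda>k. card {i\<in>{0..<n}. c i = k}) (sorted_list_of_set (c ` {0..<n}))) = psum cw (mset a) xs"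
  proof (rule psum_mset_cong)
    have "mset (sorted_list_of_set (c ` {0..<n})) = mset_set (c ` {0..<n})"
      by (metis distinct_sorted_list_of_set finite_atLeastLessThan finite_imageI mset_set_set set_sorted_list_of_set)
    then show "mset (map (\<lambda>k. card {i\<in>{0..<n}. c i = k}) (sorted_list_of_set (c ` {0..<n}))) = mset xs"
      by (simp add: assms(3) fibre_sizes_def)
  qed
  ultimately show ?thesis by simp
qed

section \<open>Symmetrisation\<close>

text \<open>For irreflexive \<open>E\<close> the set \<open>X\<close> together with \<open>u\<close>
  becomes independent.\<close>

definition clone :: "nat set \<Rightarrow> nat \<Rightarrow> (nat \<Rightarrow> nat \<Rightarrow> bool) \<Rightarrow> nat \<Rightarrow> nat \<Rightarrow> bool" where
  "clone X u E x y = E (if x \<in> X then u else x) (if y \<in> X then u else y)"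

definition is_copy :: "nat list \<Rightarrow> (nat \<Rightarrow> nat \<Rightarrow> bool) \<Rightarrow> nat set \<Rightarrow> bool" where
  "is_copy a E S \<longleftrightarrow> (\<exists>f. bij_betw f {0..<sum_list a} S \<and>
     (\<forall>i<sum_list a. \<forall>j<sum_list a. complete_multipartite a i j \<longleftrightarrow> E (f i) (f j)))"

definition extremal :: "nat list \<Rightarrow> nat \<Rightarrow> (nat \<Rightarrow> nat \<Rightarrow> bool) \<Rightarrow> bool" where
  "extremal a n E \<longleftrightarrow> simple_graph n E \<and>
     induced_count (sum_list a) (complete_multipartite a) n E = max_induced (sum_list a) (complete_multipartite a) n"

lemma induced_count_eq_card_copies:
  "induced_count (sum_list a) (complete_multipartite a) n E = card {S. S \<subseteq> {0..<n} \<and> is_copy a E S}"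
proof -
  have "card S = sum_list a" if copy: "is_copy a E S" for S
  proof -
    obtain f where "bij_betw f {0..<sum_list a} S" using copy unfolding is_copy_def by blast
    from bij_betw_same_card[OF this] show ?thesis by simp
  qed
  then show ?thesis
    unfolding induced_count_def is_copy_def[symmetric] by (intro arg_cong[where f = card] Collect_cong conj_cong refl) auto
qed

lemma finite_induced_counts: "finite {induced_count k F n E | E. simple_graph n E}"
proof (rule finite_subset)
  show "{induced_count k F n E | E. simple_graph n E} \<subseteq> {..card (Pow {0..<n})}"
  proof clarify
    fix E
    show "induced_count k F n E \<le> card (Pow {0..<n})"
      unfolding induced_count_def by (rule card_mono) auto
  qed
qed simp

lemma induced_count_le_max: "simple_graph n E \<Longrightarrow> induced_count k F n E \<le> max_induced k F n"
  unfolding max_induced_def by (rule Max_ge[OF finite_induced_counts]) blast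

lemma ex_extremal: "\<exists>E. extremal a n E"
proof -
  have "simple_graph n (\<lambda>_ _. False)" by (simp add: simple_graph_def)
  then have "{induced_count (sum_list a) (complete_multipartite a) n E | E. simple_graph n E} \<noteq> {}" by blast
  from Max_in[OF finite_induced_counts this] show ?thesis
    unfolding extremal_def max_induced_def by fastforce
qed

lemma is_copy_cong:
  assumes "\<And>x y. x \<in> S \<Longrightarrow> y \<in> S \<Longrightarrow> E x y \<longleftrightarrow> E' (\<rho> x) (\<rho> y)" "inj_on \<rho> S"
  shows "is_copy a E S \<longleftrightarrow> is_copy a E' (\<rho> ` S)"
proof
  assume "is_copy a E S"
  then obtain f where f: "bij_betw f {0..<sum_list a} S"
    "\<forall>i<sum_list a. \<forall>j<sum_list a. complete_multipartite a i j \<longleftrightarrow> E (f i) (f j)"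
    unfolding is_copy_def by blast
  have fS: "f i \<in> S" if "i < sum_list a" for i using bij_betw_imp_surj_on[OF f(1)] that by auto
  have "bij_betw (\<rho> \<circ> f) {0..<sum_list a} (\<rho> ` S)"
    by (rule bij_betw_trans[OF f(1)]) (use assms(2) in \<open>simp add: bij_betw_def\<close>)
  then show "is_copy a E' (\<rho> ` S)"
    unfolding is_copy_def using f(2) fS assms(1) by (intro exI[of _ "\<rho> \<circ> f"]) simp
next
  assume "is_copy a E' (\<rho> ` S)"
  then obtain f where f: "bij_betw f {0..<sum_list a} (\<rho> ` S)"
    "\<forall>i<sum_list a. \<forall>j<sum_list a. complete_multipartite a i j \<longleftrightarrow> E' (f i) (f j)"
    unfolding is_copy_def by blast
  define g where "g = inv_into S \<rho> \<circ> f"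
  have fS: "f i \<in> \<rho> ` S" if "i < sum_list a" for i using bij_betw_imp_surj_on[OF f(1)] that by auto
  have "bij_betw g {0..<sum_list a} S"
    unfolding g_def by (rule bij_betw_trans[OF f(1)]) (use assms(2) in \<open>simp add: bij_betw_inv_into bij_betw_def inj_on_inv_into\<close>)
  moreover have "E (g i) (g j) \<longleftrightarrow> E' (f i) (f j)" if "i < sum_list a" "j < sum_list a" for i j
  proof -
    have g: "g i \<in> S" "g j \<in> S" "\<rho> (g i) = f i" "\<rho> (g j) = f j"
      using fS[OF that(1)] fS[OF that(2)] by (simp_all only: g_def inv_into_into f_inv_into_f o_apply)
    show ?thesis using assms(1)[OF g(1,2)] g(3,4) by simp
  qed
  ultimately show "is_copy a E S"
    unfolding is_copy_def using f(2) by (intro exI[of _ g]) simp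
qed

text \<open>In a copy of a complete multipartite graph non-adjacent vertices have the same neighbours.\<close>

lemma is_copy_clone:
  assumes "is_copy a E S" "u \<in> S" "v \<in> S" "\<not> E u v"
  shows "is_copy a (clone {v} u E) S"
proof -
  obtain f where f: "bij_betw f {0..<sum_list a} S"
    "\<And>i j. i<sum_list a \<Longrightarrow> j<sum_list a \<Longrightarrow> complete_multipartite a i j \<longleftrightarrow> E (f i) (f j)"
    using assms(1) unfolding is_copy_def by blast
  have S: "S = f ` {0..<sum_list a}" using bij_betw_imp_surj_on[OF f(1)] by simp
  obtain i j where ij: "i < sum_list a" "f i = u" "j < sum_list a" "f j = v" using assms(2,3) S by auto
  have p: "part_index a i = part_index a j"
    using f(2)[OF ij(1,3)] assms(4) ij by (simp add: complete_multipartite_def)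
  have same: "E (f k) u \<longleftrightarrow> E (f k) v" "E u (f k) \<longleftrightarrow> E v (f k)" if "k < sum_list a" for k
    using f(2)[OF that ij(1)] f(2)[OF that ij(3)] f(2)[OF ij(1) that] f(2)[OF ij(3) that] ij p
    by (auto simp: complete_multipartite_def)
  have "clone {v} u E x y \<longleftrightarrow> E x y" if xy: "x \<in> S" "y \<in> S" for x y
  proof -
    obtain k k' where k: "k < sum_list a" "x = f k" "k' < sum_list a" "y = f k'" using xy unfolding S by auto
    have "E u u \<longleftrightarrow> E v v" "E u v \<longleftrightarrow> E v v" "E v u \<longleftrightarrow> E v v"
      using same[OF ij(1)] same[OF ij(3)] ij by auto
    then show ?thesis using same[OF k(1)] same[OF k(3)] k by (auto simp: clone_def)
  qed
  then have "is_copy a E S \<longleftrightarrow> is_copy a (clone {v} u E) (id ` S)"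
    by (intro is_copy_cong) auto
  then show ?thesis using assms(1) by simp
qed

text \<open>Copies avoiding \<open>v\<close> are unaffected, copies through both vertices survive by
  \<open>is_copy_clone\<close>, and copies through \<open>v\<close> but not \<open>u\<close> are
  replaced by as many as formerly went through \<open>u\<close> but not \<open>v\<close>. Sums on
  both sides avoid subtraction of naturals.\<close>

lemma card_copies_clone:
  assumes "simple_graph n E" "u < n" "v < n" "u \<noteq> v" "\<not> E u v"
  shows "card {S. S \<subseteq> {0..<n} \<and> is_copy a E S} + card {S. S \<subseteq> {0..<n} \<and> is_copy a E S \<and> u \<in> S \<and> v \<notin> S}
     \<le> card {S. S \<subseteq> {0..<n} \<and> is_copy a (clone {v} u E) S} + card {S. S \<subseteq> {0..<n} \<and> is_copy a E S \<and> v \<in> S \<and> u \<notin> S}"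
proof -
  let ?V = "{0..<n}" and ?E' = "clone {v} u E"
  have fin: "finite {S. S \<subseteq> ?V \<and> P S}" for P by (rule finite_subset[of _ "Pow ?V"]) auto
  have split: "card {S. S \<subseteq> ?V \<and> is_copy a G S} = card {S. S \<subseteq> ?V \<and> is_copy a G S \<and> v \<notin> S}
     + (card {S. S \<subseteq> ?V \<and> is_copy a G S \<and> u \<in> S \<and> v \<in> S} + card {S. S \<subseteq> ?V \<and> is_copy a G S \<and> v \<in> S \<and> u \<notin> S})" for G
  proof -
    have "{S. S \<subseteq> ?V \<and> is_copy a G S} = {S. S \<subseteq> ?V \<and> is_copy a G S \<and> v \<notin> S}
      \<union> ({S. S \<subseteq> ?V \<and> is_copy a G S \<and> u \<in> S \<and> v \<in> S} \<union> {S. S \<subseteq> ?V \<and> is_copy a G S \<and> v \<in> S \<and> u \<notin> S})"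
      by blast
    then show ?thesis by (simp only:) (subst card_Un_disjoint, (use fin in auto)[3], subst card_Un_disjoint, (use fin in auto))
  qed
  have "is_copy a ?E' S \<longleftrightarrow> is_copy a E S" if "v \<notin> S" for S
  proof -
    have "?E' x y \<longleftrightarrow> E (id x) (id y)" if "x \<in> S" "y \<in> S" for x y
      using that \<open>v \<notin> S\<close> by (auto simp: clone_def)
    then have "is_copy a ?E' S \<longleftrightarrow> is_copy a E (id ` S)" by (rule is_copy_cong) auto
    then show ?thesis by simp
  qed
  then have 1: "{S. S \<subseteq> ?V \<and> is_copy a ?E' S \<and> v \<notin> S} = {S. S \<subseteq> ?V \<and> is_copy a E S \<and> v \<notin> S}" by blast
  have 2: "card {S. S \<subseteq> ?V \<and> is_copy a E S \<and> u \<in> S \<and> v \<in> S} \<le> card {S. S \<subseteq> ?V \<and> is_copy a ?E' S \<and> u \<in> S \<and> v \<in> S}"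
    by (rule card_mono[OF fin], rule Collect_mono) (use is_copy_clone assms(5) in blast)
  define \<rho> where "\<rho> x = (if x = v then u else x)" for x
  have \<rho>: "is_copy a ?E' S \<longleftrightarrow> is_copy a E (\<rho> ` S)" if "u \<notin> S" for S
    using that by (intro is_copy_cong) (auto simp: clone_def \<rho>_def inj_on_def)
  have 3: "card {S. S \<subseteq> ?V \<and> is_copy a ?E' S \<and> v \<in> S \<and> u \<notin> S} = card {S. S \<subseteq> ?V \<and> is_copy a E S \<and> u \<in> S \<and> v \<notin> S}"
  proof (rule bij_betw_same_card[of "\<lambda>S. \<rho> ` S"], rule bij_betw_byWitness[where f' = "\<lambda>S. insert v (S - {u})"])
    have im: "\<rho> ` S = insert u (S - {v})" if "v \<in> S" for S using that by (auto simp: \<rho>_def)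
    have im2: "\<rho> ` insert v (S - {u}) = S" if "u \<in> S" "v \<notin> S" for S
    proof -
      have "\<rho> ` (S - {u}) = S - {u}" using that by (intro image_cong[where g = id, simplified]) (auto simp: \<rho>_def)
      then show ?thesis using that by (auto simp: \<rho>_def[of v])
    qed
    show "\<forall>S\<in>{S. S \<subseteq> ?V \<and> is_copy a ?E' S \<and> v \<in> S \<and> u \<notin> S}. insert v (\<rho> ` S - {u}) = S"
      by (auto simp: im)
    show "\<forall>S\<in>{S. S \<subseteq> ?V \<and> is_copy a E S \<and> u \<in> S \<and> v \<notin> S}. \<rho> ` insert v (S - {u}) = S"
      using im2 by blast
    show "(`) \<rho> ` {S. S \<subseteq> ?V \<and> is_copy a ?E' S \<and> v \<in> S \<and> u \<notin> S} \<subseteq> {S. S \<subseteq> ?V \<and> is_copy a E S \<and> u \<in> S \<and> v \<notin> S}"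
    proof clarify
      fix S assume S: "S \<subseteq> ?V" "is_copy a ?E' S" "v \<in> S" "u \<notin> S"
      then have "is_copy a E (\<rho> ` S)" using \<rho> by simp
      then show "\<rho> ` S \<subseteq> ?V \<and> is_copy a E (\<rho> ` S) \<and> u \<in> \<rho> ` S \<and> v \<notin> \<rho> ` S"
        using S assms(2,4) by (auto simp: im)
    qed
    show "(\<lambda>S. insert v (S - {u})) ` {S. S \<subseteq> ?V \<and> is_copy a E S \<and> u \<in> S \<and> v \<notin> S}
       \<subseteq> {S. S \<subseteq> ?V \<and> is_copy a ?E' S \<and> v \<in> S \<and> u \<notin> S}"
    proof clarify
      fix S assume S: "S \<subseteq> ?V" "is_copy a E S" "u \<in> S" "v \<notin> S"
      have "\<rho> ` insert v (S - {u}) = S" using S by (intro im2)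
      then have "is_copy a ?E' (insert v (S - {u}))" using S \<rho>[of "insert v (S - {u})"] assms(4) by simp
      then show "insert v (S - {u}) \<subseteq> ?V \<and> is_copy a ?E' (insert v (S - {u})) \<and> v \<in> insert v (S - {u}) \<and> u \<notin> insert v (S - {u})"
        using S assms(3,4) by auto
    qed
  qed
  show ?thesis unfolding split[of E] split[of ?E'] 1 3 using 2 by linarith
qed

lemma simple_graphD:
  assumes "simple_graph n E" "E x y"
  shows "x < n" "y < n" "x \<noteq> y" "E y x"
  using assms unfolding simple_graph_def by blast+

lemma simple_graph_irrefl: "simple_graph n E \<Longrightarrow> \<not> E x x"
  using simple_graphD(3) by blast

lemma simple_graph_sym: "simple_graph n E \<Longrightarrow> E x y \<longleftrightarrow> E y x"
  using simple_graphD(4) by blast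

lemma simple_graph_clone:
  assumes "simple_graph n E" "X \<subseteq> {0..<n}"
  shows "simple_graph n (clone X u E)"
  unfolding simple_graph_def
proof (intro conjI allI impI)
  fix x y assume "clone X u E x y"
  then have *: "E (if x \<in> X then u else x) (if y \<in> X then u else y)" by (simp only: clone_def)
  have X: "x < n" if "x \<in> X" for x using that assms(2) by auto
  show "x < n" using simple_graphD(1)[OF assms(1) *] X[of x] by (cases "x \<in> X") simp_all
  show "y < n" using simple_graphD(2)[OF assms(1) *] X[of y] by (cases "y \<in> X") simp_all
  show "x \<noteq> y" using simple_graphD(3)[OF assms(1) *] by blast
  show "clone X u E y x" unfolding clone_def by (rule simple_graphD(4)[OF assms(1) *])
qed

text \<open>\<open>card_copies_clone\<close> is applied in both directions. As neither clone can
  beat \<open>E\<close>, equally many copies pass through \<open>u\<close> alone and through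
  \<open>v\<close> alone, and so nothing is lost.\<close>

lemma extremal_clone_single:
  assumes "extremal a n E" "u < n" "v < n" "u \<noteq> v" "\<not> E u v"
  shows "extremal a n (clone {v} u E)"
proof -
  let ?N = "\<lambda>E. card {S. S \<subseteq> {0..<n} \<and> is_copy a E S}"
  have sg: "simple_graph n E" using assms by (simp add: extremal_def)
  then have "\<not> E v u" using assms(5) simple_graphD(4) by blast
  have max: "?N G \<le> ?N E" if "simple_graph n G" for G
    using induced_count_le_max[OF that, of "sum_list a" "complete_multipartite a"] assms(1)
    by (simp add: extremal_def induced_count_eq_card_copies)
  have "?N (clone {v} u E) \<le> ?N E" "?N (clone {u} v E) \<le> ?N E"
    using sg assms(2,3) by (intro max simple_graph_clone; simp)+
  then have "?N (clone {v} u E) = ?N E"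
    using card_copies_clone[OF sg assms(2-5), of a] card_copies_clone[OF sg assms(3,2) assms(4)[symmetric] \<open>\<not> E v u\<close>, of a]
    by linarith
  moreover have "simple_graph n (clone {v} u E)" using sg assms(3) by (intro simple_graph_clone) simp_all
  ultimately show ?thesis using assms(1) by (simp add: extremal_def induced_count_eq_card_copies)
qed

lemma extremal_clone:
  assumes "extremal a n E" "u < n" "X \<subseteq> {0..<n}" "u \<notin> X" "\<And>x. x \<in> X \<Longrightarrow> \<not> E u x"
  shows "extremal a n (clone X u E)"
proof -
  have "finite X" using assms(3) finite_subset by blast
  then show ?thesis using assms(3-5)
  proof (induction X rule: finite_induct)
    case empty
    have "clone {} u E = E" by (simp add: clone_def fun_eq_iff)
    then show ?case using assms(1) by simp
  next
    case (insert x X)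
    have "extremal a n (clone {x} u (clone X u E))"
    proof (intro extremal_clone_single insert.IH)
      show "\<not> clone X u E u x" using insert.prems insert.hyps by (simp add: clone_def)
    qed (use insert.prems assms(2) in auto)
    moreover have "clone {x} u (clone X u E) = clone (insert x X) u E"
      using insert.prems by (auto simp: clone_def fun_eq_iff)
    ultimately show ?case by simp
  qed
qed

section \<open>Twin classes and complete multipartite extremal graphs\<close>

definition nbh :: "(nat \<Rightarrow> nat \<Rightarrow> bool) \<Rightarrow> nat \<Rightarrow> nat set" where
  "nbh E x = {w. E x w}"

text \<open>The twin classes serve as colour classes; adjacent vertices are not twins, as the graph
  has no loops.\<close>

lemma multipartite_if_twins:
  assumes "simple_graph n E" "\<And>u v. u < n \<Longrightarrow> v < n \<Longrightarrow> \<not> E u v \<Longrightarrow> nbh E u = nbh E v"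
  shows "\<exists>c. multipartite n E c"
proof -
  define c where "c x = (LEAST y. nbh E y = nbh E x)" for x
  have c: "nbh E (c x) = nbh E x" for x unfolding c_def by (rule LeastI) (rule refl)
  have eq: "c x = c y \<longleftrightarrow> nbh E x = nbh E y" for x y
  proof
    show "c x = c y" if "nbh E x = nbh E y" using that by (simp add: c_def)
    show "nbh E x = nbh E y" if "c x = c y" using that c[of x] c[of y] by simp
  qed
  have E: "E x y \<longleftrightarrow> nbh E x \<noteq> nbh E y" if "x < n" "y < n" for x y
  proof (cases "E x y")
    case True
    then have "y \<in> nbh E x" "y \<notin> nbh E y" using simple_graph_irrefl[OF assms(1)] by (simp_all add: nbh_def)
    then have "nbh E x \<noteq> nbh E y" by metis
    then show ?thesis using True by simp
  next
    case False
    then show ?thesis using assms(2)[OF that] by simp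
  qed
  have "multipartite n E c" unfolding multipartite_def using E eq by simp
  then show ?thesis by blast
qed

text \<open>The whole class of \<open>v\<close> is replaced, so its neighbourhood disappears. Every
  new neighbourhood is the preimage, under \<open>W\<close> being sent to \<open>u\<close>, of an
  old one other than that of \<open>v\<close>, so no additional classes arise.\<close>

lemma twin_class_clone:
  assumes "simple_graph n E" "u < n" "v < n" "\<not> E u v" "nbh E u \<noteq> nbh E v"
  defines "W \<equiv> {x\<in>{0..<n}. nbh E x = nbh E v}"
  shows "u \<notin> W" "v \<in> W" "\<And>x. x \<in> W \<Longrightarrow> \<not> E u x"
    "card (nbh (clone W u E) ` {0..<n}) < card (nbh E ` {0..<n})"
proof -
  show u: "u \<notin> W" and v: "v \<in> W" using assms by (auto simp: W_def)
  show "\<not> E u x" if "x \<in> W" for x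
  proof -
    have "E x u \<longleftrightarrow> E v u" using that by (auto simp: W_def nbh_def)
    then show ?thesis using assms(4) simple_graph_sym[OF assms(1)] by blast
  qed
  define \<rho> where "\<rho> x = (if x \<in> W then u else x)" for x
  have "nbh (clone W u E) ` {0..<n} \<subseteq> (\<lambda>S. {w. \<rho> w \<in> S}) ` (nbh E ` {0..<n} - {nbh E v})"
  proof clarify
    fix x assume x: "x \<in> {0..<n}"
    have "nbh (clone W u E) x = {w. \<rho> w \<in> nbh E (\<rho> x)}" by (simp add: nbh_def clone_def \<rho>_def)
    moreover have "\<rho> x \<in> {0..<n}" "nbh E (\<rho> x) \<noteq> nbh E v"
      using x assms(2,5) by (simp_all add: \<rho>_def W_def)
    then have "nbh E (\<rho> x) \<in> nbh E ` {0..<n} - {nbh E v}" by simp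
    ultimately show "nbh (clone W u E) x \<in> (\<lambda>S. {w. \<rho> w \<in> S}) ` (nbh E ` {0..<n} - {nbh E v})" by blast
  qed
  then have "card (nbh (clone W u E) ` {0..<n}) \<le> card ((\<lambda>S. {w. \<rho> w \<in> S}) ` (nbh E ` {0..<n} - {nbh E v}))"
    by (rule card_mono[rotated]) simp
  also have "\<dots> \<le> card (nbh E ` {0..<n} - {nbh E v})" by (rule card_image_le) simp
  also have "\<dots> < card (nbh E ` {0..<n})"
    using assms(3) by (intro psubset_card_mono) auto
  finally show "card (nbh (clone W u E) ` {0..<n}) < card (nbh E ` {0..<n})" .
qed

lemma ex_extremal_multipartite: "\<exists>E c. extremal a n E \<and> multipartite n E c"
proof -
  obtain E where E: "extremal a n E" "\<And>G. extremal a n G \<Longrightarrow> card (nbh E ` {0..<n}) \<le> card (nbh G ` {0..<n})"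
  proof -
    obtain E0 where "extremal a n E0" using ex_extremal by blast
    from ex_has_least_nat[of "extremal a n", OF this, of "\<lambda>E. card (nbh E ` {0..<n})"] that show thesis by blast
  qed
  have "nbh E u = nbh E v" if uv: "u < n" "v < n" "\<not> E u v" for u v
  proof (rule ccontr)
    assume ne: "nbh E u \<noteq> nbh E v"
    define W where "W = {x\<in>{0..<n}. nbh E x = nbh E v}"
    have sg: "simple_graph n E" using E(1) by (simp add: extremal_def)
    note W = twin_class_clone[OF sg uv ne, folded W_def]
    have "extremal a n (clone W u E)"
      using E(1) uv(1) W(1,3) by (intro extremal_clone) (auto simp: W_def)
    from E(2)[OF this] W(4) show False by simp
  qed
  then have "\<exists>c. multipartite n E c" using E(1) by (intro multipartite_if_twins) (auto simp: extremal_def)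
  with E(1) show ?thesis by blast
qed

text \<open>Replacing all non-neighbours of \<open>v\<close> by clones of \<open>v\<close> yields a complete multipartite extremal graph, whose
  parts are the new class of \<open>v\<close> and the colour classes in its neighbourhood.\<close>

lemma card_colours_nbh:
  fixes c :: "nat \<Rightarrow> nat"
  assumes ext: "extremal a n H" and m: "\<And>E c. extremal a n E \<Longrightarrow> multipartite n E c \<Longrightarrow> card (c ` {0..<n}) = m"
    and v: "v \<in> W" "v < n" "\<And>w. w \<in> W \<Longrightarrow> \<not> H v w"
    and c: "\<And>x y. x < n \<Longrightarrow> y < n \<Longrightarrow> x \<notin> W \<Longrightarrow> y \<notin> W \<Longrightarrow> H x y \<longleftrightarrow> c x \<noteq> c y"
  shows "Suc (card (c ` nbh H v)) = m"
proof -
  have sg: "simple_graph n H" using ext by (simp add: extremal_def)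
  then have nb: "nbh H v \<subseteq> {0..<n}" "v \<notin> nbh H v" and sym: "H x y \<longleftrightarrow> H y x" for x y
    using simple_graphD(2)[OF sg] simple_graph_irrefl[OF sg] simple_graph_sym[OF sg, of x y] by (auto simp: nbh_def)
  define X where "X = {x\<in>{0..<n}. x \<noteq> v \<and> \<not> H v x}"
  \<comment> \<open>A colour not seen by \<open>v\<close>, used for \<open>v\<close> and its clones;
    the inserted 0 covers an empty neighbourhood.\<close>
  define q where "q = Suc (Max (insert 0 (c ` nbh H v)))"
  define c' where "c' x = (if x \<in> nbh H v then c x else q)" for x
  have fin: "finite (c ` nbh H v)" using nb finite_subset by blast
  have q: "q \<notin> c ` nbh H v"
  proof
    assume "q \<in> c ` nbh H v"
    then have "q \<le> Max (insert 0 (c ` nbh H v))" using fin by (intro Max_ge) auto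
    then show False by (simp add: q_def)
  qed
  have "extremal a n (clone X v H)"
    using ext v(2) by (intro extremal_clone) (auto simp: X_def)
  moreover have "multipartite n (clone X v H) c'"
    unfolding multipartite_def
  proof (intro allI impI)
    fix x y assume xy: "x < n" "y < n"
    have X: "x \<in> nbh H v \<or> (if x \<in> X then v else x) = v" if "x < n" for x
      using that by (auto simp: nbh_def X_def)
    have NX: "x \<in> nbh H v \<Longrightarrow> x \<notin> X \<and> x \<notin> W" for x
      using v(3) by (auto simp: nbh_def X_def)
    show "clone X v H x y \<longleftrightarrow> c' x \<noteq> c' y"
    proof (cases "x \<in> nbh H v"; cases "y \<in> nbh H v")
      assume a: "x \<in> nbh H v" "y \<in> nbh H v"
      then show ?thesis using NX[OF a(1)] NX[OF a(2)] c[OF xy] by (simp add: clone_def c'_def)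
    next
      assume a: "x \<in> nbh H v" "y \<notin> nbh H v"
      then have "(if y \<in> X then v else y) = v" using X[OF xy(2)] by blast
      then show ?thesis using NX[OF a(1)] a q sym[of x v] by (auto simp: clone_def c'_def nbh_def)
    next
      assume a: "x \<notin> nbh H v" "y \<in> nbh H v"
      then have "(if x \<in> X then v else x) = v" using X[OF xy(1)] by blast
      then show ?thesis using NX[OF a(2)] a q by (auto simp: clone_def c'_def nbh_def)
    next
      assume a: "x \<notin> nbh H v" "y \<notin> nbh H v"
      then have "(if x \<in> X then v else x) = v" "(if y \<in> X then v else y) = v" using X xy by blast+
      then show ?thesis using a nb(2) by (simp add: clone_def c'_def nbh_def)
    qed
  qed
  ultimately have "card (c' ` {0..<n}) = m" by (rule m)
  also have "c' ` {0..<n} = insert q (c ` nbh H v)"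
    using nb v(2) by (auto simp: c'_def image_iff)
  finally show ?thesis using fin q by simp
qed

text \<open>Among counterexamples take \<open>H\<close> with the fewest twin classes. Replacing the
  class \<open>W\<close> of \<open>v\<close> by clones of a non-neighbour gives fewer classes, hence
  a complete multipartite graph, and its colouring \<open>c\<close> describes \<open>H\<close>
  outside \<open>W\<close>. It remains to show that outside \<open>W\<close> the vertex
  \<open>v\<close> misses exactly one colour class.\<close>

lemma extremal_multipartite:
  assumes m: "\<And>E c. extremal a n E \<Longrightarrow> multipartite n E c \<Longrightarrow> card (c ` {0..<n}) = m"
    and "extremal a n E"
  shows "\<exists>c. multipartite n E c"
proof (rule ccontr)
  assume no: "\<not> ?thesis"
  let ?P = "\<lambda>E. extremal a n E \<and> \<not> (\<exists>c. multipartite n E c)"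
  obtain H where H: "?P H" "\<And>G. ?P G \<Longrightarrow> card (nbh H ` {0..<n}) \<le> card (nbh G ` {0..<n})"
    using ex_has_least_nat[of ?P E "\<lambda>E. card (nbh E ` {0..<n})"] no assms(2) by blast
  have sg: "simple_graph n H" using H(1) by (simp add: extremal_def)
  obtain u v where uv: "u < n" "v < n" "\<not> H u v" "nbh H u \<noteq> nbh H v"
    using multipartite_if_twins[OF sg] H(1) by blast
  define W where "W = {x\<in>{0..<n}. nbh H x = nbh H v}"
  note W = twin_class_clone[OF sg uv, folded W_def]
  have ext': "extremal a n (clone W u H)"
    using H(1) uv(1) W(1,3) by (intro extremal_clone) (auto simp: W_def)
  then obtain c where c: "multipartite n (clone W u H) c" using H(2)[of "clone W u H"] W(4) by force
  have cc: "H x y \<longleftrightarrow> c x \<noteq> c y" if "x < n" "y < n" "x \<notin> W" "y \<notin> W" for x y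
  proof -
    have "clone W u H x y \<longleftrightarrow> c x \<noteq> c y" using c that(1,2) by (simp add: multipartite_def)
    then show ?thesis using that(3,4) by (simp add: clone_def)
  qed
  have sym: "H x y \<longleftrightarrow> H y x" for x y using sg by (rule simple_graph_sym)
  have nv: "nbh H v \<subseteq> {0..<n}" using simple_graphD(2)[OF sg] by (auto simp: nbh_def)
  have irr: "\<not> H x x" for x using sg by (rule simple_graph_irrefl)
  have Wv: "H w y \<longleftrightarrow> H v y" if "w \<in> W" for w y using that by (auto simp: W_def nbh_def)
  have vW: "\<not> H v w" if "w \<in> W" for w using Wv[OF that, of w] irr by simp
  have fin: "finite (c ` nbh H v)" using nv finite_subset by blast
  have cW: "c w = c u" if "w \<in> W" for w
  proof -
    have "w < n" using that by (simp add: W_def)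
    then have "clone W u H w u \<longleftrightarrow> c w \<noteq> c u" using c uv(1) by (simp add: multipartite_def)
    then show ?thesis using that W(1) irr by (simp add: clone_def)
  qed
  have card_all: "card (c ` {0..<n}) = m" by (rule m[OF ext' c])
  have card_nb: "Suc (card (c ` nbh H v)) = m"
  proof (rule card_colours_nbh)
    show "extremal a n H" using H(1) by blast
    show "v \<in> W" "v < n" by (fact W(2) uv(2))+
  qed (fact m vW cc)+
  \<comment> \<open>If a colour class met both the neighbourhood of \<open>v\<close> and its
    complement outside \<open>W\<close>, replacing its members adjacent to \<open>v\<close> by
    clones of \<open>x\<close> would keep the graph extremal while \<open>v\<close> loses one
    colour. But \<open>card_colours_nbh\<close> forces \<open>m - 1\<close> colours before and
    after.\<close>
  have pure: "c x \<noteq> c w" if x: "x < n" "x \<notin> W" "x \<notin> nbh H v" and w: "w \<in> nbh H v" for x w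
  proof
    assume eq: "c x = c w"
    define Z where "Z = {y \<in> nbh H v. c y = c x}"
    have Z: "Z \<subseteq> {0..<n}" "x \<notin> Z" "Z \<inter> W = {}" "v \<notin> Z"
      using nv x vW irr by (auto simp: Z_def nbh_def)
    have ext2: "extremal a n (clone Z x H)"
    proof (rule extremal_clone[OF _ x(1) Z(1,2)])
      fix y assume "y \<in> Z"
      then have "y < n" "y \<notin> W" "c y = c x" using Z(1,3) by (auto simp: Z_def)
      then show "\<not> H x y" using cc[OF x(1) _ x(2), of y] by simp
    qed (use H in blast)
    have nb2: "nbh (clone Z x H) v = nbh H v - Z"
      using Z(4) x(3) by (auto simp: nbh_def clone_def Z_def)
    have "Suc (card (c ` nbh (clone Z x H) v)) = m"
    proof (rule card_colours_nbh)
      show "extremal a n (clone Z x H)" "v \<in> W" "v < n" by (fact ext2 W(2) uv(2))+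
      show "\<not> clone Z x H v w" if "w \<in> W" for w
        using that Z vW by (auto simp: clone_def)
      show "clone Z x H p q \<longleftrightarrow> c p \<noteq> c q" if "p < n" "q < n" "p \<notin> W" "q \<notin> W" for p q
        using that cc x by (auto simp: clone_def Z_def)
    qed (fact m)
    moreover have "c ` (nbh H v - Z) = c ` nbh H v - {c x}" by (auto simp: Z_def)
    moreover have "c x \<in> c ` nbh H v" using eq w by auto
    ultimately show False using card_nb fin nb2 by (metis card_Suc_Diff1 n_not_Suc_n)
  qed
  \<comment> \<open>All of \<open>c\<close> has \<open>m\<close> colours and \<open>v\<close> sees
    \<open>m - 1\<close> of them, so one colour \<open>t\<close> is left.\<close>
  have "c ` nbh H v \<subseteq> c ` {0..<n}" using nv by blast
  then have "card (c ` {0..<n} - c ` nbh H v) = 1"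
    using card_all card_nb fin by (simp add: card_Diff_subset)
  then obtain t where t: "c ` {0..<n} - c ` nbh H v = {t}" by (meson card_1_singletonE)
  have nbt: "y \<in> nbh H v \<longleftrightarrow> c y \<noteq> t" if "y < n" "y \<notin> W" for y
  proof
    show "c y \<noteq> t" if "y \<in> nbh H v" using that t by blast
    show "y \<in> nbh H v" if "c y \<noteq> t"
    proof (rule ccontr)
      assume "y \<notin> nbh H v"
      have "c y \<in> c ` nbh H v" using that t \<open>y < n\<close> by (metis DiffI atLeastLessThan_iff imageI singletonD zero_le)
      then show False using pure[OF \<open>y < n\<close> \<open>y \<notin> W\<close> \<open>y \<notin> nbh H v\<close>] by auto
    qed
  qed
  \<comment> \<open>\<open>W\<close> joins the one class that \<open>v\<close> does not see.\<close>
  have "multipartite n H (\<lambda>x. if x \<in> W then t else c x)"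
    unfolding multipartite_def
  proof (intro allI impI)
    fix x y assume xy: "x < n" "y < n"
    consider "x \<in> W" "y \<in> W" | "x \<in> W" "y \<notin> W" | "x \<notin> W" "y \<in> W" | "x \<notin> W" "y \<notin> W" by blast
    then show "H x y \<longleftrightarrow> (if x \<in> W then t else c x) \<noteq> (if y \<in> W then t else c y)"
    proof cases
      case 1 then show ?thesis using Wv[of x y] vW[of y] by simp
    next
      case 2 then show ?thesis using Wv[of x y] nbt[OF xy(2)] by (auto simp: nbh_def)
    next
      case 3 then show ?thesis using Wv[of y x] sym[of x y] nbt[OF xy(1)] by (auto simp: nbh_def)
    next
      case 4 then show ?thesis using cc[OF xy] by simp
    qed
  qed
  then show False using H(1) by blast
qed

section \<open>The optimal number of parts\<close>

context
  fixes r l :: nat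
  assumes r2: "2 \<le> r" and lr: "r + 1 \<le> l"
begin

lemma f_rl_pos: "r \<le> k \<Longrightarrow> 0 < f_rl r l k"
  unfolding f_rl_def using r2 by (intro divide_pos_pos prod_pos zero_less_power) auto

lemma f_rl_le_inverse:
  assumes "r \<le> k"
  shows "f_rl r l k \<le> 1 / real k"
proof -
  have "(\<Prod>i\<in>{1..<r}. real k - real i) \<le> (\<Prod>i\<in>{1..<r}. real k)"
    using assms by (intro prod_mono) auto
  also have "\<dots> = real k ^ (r - 1)" by simp
  finally have "f_rl r l k \<le> real k ^ (r - 1) / real k ^ (l - 1)"
    unfolding f_rl_def by (intro divide_right_mono) auto
  also have "real k ^ (l - 1) = real k ^ (r - 1) * real k ^ (l - r)"
    using lr r2 by (simp add: power_add[symmetric])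
  also have "real k ^ (r - 1) / (real k ^ (r - 1) * real k ^ (l - r)) = 1 / real k ^ (l - r)"
    using assms r2 by simp
  also have "\<dots> \<le> 1 / real k ^ 1"
    using assms r2 lr by (intro divide_left_mono power_increasing) auto
  finally show ?thesis by simp
qed

lemma f_rl_has_maximiser: "\<exists>k\<ge>r. \<forall>j\<ge>r. f_rl r l j \<le> f_rl r l k"
proof -
  \<comment> \<open>Beyond \<open>K\<close> the bound \<open>1 / k\<close> is already below the
    value at \<open>r\<close>, so the maximum can be sought in a finite range.\<close>
  define K where "K = nat \<lceil>1 / f_rl r l r\<rceil> + r"
  have "Max (f_rl r l ` {r..K}) \<in> f_rl r l ` {r..K}" by (rule Max_in) (auto simp: K_def)
  then obtain k where k: "k \<in> {r..K}" "Max (f_rl r l ` {r..K}) = f_rl r l k" by auto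
  have le: "f_rl r l j \<le> f_rl r l k" if "j \<in> {r..K}" for j
    unfolding k(2)[symmetric] using that by (intro Max_ge) auto
  have "f_rl r l j \<le> f_rl r l k" if "r \<le> j" for j
  proof (cases "j \<le> K")
    case False
    have p: "0 < f_rl r l r" by (rule f_rl_pos) simp
    have "1 / f_rl r l r \<le> real j" using False unfolding K_def by linarith
    then have "1 / real j \<le> f_rl r l r" using p that r2 by (simp add: field_simps)
    then show ?thesis using f_rl_le_inverse[OF that] le[of r] by (simp add: K_def)
  qed (use le that in auto)
  then show ?thesis using k(1) by auto
qed

text \<open>In terms of 1/k the function is a positive power times factors that are affine in 1/k.
  Each logarithm is therefore concave in 1/k, the first one strictly.\<close>

lemma ln_f_rl:
  assumes "r \<le> k"
  shows "ln (f_rl r l k) = real (l - r) * ln (1 / real k) + (\<Sum>i\<in>{1..<r}. ln (1 - real i / real k))"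
proof -
  have k: "0 < real k" using assms r2 by simp
  have "(\<Prod>i\<in>{1..<r}. real k - real i) = (\<Prod>i\<in>{1..<r}. real k * (1 - real i / real k))"
    using k by (intro prod.cong) (auto simp: right_diff_distrib)
  also have "\<dots> = real k ^ (r - 1) * (\<Prod>i\<in>{1..<r}. 1 - real i / real k)"
    by (simp add: prod.distrib)
  finally have "f_rl r l k = (real k ^ (r - 1) / real k ^ (l - 1)) * (\<Prod>i\<in>{1..<r}. 1 - real i / real k)"
    by (simp add: f_rl_def)
  also have "real k ^ (l - 1) = real k ^ (r - 1) * real k ^ (l - r)"
    using lr r2 by (simp add: power_add[symmetric])
  also have "real k ^ (r - 1) / (real k ^ (r - 1) * real k ^ (l - r)) = (1 / real k) ^ (l - r)"
    using k by (simp add: power_one_over)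
  finally have "f_rl r l k = (1 / real k) ^ (l - r) * (\<Prod>i\<in>{1..<r}. 1 - real i / real k)" .
  moreover have pos: "\<forall>i\<in>{1..<r}. 0 < 1 - real i / real k" using assms k by (auto simp: divide_less_eq)
  then have "0 < (\<Prod>i\<in>{1..<r}. 1 - real i / real k)" by (intro prod_pos) auto
  moreover have "ln (\<Prod>i\<in>{1..<r}. 1 - real i / real k) = (\<Sum>i\<in>{1..<r}. ln (1 - real i / real k))"
    using pos by (intro ln_prod) auto
  moreover have "0 < (1 / real k) ^ (l - r)" using k by simp
  ultimately show ?thesis using k by (simp only: ln_mult_pos ln_realpow zero_less_divide_1_iff)
qed

text \<open>In the variable \<open>1 / k\<close> the function is strictly log-concave: the logarithm lies strictly
  below its tangent at \<open>1 / j\<close>.\<close>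

lemma ln_f_rl_less_tangent:
  assumes "r \<le> k" "r \<le> j" "k \<noteq> j"
  shows "ln (f_rl r l k) - ln (f_rl r l j)
    < (1 / real k - 1 / real j) * (real (l - r) * real j - (\<Sum>i\<in>{1..<r}. real i / (1 - real i / real j)))"
proof -
  have pos: "0 < real k" "0 < real j" using assms r2 by auto
  have "ln (real j / real k) \<noteq> real j / real k - 1"
    using ln_eq_minus_one[of "real j / real k"] pos assms(3) by auto
  then have "ln (real j / real k) < real j / real k - 1"
    using ln_le_minus_one[of "real j / real k"] pos by auto
  moreover have "ln (real j / real k) = ln (1 / real k) - ln (1 / real j)" using pos by (simp add: ln_div)
  moreover have "real j / real k - 1 = (1 / real k - 1 / real j) * real j" using pos by (simp add: field_simps)
  ultimately have "ln (1 / real k) - ln (1 / real j) < (1 / real k - 1 / real j) * real j" by simp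
  then have 1: "real (l - r) * (ln (1 / real k) - ln (1 / real j)) < real (l - r) * ((1 / real k - 1 / real j) * real j)"
    using lr by (intro mult_strict_left_mono) auto
  have 2: "(\<Sum>i\<in>{1..<r}. ln (1 - real i / real k) - ln (1 - real i / real j))
      \<le> (\<Sum>i\<in>{1..<r}. - ((1 / real k - 1 / real j) * (real i / (1 - real i / real j))))"
  proof (rule sum_mono)
    fix i assume "i \<in> {1..<r}"
    then have p: "0 < 1 - real i / real k" "0 < 1 - real i / real j" using assms pos by (auto simp: divide_less_eq)
    have self: "(1 - real i / real j) / (1 - real i / real j) = 1" using p(2) by (intro divide_self) linarith
    have "ln (1 - real i / real k) - ln (1 - real i / real j) = ln ((1 - real i / real k) / (1 - real i / real j))"
      using p by (intro ln_divide_pos[symmetric])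
    also have "\<dots> \<le> (1 - real i / real k) / (1 - real i / real j) - 1"
      using p by (intro ln_le_minus_one divide_pos_pos)
    also have "\<dots> = ((1 - real i / real k) - (1 - real i / real j)) / (1 - real i / real j)"
      by (subst diff_divide_distrib[of "1 - real i / real k"]) (simp only: self)
    also have "\<dots> = - ((1 / real k - 1 / real j) * (real i / (1 - real i / real j)))"
      by (simp add: left_diff_distrib diff_divide_distrib)
    finally show "ln (1 - real i / real k) - ln (1 - real i / real j) \<le> - ((1 / real k - 1 / real j) * (real i / (1 - real i / real j)))" .
  qed
  have "ln (f_rl r l k) - ln (f_rl r l j) = real (l - r) * (ln (1 / real k) - ln (1 / real j))
     + (\<Sum>i\<in>{1..<r}. ln (1 - real i / real k) - ln (1 - real i / real j))"
    unfolding ln_f_rl[OF assms(1)] ln_f_rl[OF assms(2)] sum_subtractf right_diff_distrib by simp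
  also have "\<dots> < real (l - r) * ((1 / real k - 1 / real j) * real j)
     + (\<Sum>i\<in>{1..<r}. - ((1 / real k - 1 / real j) * (real i / (1 - real i / real j))))"
    using 1 2 by (rule add_less_le_mono)
  also have "\<dots> = (1 / real k - 1 / real j) * (real (l - r) * real j - (\<Sum>i\<in>{1..<r}. real i / (1 - real i / real j)))"
    unfolding sum_negf sum_distrib_left[symmetric] by (simp only: right_diff_distrib mult_ac)
  finally show ?thesis .
qed

text \<open>Concavity does not exclude a tie between consecutive integers, but divisibility does: a
  tie would give k^l = (k-r+1) (k+1)^(l-1), while \<open>k\<close> and \<open>k + 1\<close> are
  coprime.\<close>

lemma f_rl_Suc_neq:
  assumes "r \<le> k"
  shows "f_rl r l (Suc k) \<noteq> f_rl r l k"
proof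
  assume eq: "f_rl r l (Suc k) = f_rl r l k"
  obtain s where s: "r = Suc (Suc s)" using r2 by (metis add_2_eq_Suc le_add_diff_inverse)
  define P where "P = (\<Prod>i\<in>{1..<Suc s}. real k - real i)"
  have P: "0 < P" unfolding P_def using assms s by (intro prod_pos) auto
  have a: "(\<Prod>i\<in>{1..<r}. real k - real i) = P * (real k - real (Suc s))"
    unfolding P_def s by (subst prod.atLeastLessThan_Suc) auto
  have "(\<Prod>i\<in>{1..<r}. real (Suc k) - real i) = (\<Prod>i\<in>{0..<Suc s}. real k - real i)"
    unfolding s using prod.shift_bounds_Suc_ivl[of "\<lambda>i. real (Suc k) - real i" 0 "Suc s"] by simp
  also have "\<dots> = real k * P"
    unfolding P_def by (subst prod.atLeast_Suc_lessThan) auto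
  finally have b: "(\<Prod>i\<in>{1..<r}. real (Suc k) - real i) = real k * P" .
  have "real k * P * real k ^ (l - 1) = P * (real k - real (Suc s)) * real (Suc k) ^ (l - 1)"
    using eq assms r2 unfolding f_rl_def a b by (simp add: frac_eq_eq)
  then have "real k * real k ^ (l - 1) = (real k - real (Suc s)) * real (Suc k) ^ (l - 1)"
    using P by simp
  also have "real k - real (Suc s) = real (k - Suc s)" using assms s by (simp add: of_nat_diff)
  finally have "real (k * k ^ (l - 1)) = real ((k - Suc s) * Suc k ^ (l - 1))" by (simp only: of_nat_mult of_nat_power)
  then have "k * k ^ (l - 1) = (k - Suc s) * Suc k ^ (l - 1)" by (simp only: of_nat_eq_iff)
  moreover have "k * k ^ (l - 1) = k ^ l" using lr by (metis power_minus_mult mult.commute add_gr_0 less_le_trans zero_less_one)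
  moreover have "Suc k dvd Suc k ^ (l - 1)" using lr r2 by (intro dvd_power) auto
  ultimately have "Suc k dvd k ^ l" by (metis dvd_mult)
  moreover have "coprime (Suc k) (k ^ l)" by (simp add: coprime_Suc_left_nat)
  ultimately have "Suc k = 1" by (metis coprime_absorb_left is_unit_gcd nat_dvd_1_iff_1 coprime_common_divisor dvd_refl)
  then show False using assms r2 by simp
qed

lemma m_rl_maximiser: "r \<le> m_rl r l" "\<And>j. r \<le> j \<Longrightarrow> j \<noteq> m_rl r l \<Longrightarrow> f_rl r l j < f_rl r l (m_rl r l)"
proof -
  let ?P = "\<lambda>k. r \<le> k \<and> (\<forall>j\<ge>r. f_rl r l j \<le> f_rl r l k)"
  obtain k where k: "?P k" using f_rl_has_maximiser by blast
  have no: False if P: "?P k" "?P k'" and less: "k < k'" for k k'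
  proof (cases "k' = Suc k")
    case True
    have "f_rl r l (Suc k) = f_rl r l k" using P unfolding True by (metis order_antisym le_Suc_eq)
    then show False using f_rl_Suc_neq P by blast
  next
    case False
    \<comment> \<open>A point strictly between two maximisers. Both logarithms are at least the one
      at \<open>j\<close> and lie strictly below the tangent at \<open>1 / j\<close>, so its slope
      \<open>D\<close> would have to be positive towards one side and negative towards the
      other.\<close>
    define j where "j = Suc k"
    define D where "D = real (l - r) * real j - (\<Sum>i\<in>{1..<r}. real i / (1 - real i / real j))"
    have j: "k < j" "j < k'" "r \<le> j" using False less P by (auto simp: j_def)
    have ge: "0 \<le> ln (f_rl r l x) - ln (f_rl r l j)" if "?P x" for x
      using that j(3) f_rl_pos[of j] f_rl_pos[of x] by simp
    have "0 < (1 / real k - 1 / real j) * D"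
      using ge[OF P(1)] ln_f_rl_less_tangent[of k j] j P unfolding D_def by linarith
    moreover have "0 < 1 / real k - 1 / real j" using j P r2 by (simp add: field_simps)
    ultimately have "0 < D" by (simp add: zero_less_mult_iff)
    have "0 < (1 / real k' - 1 / real j) * D"
      using ge[OF P(2)] ln_f_rl_less_tangent[of k' j] j P unfolding D_def by linarith
    moreover have "1 / real k' - 1 / real j < 0" using j P r2 by (simp add: field_simps)
    ultimately show False using \<open>0 < D\<close> by (simp add: zero_less_mult_iff)
  qed
  have uniq: "k' = k" if "?P k'" for k'
    using no[OF k that] no[OF that k] by (metis linorder_neqE_nat)
  have "m_rl r l = k" unfolding m_rl_def by (rule the_equality[of ?P, OF k uniq])
  then show "r \<le> m_rl r l" using k by simp
  show "f_rl r l j < f_rl r l (m_rl r l)" if j: "r \<le> j" "j \<noteq> m_rl r l" for j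
  proof (rule ccontr)
    assume "\<not> ?thesis"
    then have "f_rl r l k \<le> f_rl r l j" using \<open>m_rl r l = k\<close> by simp
    then have "?P j" using k j(1) by (meson order_trans)
    then show False using uniq j(2) \<open>m_rl r l = k\<close> by blast
  qed
qed

lemma falling_m_rl: "real_of_int (falling (int (m_rl r l) - 1) (r - 1)) / real (m_rl r l) ^ (l - 1) = f_rl r l (m_rl r l)"
proof -
  have "falling (int (m_rl r l) - 1) (r - 1) = (\<Prod>i<r - 1. int (m_rl r l) - 1 - int i)"
    using m_rl_maximiser(1) r2 by (simp add: falling_def)
  then have "real_of_int (falling (int (m_rl r l) - 1) (r - 1)) = (\<Prod>i<r - 1. real (m_rl r l) - real (Suc i))"
    by (simp add: algebra_simps)
  also have "\<dots> = (\<Prod>i\<in>{Suc 0..<Suc (r - 1)}. real (m_rl r l) - real i)"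
    by (simp only: prod.shift_bounds_Suc_ivl lessThan_atLeast0)
  also have "{Suc 0..<Suc (r - 1)} = {1..<r}" using r2 by auto
  finally show ?thesis by (simp add: f_rl_def)
qed

end

text \<open>The first factor \<open>k\<close> of the falling factorial in
  \<open>psum_replicate\<close> lowers the exponent of \<open>k\<close> from \<open>l\<close> to
  \<open>l - 1\<close>.\<close>

lemma (in balanced_parts) equal_weight_eq_f_rl:
  assumes "1 \<le> k"
  shows "equal_weight k = f_rl (size M) (sum_mset M) k
    / ((\<Prod>\<alpha>\<in>#M. fact \<alpha>) * (\<Prod>\<alpha>\<in>set_mset M. fact (count M \<alpha>)))"
proof -
  let ?r = "size M" and ?l = "sum_mset M"
  have k: "0 < real k" using assms by simp
  have ne: "M \<noteq> {#}" using two_parts by auto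
  then obtain \<alpha> where "\<alpha> \<in># M" by blast
  then have l: "1 \<le> ?l" using part_ge_1 by (metis le_add1 le_trans sum_mset.remove)
  have pw: "(\<Prod>\<alpha>\<in>#M. pw x \<alpha>) = x ^ sum_mset M / (\<Prod>\<alpha>\<in>#M. fact \<alpha>)" for x
    by (induction M) (auto simp: pw_def power_add)
  have "{..<?r} = insert 0 {1..<?r}" using two_parts by auto
  then have ff: "(\<Prod>i<?r. real k - real i) = real k * (\<Prod>i\<in>{1..<?r}. real k - real i)" by simp
  have s: "(\<Prod>\<alpha>\<in>set_mset M. fact (count M \<alpha>)) \<noteq> (0::real)" by simp
  have "real k ^ ?l = real k * real k ^ (?l - 1)" using l by (metis One_nat_def Suc_pred less_eq_Suc_le power_Suc)
  then have "(1 / real k) ^ ?l * (real k * (\<Prod>i\<in>{1..<?r}. real k - real i)) = f_rl ?r ?l k"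
    using k by (simp add: f_rl_def power_one_over)
  moreover have "equal_weight k * (\<Prod>\<alpha>\<in>set_mset M. fact (count M \<alpha>))
      = (1 / real k) ^ ?l / (\<Prod>\<alpha>\<in>#M. fact \<alpha>) * (real k * (\<Prod>i\<in>{1..<?r}. real k - real i))"
    unfolding equal_weight_def psum_replicate pw ff by (rule refl)
  ultimately have "equal_weight k * (\<Prod>\<alpha>\<in>set_mset M. fact (count M \<alpha>)) = f_rl ?r ?l k / (\<Prod>\<alpha>\<in>#M. fact \<alpha>)"
    by (simp only: times_divide_eq_left)
  then have "equal_weight k = f_rl ?r ?l k / (\<Prod>\<alpha>\<in>#M. fact \<alpha>) / (\<Prod>\<alpha>\<in>set_mset M. fact (count M \<alpha>))"
    using s by (metis nonzero_mult_div_cancel_right)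
  then show ?thesis by (simp only: divide_divide_eq_left)
qed

section \<open>Balanced lists and the part sizes of the Turan graph\<close>

text \<open>Length and sum determine a balanced list up to order. This is what turns optimal part
  sizes into uniqueness of the extremal graph.\<close>

lemma balanced_list_mset:
  assumes "balanced_list xs" "xs \<noteq> []"
  shows "mset xs = replicate_mset (sum_list xs mod length xs) (Suc (sum_list xs div length xs))
     + replicate_mset (length xs - sum_list xs mod length xs) (sum_list xs div length xs)"
proof -
  define p where "p = Min (set xs)"
  define j where "j = length (filter (\<lambda>x. x \<noteq> p) xs)"
  have p: "p \<in> set xs" "\<forall>x\<in>set xs. p \<le> x" using assms(2) by (auto simp: p_def)
  have vals: "x = Suc p" if "x \<in> set xs" "x \<noteq> p" for x
    using assms(1) p that unfolding balanced_list_def by (metis Suc_eq_plus1 le_SucE le_antisym)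
  define i where "i = length (filter (\<lambda>x. x = p) xs)"
  have "filter (\<lambda>x. x \<noteq> p) xs = replicate j (Suc p)"
    unfolding j_def using vals by (intro replicate_eqI) auto
  moreover have "filter (\<lambda>x. x = p) xs = replicate i p"
    unfolding i_def by (intro replicate_eqI) auto
  moreover have "mset xs = mset (filter (\<lambda>x. x \<noteq> p) xs) + mset (filter (\<lambda>x. x = p) xs)"
    using multiset_partition[of "mset xs" "\<lambda>x. x \<noteq> p"] by (simp add: mset_filter)
  ultimately have ms: "mset xs = replicate_mset j (Suc p) + replicate_mset i p" by simp
  have len: "i + j = length xs" using arg_cong[OF ms, of size] by simp
  have "0 < i" using p(1) by (auto simp: i_def filter_empty_conv)
  then have j: "j < length xs" using len by simp
  have "sum_list xs = j * Suc p + i * p"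
    using arg_cong[OF ms, of sum_mset] by (simp add: sum_mset_sum_list)
  also have "\<dots> = length xs * p + j"
    by (simp add: len[symmetric] algebra_simps)
  finally have "sum_list xs = length xs * p + j" .
  then have "sum_list xs div length xs = p" "sum_list xs mod length xs = j"
    using j by (simp_all add: div_nat_eqI)
  moreover have "length xs - j = i" using len by simp
  ultimately show ?thesis using ms by simp
qed

lemma fibre_sizes_mod_balanced:
  assumes "mset xs = fibre_sizes (\<lambda>i. i mod m) {0..<n}" "0 < m" "m \<le> n"
  shows "balanced_list xs" "length xs = m"
proof -
  have im: "(\<lambda>i. i mod m) ` {0..<n} = {0..<m}"
  proof (intro equalityI subsetI)
    fix k assume "k \<in> {0..<m}"
    then show "k \<in> (\<lambda>i. i mod m) ` {0..<n}" using assms(3) by (intro image_eqI[of _ _ k]) auto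
  qed (use assms in auto)
  have "length xs = size (fibre_sizes (\<lambda>i. i mod m) {0..<n})" using assms(1) by (metis size_mset)
  then show "length xs = m" by (simp add: size_fibre_sizes im)
  let ?A = "\<lambda>k. {i\<in>{0..<n}. i mod m = k}"
  have le: "card (?A k) \<le> card (?A k') + 1" if k: "k < m" "k' < m" for k k'
  proof (cases "k' \<le> k")
    case True
    \<comment> \<open>Shifting down by \<open>k - k'\<close> never leaves the range.\<close>
    have "card (?A k) \<le> card (?A k')"
    proof (rule card_inj_on_le[of "\<lambda>i. i - (k - k')"])
      have ge: "k - k' \<le> i" if "i mod m = k" for i using that mod_less_eq_dividend[of i m] by linarith
      show "inj_on (\<lambda>i. i - (k - k')) (?A k)"
        using ge by (auto simp: inj_on_def) (metis eq_diff_iff)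
      show "(\<lambda>i. i - (k - k')) ` ?A k \<subseteq> ?A k'"
      proof clarify
        fix i assume i: "i \<in> {0..<n}" "k = i mod m"
        have "i = m * (i div m) + k" using i by simp
        then have "i - (k - k') = m * (i div m) + k'" using True by linarith
        then have "(i - (k - k')) mod m = k'" using k by simp
        then show "i - (i mod m - k') \<in> {0..<n} \<and> (i - (i mod m - k')) mod m = k'" using i by auto
      qed
    qed simp
    then show ?thesis by simp
  next
    case False
    \<comment> \<open>Shifting up could leave the range, so the shift is followed by subtracting
      \<open>m\<close>. Only the smallest element \<open>k\<close> has no image, which accounts for
      the extra 1.\<close>
    have "card (?A k - {k}) \<le> card (?A k')"
    proof (rule card_inj_on_le[of "\<lambda>i. i + (k' - k) - m"])
      have ge: "m \<le> i" if "i mod m = k" "i \<noteq> k" for i using that by (metis mod_less not_le_imp_less)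
      show "inj_on (\<lambda>i. i + (k' - k) - m) (?A k - {k})"
      proof (rule inj_onI)
        fix x y assume xy: "x \<in> ?A k - {k}" "y \<in> ?A k - {k}" "x + (k' - k) - m = y + (k' - k) - m"
        then have "m \<le> x" "m \<le> y" using ge by auto
        then show "x = y" using xy(3) by linarith
      qed
      show "(\<lambda>i. i + (k' - k) - m) ` (?A k - {k}) \<subseteq> ?A k'"
      proof (rule image_subsetI)
        fix i assume "i \<in> ?A k - {k}"
        then have i: "i < n" "i mod m = k" "m \<le> i" using ge by auto
        then obtain q where q: "i div m = Suc q" using assms(2) by (metis Suc_pred div_greater_zero_iff)
        have "i = m * (i div m) + k" using i(2) by (metis mult_div_mod_eq)
        then have "i = m * q + m + k" using q by simp
        then have "i + (k' - k) - m = m * q + k'" using False by linarith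
        then have "(i + (k' - k) - m) mod m = k'" using k by simp
        moreover have "i + (k' - k) - m < n" using i k by linarith
        ultimately show "i + (k' - k) - m \<in> ?A k'" by simp
      qed
    qed simp
    moreover have "card (?A k) \<le> card (?A k - {k}) + 1" by (simp add: card_Diff_singleton_if) linarith
    ultimately show ?thesis by linarith
  qed
  have "set xs = set_mset (fibre_sizes (\<lambda>i. i mod m) {0..<n})" using assms(1) by (metis set_mset_mset)
  also have "\<dots> = (\<lambda>k. card (?A k)) ` {0..<m}" by (simp only: fibre_sizes_def set_image_mset im finite_set_mset_mset_set finite_atLeastLessThan)
  finally show "balanced_list xs" using le by (auto simp: balanced_list_def)
qed

lemma binomial_div_power_tendsto: "(\<lambda>n. real (n choose l) / real n ^ l) \<longlonglongrightarrow> 1 / fact l"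
proof -
  have "(\<lambda>n. (\<Prod>i<l. 1 - real i / real n) / fact l) \<longlonglongrightarrow> (\<Prod>i<l. 1 - 0) / fact l"
    by (intro tendsto_divide tendsto_prod tendsto_diff tendsto_const lim_const_over_n) simp
  moreover have "eventually (\<lambda>n. (\<Prod>i<l. 1 - real i / real n) / fact l = real (n choose l) / real n ^ l) sequentially"
    using eventually_gt_at_top[of 0]
  proof eventually_elim
    case (elim n)
    have "fact l * real (n choose l) = (\<Prod>i<l. real n * (1 - real i / real n))"
      using fact_mult_cw[of l n] elim by (simp add: cw_def right_diff_distrib)
    also have "\<dots> = real n ^ l * (\<Prod>i<l. 1 - real i / real n)" by (simp add: prod.distrib)
    finally show ?case using elim by (simp add: field_simps)
  qed
  ultimately show ?thesis by (simp add: filterlim_cong[OF refl refl])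
qed

section \<open>Main result\<close>

lemma balanced_parts_mset:
  assumes "length a \<ge> 2" "\<forall>x\<in>set a. x \<ge> 1" "sorted_wrt (\<ge>) a" "almost_balanced a"
  shows "balanced_parts (mset a)"
proof
  fix \<alpha> \<beta> assume "\<alpha> \<in># mset a" "\<beta> \<in># mset a"
  then have ab: "\<alpha> \<in> set a" "\<beta> \<in> set a" by auto
  have hd: "x \<le> hd a" and last: "last a \<le> x" if "x \<in> set a" for x
  proof -
    obtain i where i: "i < length a" "x = a ! i" using \<open>x \<in> set a\<close> by (auto simp: in_set_conv_nth)
    have mono: "a ! k \<le> a ! j" if "j \<le> k" "k < length a" for j k
      using sorted_wrt_nth_less[OF assms(3), of j k] that by (cases "j = k") auto
    have "a \<noteq> []" using i by auto
    then show "x \<le> hd a" "last a \<le> x"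
      using i mono[of 0 i] mono[of i "length a - 1"] by (auto simp: hd_conv_nth last_conv_nth)
  qed
  have "\<alpha> - \<beta> \<le> hd a - last a" using hd[OF ab(1)] last[OF ab(2)] by linarith
  then have "(\<alpha> - \<beta>) choose 2 \<le> (hd a - last a) choose 2" by (rule binomial_right_mono)
  also have "\<dots> < last a" using assms(4) by (simp add: almost_balanced_def)
  also have "\<dots> \<le> \<beta>" by (rule last[OF ab(2)])
  finally show "(\<alpha> - \<beta>) choose 2 < \<beta>" .
next
  obtain x where x: "x \<in> set a" "x \<noteq> 1" using assms(4) by (auto simp: almost_balanced_def)
  then have "1 \<le> x" using assms(2) by blast
  with x have "2 \<le> x" by linarith
  with x(1) show "\<exists>\<alpha>\<in>#mset a. 2 \<le> \<alpha>" by auto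
qed (use assms in auto)

theorem theorem1p1:
  fixes r l :: nat and a :: "nat list"
  assumes "r \<ge> 2" and "l \<ge> r + 1"
    and "length a = r" and "\<forall>x\<in>set a. x \<ge> 1" and "sorted_wrt (\<ge>) a"
    and "sum_list a = l"
    and "almost_balanced a"
  shows "(\<lambda>n. real (max_induced l (complete_multipartite a) n) / real (n choose l))
           \<longlonglongrightarrow> kappa a * real_of_int (falling (int (m_rl r l) - 1) (r - 1))
                         / real (m_rl r l) ^ (l - 1)
       \<and> (\<exists>N. \<forall>n\<ge>N.
           induced_count l (complete_multipartite a) n (turan (m_rl r l) n)
             = max_induced l (complete_multipartite a) n
         \<and> (\<forall>E. simple_graph n E \<and>
                 induced_count l (complete_multipartite a) n E = max_induced l (complete_multipartite a) n
                 \<longrightarrow> graph_iso n E (turan (m_rl r l) n)))"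
proof -
  define m where "m = m_rl r l"
  define M where "M = mset a"
  have lr: "r + 1 \<le> l" by (rule assms(2))
  have rm: "r \<le> m" unfolding m_def by (rule m_rl_maximiser(1)[OF assms(1) lr])
  have sizes: "size M = r" "sum_mset M = l" using assms(3,6) by (simp_all add: M_def sum_mset_sum_list)
  interpret balanced_parts M
    unfolding M_def using assms by (intro balanced_parts_mset) auto
  \<comment> \<open>The common denominator of all equal weights, so comparing them amounts to
    comparing the values of \<open>f_rl\<close>. It is also the denominator of
    \<open>kappa a\<close>.\<close>
  define C where "C = (\<Prod>\<alpha>\<in>#M. fact \<alpha>) * (\<Prod>\<alpha>\<in>set_mset M. fact (count M \<alpha>) :: real)"
  have C: "0 < C" unfolding C_def by (intro mult_pos_pos prod_pos) (induction M; simp)+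
  have ew: "equal_weight k = f_rl r l k / C" if "1 \<le> k" for k
    using equal_weight_eq_f_rl[OF that] by (simp add: C_def sizes)
  interpret balanced_parts_max M m
  proof
    show "2 \<le> m" using rm assms(1) by simp
    fix k :: nat assume k: "1 \<le> k" "k \<noteq> m"
    have "f_rl r l k < f_rl r l m"
    proof (cases "r \<le> k")
      case True
      then show ?thesis unfolding m_def by (rule m_rl_maximiser(2)[OF assms(1) lr]) (use k m_def in simp)
    next
      case False
      \<comment> \<open>For \<open>1 \<le> k < r\<close> the factor with \<open>i = k\<close>
        vanishes.\<close>
      then have "(\<Prod>i\<in>{1..<r}. real k - real i) = 0" using k by (intro prod_zero) auto
      then have "f_rl r l k = 0" by (simp add: f_rl_def)
      then show ?thesis using f_rl_pos[OF assms(1) lr rm] by simp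
    qed
    then show "equal_weight k < equal_weight m"
      using k rm assms(1) C by (simp add: ew divide_strict_right_mono)
  qed
  let ?F = "complete_multipartite a"
  have count: "real (induced_count l ?F n E) = psum cw M xs"
    if "multipartite n E c" "mset xs = fibre_sizes c {0..<n}" for n E c xs
    using induced_count_multipartite[OF assms(4) that] assms(6) by (simp add: M_def)
  have parts: "sum_list xs = n" "\<forall>x\<in>set xs. 1 \<le> x" if "mset xs = fibre_sizes c {0..<n}" for c :: "nat \<Rightarrow> nat" and n xs
  proof -
    have "sum_list xs = sum_mset (fibre_sizes c {0..<n})" using that by (metis sum_mset_sum_list)
    then show "sum_list xs = n" by (simp add: sum_fibre_sizes)
    have "set xs = set_mset (fibre_sizes c {0..<n})" using that by (metis set_mset_mset)
    then show "\<forall>x\<in>set xs. 1 \<le> x" using fibre_sizes_pos[of "{0..<n}" _ c] by auto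
  qed
  have le_max: "psum cw M ys \<le> real (max_induced l ?F n)"
    if "sum_list ys = n" "\<forall>y\<in>set ys. 1 \<le> y" for ys n
  proof -
    have "multipartite n (complete_multipartite ys) (part_index ys)"
      using that(1) by (simp add: multipartite_def complete_multipartite_def)
    moreover have "mset ys = fibre_sizes (part_index ys) {0..<n}"
      using fibre_sizes_part_index[OF that(2)] that(1) by simp
    ultimately have "psum cw M ys = real (induced_count l ?F n (complete_multipartite ys))"
      by (rule count[symmetric])
    moreover have "simple_graph n (complete_multipartite ys)"
      unfolding simple_graph_def complete_multipartite_def that(1)[symmetric]
      by (intro conjI allI impI) auto
    ultimately show ?thesis using induced_count_le_max by simp
  qed
  have ex_parts: "\<exists>xs. sum_list xs = n \<and> (\<forall>x\<in>set xs. 1 \<le> x) \<and> real (max_induced l ?F n) = psum cw M xs" for n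
  proof -
    obtain E c where Ec: "extremal a n E" "multipartite n E c" using ex_extremal_multipartite by blast
    obtain xs where xs: "mset xs = fibre_sizes c {0..<n}" using ex_mset by auto
    have "real (max_induced l ?F n) = psum cw M xs"
      using count[OF Ec(2) xs] Ec(1) assms(6) by (simp add: extremal_def)
    with parts[OF xs] show ?thesis by blast
  qed
  \<comment> \<open>Balanced lists give the lower bound. The upper bound is \<open>weight_le\<close>
    applied to the class sizes of a complete multipartite extremal graph.\<close>
  have "(\<lambda>n. real (max_induced l ?F n) / real n ^ l) \<longlonglongrightarrow> equal_weight m"
  proof (rule LIMSEQ_I)
    fix \<theta> :: real assume "0 < \<theta>"
    then have "0 < \<theta> / 2" by simp
    then obtain N :: nat where N: "\<And>n xs. \<lbrakk>N \<le> n; balanced_list xs; length xs = m; sum_list xs = n\<rbrakk>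
      \<Longrightarrow> real n ^ sum_mset M * (equal_weight m - \<theta> / 2) \<le> psum cw M xs"
      by (rule balanced_list_psum_ge) (rule that)
    show "\<exists>N. \<forall>n\<ge>N. norm (real (max_induced l ?F n) / real n ^ l - equal_weight m) < \<theta>"
    proof (intro exI[of _ "N + m"] allI impI)
      fix n assume "N + m \<le> n"
      then have n: "N \<le> n" "m \<le> n" "0 < n" using rm assms(1) by auto
      then have p: "0 < real n ^ l" by simp
      obtain bs where bs: "balanced_list bs" "length bs = m" "sum_list bs = n" "\<forall>x\<in>set bs. 1 \<le> x"
        by (rule ex_balanced_list[OF n(2)]) (rule that)
      have "real n ^ l * (equal_weight m - \<theta> / 2) \<le> real (max_induced l ?F n)"
        using N[OF n(1) bs(1-3)] le_max[OF bs(3,4)] by (simp add: sizes)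
      then have lo: "equal_weight m - \<theta> / 2 \<le> real (max_induced l ?F n) / real n ^ l"
        using p by (simp add: pos_le_divide_eq mult.commute)
      obtain xs where xs: "sum_list xs = n" "real (max_induced l ?F n) = psum cw M xs" using ex_parts by blast
      have "psum cw M xs \<le> real n ^ l * weight (map (\<lambda>x. real x / n) xs)"
        using psum_cw_le_equal_weight(1)[OF xs(1) n(3)] by (simp add: sizes)
      also have "\<dots> \<le> real n ^ l * equal_weight m"
        by (intro mult_left_mono weight_le psum_cw_le_equal_weight(2)[OF xs(1) n(3)]) simp
      finally have "real (max_induced l ?F n) / real n ^ l \<le> equal_weight m"
        using p xs(2) by (simp add: pos_divide_le_eq mult.commute)
      with lo show "norm (real (max_induced l ?F n) / real n ^ l - equal_weight m) < \<theta>"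
        using \<open>0 < \<theta>\<close> by (simp add: abs_less_iff)
    qed
  qed
  from tendsto_divide[OF this binomial_div_power_tendsto[of l]]
  have "(\<lambda>n. real (max_induced l ?F n) / real n ^ l / (real (n choose l) / real n ^ l)) \<longlonglongrightarrow> equal_weight m / (1 / fact l)"
    by simp
  moreover have "eventually (\<lambda>n. real (max_induced l ?F n) / real n ^ l / (real (n choose l) / real n ^ l)
      = real (max_induced l ?F n) / real (n choose l)) sequentially"
    using eventually_gt_at_top[of 0] by eventually_elim simp
  ultimately have lim: "(\<lambda>n. real (max_induced l ?F n) / real (n choose l)) \<longlonglongrightarrow> equal_weight m / (1 / fact l)"
    by (rule Lim_transform_eventually)
  have "(\<Prod>\<alpha>\<in>#mset xs. fact \<alpha>) = real (\<Prod>x\<leftarrow>xs. fact x)" for xs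
    by (induction xs) auto
  then have "C = real (\<Prod>x\<leftarrow>a. fact x) * real (sym_factor a)"
    by (simp add: C_def M_def sym_factor_def count_mset)
  then have "kappa a = fact l / C" by (simp add: kappa_def assms(6))
  moreover have "1 \<le> m" using rm assms(1) by simp
  ultimately have "equal_weight m / (1 / fact l) = kappa a * f_rl r l m"
    by (simp add: ew)
  also have "\<dots> = kappa a * real_of_int (falling (int (m_rl r l) - 1) (r - 1)) / real (m_rl r l) ^ (l - 1)"
    unfolding m_def falling_m_rl[OF assms(1) lr, symmetric] by simp
  finally have limit: "(\<lambda>n. real (max_induced l ?F n) / real (n choose l))
     \<longlonglongrightarrow> kappa a * real_of_int (falling (int (m_rl r l) - 1) (r - 1)) / real (m_rl r l) ^ (l - 1)"
    using lim by simp
  obtain N0 :: nat where N0: "\<And>n xs. \<lbrakk>N0 \<le> n; sum_list xs = n; \<forall>x\<in>set xs. 1 \<le> x;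
      \<forall>ys. sum_list ys = n \<and> (\<forall>y\<in>set ys. 1 \<le> y) \<longrightarrow> psum cw M ys \<le> psum cw M xs\<rbrakk>
      \<Longrightarrow> length xs = m \<and> balanced_list xs"
    by (rule optimal_parts_balanced) (rule that)
  have main: "induced_count l ?F n (turan m n) = max_induced l ?F n
      \<and> (\<forall>E. simple_graph n E \<and> induced_count l ?F n E = max_induced l ?F n \<longrightarrow> graph_iso n E (turan m n))"
    if "N0 + m \<le> n" for n
  proof -
    have n: "N0 \<le> n" "m \<le> n" "0 < m" using that rm assms(1) by auto
    have ext_parts: "length xs = m \<and> balanced_list xs"
      if E: "extremal a n E" "multipartite n E c" and xs: "mset xs = fibre_sizes c {0..<n}" for E c xs
    proof (rule N0[OF n(1) parts[OF xs]], intro allI impI)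
      fix ys assume "sum_list ys = n \<and> (\<forall>y\<in>set ys. 1 \<le> y)"
      with le_max[of ys n] show "psum cw M ys \<le> psum cw M xs"
        using count[OF E(2) xs] E(1) assms(6) by (simp add: extremal_def)
    qed
    define t where "t i = i mod m" for i :: nat
    have turan: "multipartite n (turan m n) t"
      by (simp add: multipartite_def turan_def t_def)
    obtain ts where ts: "mset ts = fibre_sizes t {0..<n}" using ex_mset by auto
    have ts_bal: "balanced_list ts" "length ts = m"
      using fibre_sizes_mod_balanced[OF ts[unfolded t_def] n(3,2)] by auto
    \<comment> \<open>Both colourings have balanced class sizes with the same number of classes and
      the same total, hence the same class sizes.\<close>
    have same: "fibre_sizes c {0..<n} = fibre_sizes t {0..<n}"
      if "extremal a n E" "multipartite n E c" for E c
    proof -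
      obtain xs where xs: "mset xs = fibre_sizes c {0..<n}" using ex_mset by auto
      have "length xs = m" "balanced_list xs" using ext_parts[OF that xs] by auto
      moreover have "xs \<noteq> []" "ts \<noteq> []" using \<open>length xs = m\<close> ts_bal(2) n(3) by auto
      ultimately have "mset xs = mset ts"
        using balanced_list_mset[of xs] balanced_list_mset[of ts] ts_bal parts(1)[OF xs] parts(1)[OF ts] by simp
      then show ?thesis using xs ts by simp
    qed
    have all_mp: "\<exists>c. multipartite n E c" if "extremal a n E" for E
    proof (rule extremal_multipartite[OF _ that])
      fix E c assume Ec: "extremal a n E" "multipartite n E c"
      obtain xs where xs: "mset xs = fibre_sizes c {0..<n}" using ex_mset by auto
      have "card (c ` {0..<n}) = size (mset xs)" by (simp only: xs size_fibre_sizes)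
      then show "card (c ` {0..<n}) = m" using ext_parts[OF Ec xs] by simp
    qed
    have "induced_count l ?F n (turan m n) = max_induced l ?F n"
    proof -
      obtain E c where Ec: "extremal a n E" "multipartite n E c" using ex_extremal_multipartite by blast
      have "mset ts = fibre_sizes c {0..<n}" using same[OF Ec] ts by simp
      from count[OF Ec(2) this] count[OF turan ts] have "induced_count l ?F n (turan m n) = induced_count l ?F n E"
        by simp
      then show ?thesis using Ec(1) assms(6) by (simp add: extremal_def)
    qed
    moreover have "graph_iso n E (turan m n)"
      if "simple_graph n E" "induced_count l ?F n E = max_induced l ?F n" for E
    proof -
      have ext: "extremal a n E" using that assms(6) by (simp add: extremal_def)
      then obtain c where c: "multipartite n E c" using all_mp by blast
      have "\<exists>f. bij_betw f {0..<n} {0..<n} \<and> (\<forall>i\<in>{0..<n}. \<forall>j\<in>{0..<n}. c i = c j \<longleftrightarrow> t (f i) = t (f j))"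
        using same[OF ext c] by (subst (asm) fibre_sizes_eq_iff) auto
      then obtain f where f: "bij_betw f {0..<n} {0..<n}" "\<And>i j. i < n \<Longrightarrow> j < n \<Longrightarrow> c i = c j \<longleftrightarrow> t (f i) = t (f j)"
        by auto
      have fn: "f i < n" if "i < n" for i using bij_betwE[OF f(1)] that by simp
      have "E i j \<longleftrightarrow> turan m n (f i) (f j)" if "i < n" "j < n" for i j
      proof -
        have "E i j \<longleftrightarrow> c i \<noteq> c j" using c that by (simp add: multipartite_def)
        also have "\<dots> \<longleftrightarrow> turan m n (f i) (f j)"
          using turan fn[OF that(1)] fn[OF that(2)] f(2)[OF that] by (simp add: multipartite_def)
        finally show ?thesis .
      qed
      then show ?thesis unfolding graph_iso_def using f(1) by blast
    qed
    ultimately show ?thesis by blast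
  qed
  have "\<exists>N. \<forall>n\<ge>N. induced_count l ?F n (turan (m_rl r l) n) = max_induced l ?F n
      \<and> (\<forall>E. simple_graph n E \<and> induced_count l ?F n E = max_induced l ?F n \<longrightarrow> graph_iso n E (turan (m_rl r l) n))"
    unfolding m_def[symmetric] by (intro exI[of _ "N0 + m"] allI impI main)
  with limit show ?thesis by (rule conjI)
qed

end
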